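(* Let $p$ and $k$ be fixed integers with $0<k\le p$, let $\alpha\in(0,1)$, and let $\Sigma_0$ be a positive definite $k$-banded $p\times p$ matrix. Let $X_1,X_2,\dots$ be i.i.d. from $N_p(0,\Sigma_0)$ and $\mathbb{X}_n=(X_1,\dots,X_n)^T$. Let $[\theta_1\mid\mathbb{X}_n]_{PPP,0}$, $[\theta_1\mid\mathbb{X}_n]_{PPP}$ and $[\theta_1\mid\mathbb{X}_n]_C$ be, respectively, the post-processed posterior using only the $k$-band operation, the $k$-banding post-processed posterior with positive-definiteness adjustment $\epsilon_n$ (where $\epsilon_n>0$ decreases to $0$), and the conventional posterior, and let $(\hat\theta_1^*,\hat\theta_2^* )$, $\hat\theta_1$, $L_n$, $\mathcal{I}$, $\mathcal{I}_{11}$, $\mathcal{I}_{11\cdot2}$ be the unrestricted and restricted maximum likelihood estimators, the log-likelihood, and the Fisher-information quantities, all as defined in the context. Assume: (A1) (Bernstein-von Mises condition) $$\lim_{n\to\infty}E_{\Sigma_0}\Big\|\,[n^{1/2}(\theta_1(\Sigma)-\hat\theta_1^* )\mid\mathbb{X}_n]_{PPP,0}-N\big(0,\mathcal{I}_{11\cdot2}^{-1}\{\theta_1(\Sigma_0),0\}\big)\Big\|_{TV}=0,$$ $$\lim_{n\to\infty}E_{\Sigma_0}\Big\|\,[n^{1/2}(\theta_1(\Sigma)-\hat\theta_1)\mid\mathbb{X}_n]_{C}-N\big(0,\mathcal{I}_{11}^{-1}\{\theta_1(\Sigma_0),0\}\big)\Big\|_{TV}=0.$$ (A2) As $n\to\infty$,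 under $\Sigma_0$: $n^{-1/2}L_n'\{\theta_1(\Sigma_0),0\}$ converges in distribution to $N[0,\mathcal{I}\{\theta_1(\Sigma_0),0\}]$; $(\hat\theta_1^*,\hat\theta_2^* )$ converges in probability to $\{\theta_1(\Sigma_0),0\}$; $\hat\theta_1$ converges in probability to $\theta_1(\Sigma_0)$; and $L_n''$ is continuous at $\{\theta_1(\Sigma_0),0\}$. If $C_{1-\alpha,n}$ is the $(1-\alpha)100\%$ highest posterior density region of $[\theta_1\mid\mathbb{X}_n]_{PPP}$, then $$\lim_{n\to\infty}E_{\Sigma_0}\big\{[\theta_1(\Sigma)\in C_{1-\alpha,n}\mid\mathbb{X}_n]_C\big\}=1-\alpha.$$
   Context: Parametrization. $\mathcal{C}_p$ is the set of $p\times p$ positive definite matrices. A matrix $\Sigma=(\sigma_{ij})$ is $k$-banded if $\sigma_{ij}=0$ whenever $|i-j|>k$. For symmetric $\Sigma$, $\theta_1=\theta_1(\Sigma)=(\sigma_{ij}:|i-j|\le k)$ and $\theta_2=\theta_2(\Sigma)=(\sigma_{ij}:|i-j|>k)$, viewed as vectors of the distinct entries ($i\le j$); $\Sigma(\theta_1,\theta_2)$ denotes the symmetric matrix with these entries. (If $\theta_2$ is empty, it is simply omitted and $\mathcal{I}_{11\cdot2}=\mathcal{I}_{11}=\mathcal I$.) $p(\mathbb{X}_n\mid\Sigma)$ is the joint density of $X_1,\dots,X_n$ i.i.d. $N_p(0,\Sigma)$. $E_{\Sigma_0}$ is expectation over $X_1,\dots,X_n$ i.i.d. $N_p(0,\Sigma_0)$.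 Bracket notation. $[h\mid\mathbb{X}_n]_{*}$ denotes the conditional distribution of $h$ given $\mathbb{X}_n$ under the posterior labelled $*$, and $[h\in A\mid\mathbb{X}_n]_{*}$ the corresponding conditional probability. Posteriors. The initial prior $\pi^i$ on $\mathcal{C}_p$ is the inverse-Wishart $IW_p(B_0,\nu_0)$, with density proportional to $|\Sigma|^{-\nu_0/2}\exp\{-\mathrm{tr}(\Sigma^{-1}B_0)/2\}$, where $\nu_0>2p$ and $B_0\in\mathcal{C}_p$ are fixed. The initial posterior $\pi^i(\cdot\mid\mathbb{X}_n)$ is $IW_p(B_0+nS_n,\nu_0+n)$ with $S_n=n^{-1}\sum_{i=1}^nX_iX_i^T$. - $[\theta_1\mid\mathbb{X}_n]_{PPP,0}$ is the marginal distribution of $\theta_1(\Sigma)$ under the initial posterior, i.e. it has density $\int\pi^i(\theta_1,\theta_2\mid\mathbb{X}_n)\,d\theta_2\propto\int\pi^i(\theta_1,\theta_2)\,p\{\mathbb{X}_n\mid\Sigma(\theta_1,\theta_2)\}\,d\theta_2$. - $[\theta_1\mid\mathbb{X}_n]_{PPP}$ is the distribution of $\theta_1\big(B_k^{(\epsilon_n)}(\Sigma)\big)$ when $\Sigma$ is drawn from the initial posterior, where $B_k(B)=(b_{ij}I(|i-j|\le k))_{i,j}$ for $B=(b_{ij})$, and $B_k^{(\epsilon_n)}(\Sigma)=B_k(\Sigma)+[\epsilon_n-\lambda_{\min}\{B_k(\Sigma)\}]I_p$ if $\lambda_{\min}\{B_k(\Sigma)\}<\epsilon_n$, and $B_k^{(\epsilon_n)}(\Sigma)=B_k(\Sigma)$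 otherwise; $\lambda_{\min}$ is the minimum eigenvalue. - $[\theta_1\mid\mathbb{X}_n]_C$ is the conventional posterior: given a prior density $\pi^c(\theta_1)$ for $k$-banded covariance matrices (supported on those $\theta_1$ with $\Sigma(\theta_1,0)\in\mathcal{C}_p$), it has density $\pi^c(\theta_1\mid\mathbb{X}_n)\propto\pi^c(\theta_1)\,p\{\mathbb{X}_n\mid\Sigma(\theta_1,0)\}$. Likelihood quantities. $L_n(\theta_1,\theta_2)=\log p\{\mathbb{X}_n\mid\Sigma(\theta_1,\theta_2)\}$; $L_n'$ and $L_n''$ are its first and second derivatives with respect to $\theta=(\theta_1,\theta_2)$. $(\hat\theta_1^*,\hat\theta_2^* )=\mathrm{argmax}_{\theta_1,\theta_2}L_n(\theta_1,\theta_2)$ and $\hat\theta_1=\mathrm{argmax}_{\theta_1}L_n(\theta_1,0)$, the maxima being over parameters giving positive definite matrices. The (per-observation) Fisher information matrix is $$\mathcal{I}(\theta_1,\theta_2)=E_{\Sigma(\theta_1,\theta_2)}\Big\{\Big[\tfrac{\partial}{\partial\theta}\log p\{X_1\mid\Sigma(\theta_1,\theta_2)\}\Big]^T\Big[\tfrac{\partial}{\partial\theta}\log p\{X_1\mid\Sigma(\theta_1,\theta_2)\}\Big]\Big\}=\begin{pmatrix}\mathcal{I}_{11}&\mathcal{I}_{12}\\ \mathcal{I}_{21}&\mathcal{I}_{22}\end{pmatrix}$$ (derivatives written as row vectors, blocks according to $(\theta_1,\theta_2)$), and $\mathcal{I}_{11\cdot2}=\mathcal{I}_{11}-\mathcal{I}_{12}\mathcal{I}_{22}^{-1}\mathcal{I}_{21}$.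 Other conventions. $N(0,V)$ denotes the multivariate normal probability measure with mean zero and covariance $V$. For probability measures $P,Q$ on a $\sigma$-field $\mathcal{M}$, $\|P-Q\|_{TV}=\sup_{A\in\mathcal{M}}|P(A)-Q(A)|$. The $(1-\alpha)100\%$ highest posterior density region of a posterior is the set of the form $\{\theta_1:f_n(\theta_1)\ge c\}$ having posterior probability $1-\alpha$, where $f_n$ is the posterior density with respect to Lebesgue measure (of its absolutely continuous part, if there is a singular part) and $c$ is a threshold depending on $\mathbb{X}_n$. *)

theory Defs
  imports "HOL-Probability.Probability"
begin

section \<open>Covariance matrices and their parametrization\<close>

type_synonym 'n rvec = "(real, 'n) vec"
type_synonym 'n sqmat = "((real, 'n) vec, 'n) vec"

text \<open>
  A matrix dimension \<open>p\<close> is the cardinality of a finite linearly ordered index type;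
  \<open>pos\<close> is the (zero-based) position of an index, so that only differences of positions matter.
\<close>

definition pos :: "'p::{finite,linorder} \<Rightarrow> nat" where
  "pos i = card {j. j < i}"

definition in_band :: "nat \<Rightarrow> 'p::{finite,linorder} \<Rightarrow> 'p \<Rightarrow> bool" where
  "in_band k i j \<longleftrightarrow> \<bar>int (pos i) - int (pos j)\<bar> \<le> int k"

definition k_banded :: "nat \<Rightarrow> ('p::{finite,linorder}) sqmat \<Rightarrow> bool" where
  "k_banded k \<Sigma> \<longleftrightarrow> (\<forall>i j. \<not> in_band k i j \<longrightarrow> \<Sigma> $ i $ j = 0)"

definition posdef :: "('n::finite) sqmat \<Rightarrow> bool" where
  "posdef A \<longleftrightarrow> transpose A = A \<and> (\<forall>v. v \<noteq> 0 \<longrightarrow> v \<bullet> (A *v v) > 0)"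

text \<open>
  The distinct entries of a symmetric matrix are indexed by the pairs \<open>(i, j)\<close> with \<open>i \<le> j\<close>;
  \<open>'p param\<close> is the space of the full parameter \<open>\<theta> = (\<theta>\<^sub>1, \<theta>\<^sub>2)\<close>.
\<close>

typedef (overloaded) ('p::linorder) upper = "{(i, j). i \<le> (j::'p)}"
  by auto

instance upper :: ("{finite,linorder}") finite
proof
  have "finite (Rep_upper ` (UNIV :: 'a upper set))"
    by (rule finite_subset[OF subset_UNIV]) simp
  then show "finite (UNIV :: 'a upper set)"
    by (rule finite_imageD) (simp add: inj_on_def Rep_upper_inject)
qed

type_synonym 'p param = "'p upper rvec"

definition theta :: "('p::{finite,linorder}) sqmat \<Rightarrow> 'p param" where
  "theta \<Sigma> = (\<chi> u. \<Sigma> $ fst (Rep_upper u) $ snd (Rep_upper u))"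

definition Sig :: "('p::{finite,linorder}) param \<Rightarrow> 'p sqmat" where
  "Sig \<theta> = (\<chi> i j. \<theta> $ Abs_upper (min i j, max i j))"

definition band :: "nat \<Rightarrow> ('p::{finite,linorder}) upper set" where
  "band k = {u. in_band k (fst (Rep_upper u)) (snd (Rep_upper u))}"

text \<open>
  The coordinates of \<open>\<theta>\<^sub>1\<close> are indexed by a type \<open>'b\<close> together with an
  enumeration \<open>e\<close> of \<open>band k\<close>, so that \<open>\<theta>\<^sub>1\<close> lives in the Euclidean space \<open>'b rvec\<close>. The coordinates
  of \<open>\<theta>\<^sub>2\<close>, of which there may be none, are those outside \<open>range e\<close>.
  \<open>zero_ext e \<theta>\<^sub>1\<close> is the full parameter \<open>(\<theta>\<^sub>1, 0)\<close>.
\<close>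

definition band_part :: "('b::finite \<Rightarrow> ('p::{finite,linorder}) upper) \<Rightarrow> 'p param \<Rightarrow> 'b rvec" where
  "band_part e \<theta> = (\<chi> a. \<theta> $ e a)"

definition theta1 :: "('b::finite \<Rightarrow> ('p::{finite,linorder}) upper) \<Rightarrow> 'p sqmat \<Rightarrow> 'b rvec" where
  "theta1 e \<Sigma> = band_part e (theta \<Sigma>)"

definition zero_ext :: "('b::finite \<Rightarrow> ('p::{finite,linorder}) upper) \<Rightarrow> 'b rvec \<Rightarrow> 'p param" where
  "zero_ext e \<theta>\<^sub>1 = (\<chi> u. if u \<in> range e then \<theta>\<^sub>1 $ inv e u else 0)"


section \<open>Gaussian sampling model\<close>

text \<open>The centred normal law with covariance \<open>V\<close>, only meaningful for positive definite \<open>V\<close>.\<close>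

definition mvn_density :: "('n::finite) sqmat \<Rightarrow> 'n rvec \<Rightarrow> real" where
  "mvn_density V x =
     exp (- (x \<bullet> (matrix_inv V *v x)) / 2) / sqrt ((2 * pi) ^ CARD('n) * det V)"

definition mvn :: "('n::finite) sqmat \<Rightarrow> 'n rvec measure" where
  "mvn V = density lborel (\<lambda>x. ennreal (mvn_density V x))"

text \<open>
  The law of the data \<open>(X\<^sub>1, \<dots>, X\<^sub>n)\<close>, i.i.d. \<open>N\<^sub>p(0, \<Sigma>)\<close>, with observations numbered from \<open>0\<close>.
\<close>

definition sampling :: "('p::finite) sqmat \<Rightarrow> nat \<Rightarrow> (nat \<Rightarrow> 'p rvec) measure" where
  "sampling \<Sigma> n = (\<Pi>\<^sub>M i\<in>{..<n}. mvn \<Sigma>)"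

definition lik :: "nat \<Rightarrow> (nat \<Rightarrow> ('p::finite) rvec) \<Rightarrow> 'p sqmat \<Rightarrow> real" where
  "lik n x \<Sigma> = (\<Prod>i<n. mvn_density \<Sigma> (x i))"

definition loglik :: "nat \<Rightarrow> (nat \<Rightarrow> ('p::{finite,linorder}) rvec) \<Rightarrow> 'p param \<Rightarrow> real" where
  "loglik n x \<theta> = ln (lik n x (Sig \<theta>))"

definition grad :: "(('d::finite) rvec \<Rightarrow> real) \<Rightarrow> 'd rvec \<Rightarrow> 'd rvec" where
  "grad f \<theta> = (\<chi> u. frechet_derivative f (at \<theta>) (axis u 1))"

definition hessian :: "(('d::finite) rvec \<Rightarrow> real) \<Rightarrow> 'd rvec \<Rightarrow> 'd sqmat" where
  "hessian f \<theta> = jacobian (grad f) (at \<theta>)"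

definition fisher :: "('p::{finite,linorder}) param \<Rightarrow> 'p upper sqmat" where
  "fisher \<theta> = (\<chi> u v. \<integral>x. grad (\<lambda>\<theta>'. ln (mvn_density (Sig \<theta>') x)) \<theta> $ u *
                          grad (\<lambda>\<theta>'. ln (mvn_density (Sig \<theta>') x)) \<theta> $ v \<partial>mvn (Sig \<theta>))"

text \<open>
  The inverse of the principal submatrix of \<open>A\<close> with rows and columns in \<open>J\<close>, obtained as the
  \<open>J\<close>-block of the inverse of the block-diagonal matrix that agrees with \<open>A\<close> on \<open>J\<close> and with the
  identity on the complement. Only its entries indexed by \<open>J\<close> are meaningful; \<open>J\<close> may be empty.
\<close>

definition block_inv :: "('d::finite) set \<Rightarrow> 'd sqmat \<Rightarrow> 'd sqmat" where
  "block_inv J A = matrix_inv (\<chi> u v. if u \<in> J \<and> v \<in> J then A $ u $ v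
                                       else if u = v then 1 else 0)"

definition fisher11 ::
  "('b::finite \<Rightarrow> ('p::{finite,linorder}) upper) \<Rightarrow> 'p param \<Rightarrow> 'b sqmat" where
  "fisher11 e \<theta> = (\<chi> a b. fisher \<theta> $ e a $ e b)"

definition fisher11_2 ::
  "('b::finite \<Rightarrow> ('p::{finite,linorder}) upper) \<Rightarrow> 'p param \<Rightarrow> 'b sqmat" where
  "fisher11_2 e \<theta> = (\<chi> a b. fisher11 e \<theta> $ a $ b -
     (\<Sum>u\<in>- range e. \<Sum>v\<in>- range e.
        fisher \<theta> $ e a $ u * block_inv (- range e) (fisher \<theta>) $ u $ v * fisher \<theta> $ v $ e b))"


section \<open>Posteriors\<close>

definition normalized :: "('a::euclidean_space \<Rightarrow> real) \<Rightarrow> 'a measure" where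
  "normalized f = density lborel (\<lambda>t. ennreal (f t) / (\<integral>\<^sup>+s. ennreal (f s) \<partial>lborel))"

text \<open>
  The inverse-Wishart law of \<open>\<Sigma>\<close>, given as the law of the parameter \<open>\<theta>\<close> with \<open>\<Sigma> = Sig \<theta>\<close>.
\<close>

definition inverse_wishart :: "('p::{finite,linorder}) sqmat \<Rightarrow> real \<Rightarrow> 'p param measure" where
  "inverse_wishart B \<nu> = normalized (\<lambda>\<theta>.
     if posdef (Sig \<theta>)
     then det (Sig \<theta>) powr (- \<nu> / 2) * exp (- trace (matrix_inv (Sig \<theta>) ** B) / 2)
     else 0)"

definition sample_cov :: "nat \<Rightarrow> (nat \<Rightarrow> ('p::finite) rvec) \<Rightarrow> 'p sqmat" where
  "sample_cov n x = (1 / real n) *\<^sub>R (\<Sum>i<n. \<chi> a b. x i $ a * x i $ b)"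

definition initial_posterior ::
  "('p::{finite,linorder}) sqmat \<Rightarrow> real \<Rightarrow> nat \<Rightarrow> (nat \<Rightarrow> 'p rvec) \<Rightarrow> 'p param measure" where
  "initial_posterior B\<^sub>0 \<nu>\<^sub>0 n x = inverse_wishart (B\<^sub>0 + real n *\<^sub>R sample_cov n x) (\<nu>\<^sub>0 + real n)"

definition lambda_min :: "('n::finite) sqmat \<Rightarrow> real" where
  "lambda_min A = Min {l. \<exists>v. v \<noteq> 0 \<and> A *v v = l *\<^sub>R v}"

definition banding :: "nat \<Rightarrow> ('p::{finite,linorder}) sqmat \<Rightarrow> 'p sqmat" where
  "banding k B = (\<chi> i j. if in_band k i j then B $ i $ j else 0)"

definition adj_banding :: "real \<Rightarrow> nat \<Rightarrow> ('p::{finite,linorder}) sqmat \<Rightarrow> 'p sqmat" where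
  "adj_banding \<epsilon> k B =
     (if lambda_min (banding k B) < \<epsilon>
      then banding k B + (\<epsilon> - lambda_min (banding k B)) *\<^sub>R mat 1
      else banding k B)"

definition ppp0_posterior ::
  "('b::finite \<Rightarrow> ('p::{finite,linorder}) upper) \<Rightarrow> 'p sqmat \<Rightarrow> real \<Rightarrow>
     nat \<Rightarrow> (nat \<Rightarrow> 'p rvec) \<Rightarrow> 'b rvec measure" where
  "ppp0_posterior e B\<^sub>0 \<nu>\<^sub>0 n x =
     distr (initial_posterior B\<^sub>0 \<nu>\<^sub>0 n x) borel (\<lambda>\<theta>. theta1 e (Sig \<theta>))"

definition ppp_posterior ::
  "('b::finite \<Rightarrow> ('p::{finite,linorder}) upper) \<Rightarrow> nat \<Rightarrow> (nat \<Rightarrow> real) \<Rightarrow> 'p sqmat \<Rightarrow> real \<Rightarrow>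
     nat \<Rightarrow> (nat \<Rightarrow> 'p rvec) \<Rightarrow> 'b rvec measure" where
  "ppp_posterior e k \<epsilon> B\<^sub>0 \<nu>\<^sub>0 n x =
     distr (initial_posterior B\<^sub>0 \<nu>\<^sub>0 n x) borel (\<lambda>\<theta>. theta1 e (adj_banding (\<epsilon> n) k (Sig \<theta>)))"

definition conventional_posterior ::
  "('b::finite \<Rightarrow> ('p::{finite,linorder}) upper) \<Rightarrow> ('b rvec \<Rightarrow> real) \<Rightarrow>
     nat \<Rightarrow> (nat \<Rightarrow> 'p rvec) \<Rightarrow> 'b rvec measure" where
  "conventional_posterior e \<pi>c n x =
     normalized (\<lambda>\<theta>\<^sub>1. \<pi>c \<theta>\<^sub>1 * lik n x (Sig (zero_ext e \<theta>\<^sub>1)))"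

definition banded_prior ::
  "('b::finite \<Rightarrow> ('p::{finite,linorder}) upper) \<Rightarrow> ('b rvec \<Rightarrow> real) \<Rightarrow> bool" where
  "banded_prior e \<pi>c \<longleftrightarrow>
     \<pi>c \<in> borel_measurable borel \<and> (\<forall>t. 0 \<le> \<pi>c t) \<and>
     (\<forall>t. \<not> posdef (Sig (zero_ext e t)) \<longrightarrow> \<pi>c t = 0) \<and>
     (\<integral>\<^sup>+t. ennreal (\<pi>c t) \<partial>lborel) = 1"

text \<open>The law of \<open>n\<^sup>1\<^sup>/\<^sup>2 (\<theta>\<^sub>1 - c)\<close> for \<open>\<theta>\<^sub>1\<close> distributed as \<open>P\<close>.\<close>

definition rescaled :: "nat \<Rightarrow> ('b::finite) rvec measure \<Rightarrow> 'b rvec \<Rightarrow> 'b rvec measure" where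
  "rescaled n P c = distr P borel (\<lambda>t. sqrt (real n) *\<^sub>R (t - c))"

text \<open>
  \<open>f\<close> is a version of the density of the absolutely continuous part of \<open>P\<close>: in the Lebesgue
  decomposition of \<open>P\<close>, the singular part is the restriction of \<open>P\<close> to the null set \<open>N\<close>.
\<close>

definition ac_density :: "('b::finite) rvec measure \<Rightarrow> ('b rvec \<Rightarrow> real) \<Rightarrow> bool" where
  "ac_density P f \<longleftrightarrow>
     f \<in> borel_measurable borel \<and> (\<forall>t. 0 \<le> f t) \<and>
     (\<exists>N\<in>sets borel. emeasure lborel N = 0 \<and>
        (\<forall>A\<in>sets borel. emeasure P (A - N) = (\<integral>\<^sup>+t\<in>A. ennreal (f t) \<partial>lborel)))"

definition hpd_region :: "real \<Rightarrow> ('b::finite) rvec measure \<Rightarrow> 'b rvec set \<Rightarrow> bool" where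
  "hpd_region \<alpha> P C \<longleftrightarrow>
     (\<exists>f c. ac_density P f \<and> C = {t. f t \<ge> c} \<and> measure P C = 1 - \<alpha>)"


section \<open>Modes of convergence\<close>

definition tv_dist :: "'a measure \<Rightarrow> 'a measure \<Rightarrow> real" where
  "tv_dist P Q = (SUP A\<in>sets P. \<bar>measure P A - measure Q A\<bar>)"

definition conv_in_prob :: "(nat \<Rightarrow> 'a measure) \<Rightarrow> (nat \<Rightarrow> 'a \<Rightarrow> 'b::metric_space) \<Rightarrow> 'b \<Rightarrow> bool" where
  "conv_in_prob P T c \<longleftrightarrow>
     (\<forall>r>0. (\<lambda>n. measure (P n) {x \<in> space (P n). dist (T n x) c > r}) \<longlonglongrightarrow> 0)"

definition conv_in_distr ::
  "(nat \<Rightarrow> 'a measure) \<Rightarrow> (nat \<Rightarrow> 'a \<Rightarrow> 'b::metric_space) \<Rightarrow> 'b measure \<Rightarrow> bool" where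
  "conv_in_distr P T Q \<longleftrightarrow>
     (\<forall>g :: 'b \<Rightarrow> real. continuous_on UNIV g \<and> bounded (range g) \<longrightarrow>
        (\<lambda>n. \<integral>x. g (T n x) \<partial>P n) \<longlonglongrightarrow> (\<integral>y. g y \<partial>Q))"

text \<open>
  \<open>Q\<close> holds with probability tending to one. Defining properties of maximum likelihood estimators
  and highest posterior density regions are required in this form, since for small \<open>n\<close>
  (e.g. \<open>n < p\<close>, where the Gaussian likelihood is unbounded) or exceptional data the maximizer, or a
  region of exact level \<open>1 - \<alpha>\<close>, need not exist.
\<close>

definition with_high_prob :: "(nat \<Rightarrow> 'a measure) \<Rightarrow> (nat \<Rightarrow> 'a \<Rightarrow> bool) \<Rightarrow> bool" where
  "with_high_prob P Q \<longleftrightarrow>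
     (\<exists>G. (\<forall>n. G n \<in> sets (P n) \<and> (\<forall>x\<in>G n. Q n x)) \<and> (\<lambda>n. measure (P n) (G n)) \<longlonglongrightarrow> 1)"

end

theory Submission
  imports Defs
begin

text \<open>
  Write \<open>I\<close> for the Fisher information at the true parameter, \<open>V\<^sub>1 = I\<^sub>1\<^sub>1\<^sub>\<cdot>\<^sub>2\<^sup>-\<^sup>1\<close> and
  \<open>V\<^sub>2 = I\<^sub>1\<^sub>1\<^sup>-\<^sup>1\<close>. The two posteriors have different limits: the post-processed one looks like
  \<open>N(0, V\<^sub>1)\<close> around the unrestricted estimator, the conventional one like \<open>N(0, V\<^sub>2)\<close> around the
  restricted estimator. The larger variance \<open>V\<^sub>1\<close> exactly compensates for the wrong centre. Indeed,
  the rescaled gap \<open>T\<close> between the two estimators is asymptotically \<open>N(0, V\<^sub>1 - V\<^sub>2)\<close>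
  (\<open>mle_gap_variance\<close>), so that a conventional posterior draw, centred at the unrestricted estimator
  and averaged over the data, is the sum of independent \<open>N(0, V\<^sub>2)\<close> and \<open>N(0, V\<^sub>1 - V\<^sub>2)\<close> variables,
  that is \<open>N(0, V\<^sub>1)\<close> (\<open>mvn_convolution\<close>). The highest density region of the post-processed posterior
  is asymptotically the superlevel set \<open>E\<close> of the density of \<open>N(0, V\<^sub>1)\<close> with probability \<open>1 - \<alpha>\<close>, and
  therefore the limit is \<open>1 - \<alpha>\<close>.

  The gap is treated without expanding the likelihood. In the Gaussian covariance model the score at
  \<open>\<theta>\<close> is \<open>n I(\<theta>) (\<theta>(S\<^sub>n) - \<theta>)\<close> (\<open>has_derivative_loglik\<close>). Hence the unrestricted estimator is
  \<open>\<theta>(S\<^sub>n)\<close>, and the gap is a linear image of the score at the true parameter whose matrix depends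
  continuously on the restricted estimator alone (\<open>mle_gap_eq\<close>); consistency of that estimator and the
  limit law of the score give the limit law of the gap (\<open>mle_difference_asymptotic\<close>). That \<open>I(\<theta>)\<close> is
  both the matrix in the score and its variance is a fourth moment computation, which the spectral
  theorem reduces to independent \<open>\<chi>\<^sup>2\<close> variables (\<open>gscore_variance\<close>).

  Three approximations lead from the posteriors to this limit experiment. The positive definiteness
  adjustment acts only where the smallest eigenvalue is below \<open>\<epsilon>\<^sub>n\<close>, an event of vanishing posterior
  probability (\<open>ppp_close_to_normal\<close>). Closeness in total variation forces the highest density region
  towards \<open>E\<close> (\<open>hpd_region_close\<close>); as sets of small \<open>N(0, V\<^sub>1)\<close> probability have small probability
  under boundedly shifted copies of \<open>N(0, V\<^sub>2)\<close>, the region may be replaced by \<open>E\<close> in the conventional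
  posterior (\<open>credible_region_transfer\<close>). Finally the shift is replaced by its limit, using continuity
  of \<open>t \<mapsto> N(0, V\<^sub>2) (E - t)\<close>.

  The hypotheses bound expectations of total variation distances. To extract bounds in probability
  from them, these distances have to be measurable functions of the data, which follows since the
  total variation distance is a countable supremum (\<open>borel_measurable_tv_dist\<close>).
\<close>

section \<open>Symmetric matrices\<close>

lemma symmetric_inner:
  fixes A :: "('n::finite) sqmat"
  assumes "transpose A = A"
  shows "v \<bullet> (A *v w) = w \<bullet> (A *v v)"
  by (metis assms dot_lmul_matrix inner_commute transpose_matrix_vector)

lemma quadratic_zero_cross_term:
  fixes a b :: real
  assumes "\<And>t. 0 \<le> 2 * t * a + t\<^sup>2 * b"
  shows "a = 0"
proof (rule ccontr)
  assume a: "a \<noteq> 0"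
  (* at t = - a / c the expression is a^2 (b - 2 c) / c^2, negative as soon as c > b / 2 *)
  define c where "c = \<bar>b\<bar> + 1"
  have c: "c > 0" "b < 2 * c" unfolding c_def by auto
  have "0 \<le> 2 * (- a / c) * a + (- a / c)\<^sup>2 * b" by (rule assms)
  also have "\<dots> = (a\<^sup>2 / c\<^sup>2) * (b - 2 * c)"
    using c by (simp add: field_simps power2_eq_square)
  also have "\<dots> < 0"
    using a c by (intro mult_pos_neg) auto
  finally show False by simp
qed

text \<open>
  Moving from the minimizer \<open>v\<close> on the unit sphere of \<open>S\<close> in a direction \<open>w\<close> orthogonal to it cannot
  decrease the quotient, which forces \<open>w \<bullet> A v = 0\<close>. For \<open>w = A v - m v\<close>, which lies in \<open>S\<close> by
  invariance, this reads \<open>w \<bullet> w = 0\<close>.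
\<close>

lemma rayleigh_minimizer:
  fixes A :: "('n::finite) sqmat" and S :: "'n rvec set"
  assumes sym: "transpose A = A" and S: "subspace S" "S \<noteq> {0}"
    and inv: "\<And>v. v \<in> S \<Longrightarrow> A *v v \<in> S"
  obtains v m where "v \<in> S" "norm v = 1" "A *v v = m *\<^sub>R v"
    "\<And>w. w \<in> S \<Longrightarrow> m * (w \<bullet> w) \<le> w \<bullet> (A *v w)"
proof -
  define K where "K = S \<inter> sphere 0 1"
  have "compact K"
    unfolding K_def using closed_subspace[OF S(1)] by (simp add: closed_Int_compact)
  moreover have "K \<noteq> {}"
  proof -
    obtain u where u: "u \<in> S" "u \<noteq> 0" using S subspace_0 by blast
    then have "u /\<^sub>R norm u \<in> K"
      using S(1) by (simp add: K_def subspace_scale)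
    then show ?thesis by blast
  qed
  moreover have "continuous_on K (\<lambda>v. v \<bullet> (A *v v))"
    by (intro continuous_intros)
  ultimately obtain v where v: "v \<in> K" and min: "\<And>w. w \<in> K \<Longrightarrow> v \<bullet> (A *v v) \<le> w \<bullet> (A *v w)"
    using continuous_attains_inf[of K "\<lambda>v. v \<bullet> (A *v v)"] by blast
  define m where "m = v \<bullet> (A *v v)"
  have vS: "v \<in> S" and nv: "norm v = 1" using v by (auto simp: K_def)
  have le: "m * (w \<bullet> w) \<le> w \<bullet> (A *v w)" if "w \<in> S" for w
  proof (cases "w = 0")
    case False
    then have "w /\<^sub>R norm w \<in> K"
      using S(1) that by (simp add: K_def subspace_scale)
    then have "m \<le> (w /\<^sub>R norm w) \<bullet> (A *v (w /\<^sub>R norm w))"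
      unfolding m_def by (rule min)
    also have "\<dots> = (w \<bullet> (A *v w)) / (w \<bullet> w)"
      by (simp add: matrix_vector_mult_scaleR vec.scale divide_inverse dot_square_norm power2_eq_square mult_ac
          scaleR_matrix_vector_assoc[symmetric])
    finally show ?thesis
      using False by (simp add: pos_le_divide_eq)
  qed simp
  have vv: "v \<bullet> v = 1" using nv by (simp add: dot_square_norm)
  have cross: "w \<bullet> (A *v v) = 0" if w: "w \<in> S" "w \<bullet> v = 0" for w
  proof (rule quadratic_zero_cross_term)
    fix t :: real
    have "v + t *\<^sub>R w \<in> S"
      using vS w S(1) by (simp add: subspace_add subspace_scale)
    from le[OF this] show "0 \<le> 2 * t * (w \<bullet> (A *v v)) + t\<^sup>2 * (w \<bullet> (A *v w) - m * (w \<bullet> w))"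
      using w(2) symmetric_inner[OF sym, of v w]
      by (simp add: matrix_vector_mult_scaleR matrix_vector_right_distrib inner_add_left inner_add_right
          inner_commute[of v w] vv m_def[symmetric] algebra_simps power2_eq_square)
  qed
  define w where "w = A *v v - m *\<^sub>R v"
  have "w \<in> S" unfolding w_def by (intro subspace_diff subspace_scale S inv vS)
  moreover have "w \<bullet> v = 0"
    by (simp add: w_def inner_diff_left vv m_def inner_commute[of "A *v v"])
  ultimately have "w \<bullet> (A *v v) = 0" using cross by blast
  then have "w \<bullet> w = 0"
    using \<open>w \<bullet> v = 0\<close> by (simp add: w_def inner_diff_right)
  then have "A *v v = m *\<^sub>R v" by (simp add: w_def)
  then show ?thesis using that vS nv le by blast
qed

text \<open>
  Spectral theorem: eigenvectors are found one at a time, each minimizing the Rayleigh quotient on the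
  orthogonal complement of its predecessors, which \<open>A\<close> leaves invariant.
\<close>

lemma spectral_theorem:
  fixes A :: "('n::finite) sqmat"
  assumes sym: "transpose A = A"
  obtains r :: "'n \<Rightarrow> 'n rvec" and m :: "'n \<Rightarrow> real"
  where "\<And>i j. r i \<bullet> r j = (if i = j then 1 else 0)" "\<And>i. A *v r i = m i *\<^sub>R r i"
proof -
  have "\<exists>r m. (\<forall>i\<in>I. \<forall>j\<in>I. r i \<bullet> r j = (if i = j then 1 else 0)) \<and> (\<forall>i\<in>I. A *v r i = m i *\<^sub>R r i)"
    for I :: "'n set"
  proof (induction I rule: infinite_finite_induct)
    case (insert k I)
    then obtain r :: "'n \<Rightarrow> 'n rvec" and m
      where r: "\<And>i j. i \<in> I \<Longrightarrow> j \<in> I \<Longrightarrow> r i \<bullet> r j = (if i = j then 1 else 0)"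
        and eig: "\<And>i. i \<in> I \<Longrightarrow> A *v r i = m i *\<^sub>R r i" by metis
    define S where "S = {v. \<forall>i\<in>I. v \<bullet> r i = 0}"
    have sub: "subspace S"
      by (auto simp: S_def subspace_def inner_add_left)
    have "card (r ` I) \<le> card I" by (rule card_image_le) (rule insert)
    also have "card I < CARD('n)"
      using insert by (metis finite_code psubset_card_mono UNIV_I psubsetI subset_UNIV)
    finally have "dim (span (r ` I)) < DIM('n rvec)"
      by (simp add: dim_span) (meson dim_le_card' finite_code finite_imageI order_le_less_trans)
    then obtain v where v: "v \<noteq> 0" "\<And>y. y \<in> span (r ` I) \<Longrightarrow> orthogonal v y"
      using orthogonal_to_subspace_exists[of "r ` I"] by (auto simp: dim_span)
    have "v \<in> S"
      using v(2) by (auto simp: S_def orthogonal_def intro: span_base)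
    then have "S \<noteq> {0}" using v(1) by blast
    moreover have inv: "A *v w \<in> S" if w: "w \<in> S" for w
    proof -
      have "(A *v w) \<bullet> r i = 0" if i: "i \<in> I" for i
      proof -
        have "(A *v w) \<bullet> r i = w \<bullet> (A *v r i)"
          by (metis inner_commute symmetric_inner[OF sym])
        then show ?thesis using w eig[OF i] i by (simp add: S_def)
      qed
      then show ?thesis by (simp add: S_def)
    qed
    ultimately obtain u \<mu> where u: "u \<in> S" "norm u = 1" "A *v u = \<mu> *\<^sub>R u"
      by (metis (no_types) rayleigh_minimizer[OF sym sub])
    have uu: "u \<bullet> u = 1" using u(2) by (simp add: dot_square_norm)
    have "(r(k := u)) i \<bullet> (r(k := u)) j = (if i = j then 1 else 0)"
      if "i \<in> insert k I" "j \<in> insert k I" for i j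
      using that r u(1) uu insert.hyps(2) by (auto simp: S_def inner_commute)
    moreover have "A *v (r(k := u)) i = (m(k := \<mu>)) i *\<^sub>R (r(k := u)) i" if "i \<in> insert k I" for i
      using that eig u(3) by auto
    ultimately show ?case by blast
  qed auto
  from this[of UNIV] show ?thesis using that by auto
qed

text \<open>
  \<open>lambda_min\<close> is a \<open>Min\<close>, hence informative only once the set of eigenvalues is known to be finite
  and nonempty: every eigenvalue occurs in the spectral theorem, and the Rayleigh minimizer provides
  one.
\<close>

lemma lambda_min_symmetric:
  fixes A :: "('n::finite) sqmat"
  assumes sym: "transpose A = A"
  shows "c \<le> lambda_min A \<longleftrightarrow> (\<forall>v. c * (v \<bullet> v) \<le> v \<bullet> (A *v v))"
proof -
  let ?L = "{l. \<exists>v. v \<noteq> 0 \<and> A *v v = l *\<^sub>R v}"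
  obtain r m where r: "\<And>i j::'n. r i \<bullet> r j = (if i = j then 1 else 0)" "\<And>i. A *v r i = m i *\<^sub>R r i"
    using spectral_theorem[OF sym] by blast
  have indep: "independent (range r)"
  proof (rule pairwise_orthogonal_independent)
    show "pairwise orthogonal (range r)"
      using r(1) by (auto simp: pairwise_def orthogonal_def)
    show "0 \<notin> range r" using r(1) by (metis imageE inner_zero_left zero_neq_one)
  qed
  have "inj r" using r(1) by (metis injI zero_neq_one)
  then have "span (range r) = UNIV"
    using indep card_image[of r UNIV] by (metis DIM_cart DIM_real dim_UNIV dim_eq_card_independent dim_eq_full
      mult.right_neutral)
  have "?L \<subseteq> range m"
  proof
    fix l assume "l \<in> ?L"
    then obtain v where v: "v \<noteq> 0" "A *v v = l *\<^sub>R v" by blast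
    have "\<exists>i. v \<bullet> r i \<noteq> 0"
    proof (rule ccontr)
      assume "\<not> ?thesis"
      then have "orthogonal v v"
        using \<open>span (range r) = UNIV\<close> by (intro orthogonal_to_span[of v "range r"]) (auto simp: orthogonal_def)
      then show False using v(1) by (simp add: orthogonal_def)
    qed
    then obtain i where i: "v \<bullet> r i \<noteq> 0" by blast
    have "l * (v \<bullet> r i) = r i \<bullet> (A *v v)" by (simp add: v(2) inner_commute)
    also have "\<dots> = v \<bullet> (A *v r i)" by (rule symmetric_inner[OF sym])
    also have "\<dots> = m i * (v \<bullet> r i)" by (simp add: r(2))
    finally show "l \<in> range m" using i by simp
  qed
  then have fin: "finite ?L" by (rule finite_subset) simp
  have "(UNIV :: 'n rvec set) \<noteq> {0}"
    by (metis UNIV_I axis_eq_0_iff singletonD zero_neq_one)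
  then obtain v \<mu> where v: "norm v = 1" "A *v v = \<mu> *\<^sub>R v"
    "\<And>w. \<mu> * (w \<bullet> w) \<le> w \<bullet> (A *v w)"
    using rayleigh_minimizer[OF sym, of UNIV] by (metis UNIV_I subspace_UNIV)
  have "v \<noteq> 0" using v(1) by auto
  have mu: "\<mu> \<in> ?L" using v \<open>v \<noteq> 0\<close> by blast
  have "lambda_min A = \<mu>"
    unfolding lambda_min_def
  proof (rule Min_eqI[OF fin _ mu])
    fix l assume "l \<in> ?L"
    then obtain w where w: "w \<noteq> 0" "A *v w = l *\<^sub>R w" by blast
    then show "\<mu> \<le> l" using v(3)[of w] by simp
  qed
  then show ?thesis
  proof (intro iffI allI)
    fix w :: "'n rvec" assume "lambda_min A = \<mu>" "c \<le> lambda_min A"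
    then have "c * (w \<bullet> w) \<le> \<mu> * (w \<bullet> w)" by (intro mult_right_mono) auto
    then show "c * (w \<bullet> w) \<le> w \<bullet> (A *v w)" using v(3)[of w] by simp
  next
    assume "lambda_min A = \<mu>" "\<forall>w. c * (w \<bullet> w) \<le> w \<bullet> (A *v w)"
    then have "c * (v \<bullet> v) \<le> v \<bullet> (A *v v)" by blast
    then show "c \<le> lambda_min A"
      using v \<open>v \<noteq> 0\<close> \<open>lambda_min A = \<mu>\<close> by simp
  qed
qed

section \<open>Positive definite matrices\<close>

lemma posdefD:
  assumes "posdef A"
  shows "transpose A = A" "v \<noteq> 0 \<Longrightarrow> v \<bullet> (A *v v) > 0"
  using assms by (auto simp: posdef_def)

lemma posdef_coercive:
  fixes A :: "('n::finite) sqmat"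
  assumes "posdef A"
  obtains c where "c > 0" "\<And>v. c * (v \<bullet> v) \<le> v \<bullet> (A *v v)"
proof -
  have "(UNIV :: 'n rvec set) \<noteq> {0}"
    by (metis UNIV_I axis_eq_0_iff singletonD zero_neq_one)
  then obtain v \<mu> where v: "norm v = 1" "A *v v = \<mu> *\<^sub>R v"
    "\<And>w. \<mu> * (w \<bullet> w) \<le> w \<bullet> (A *v w)"
    using rayleigh_minimizer[OF posdefD(1)[OF assms], of UNIV] by (metis UNIV_I subspace_UNIV)
  have "v \<noteq> 0" using v(1) by auto
  then have "\<mu> > 0" using posdefD(2)[OF assms, of v] v
    by (auto simp: dot_square_norm)
  then show ?thesis using that v(3) by blast
qed

lemma matrix_inv_lr:
  fixes A :: "('n::finite) sqmat"
  assumes "invertible A"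
  shows "A ** matrix_inv A = mat 1" "matrix_inv A ** A = mat 1"
  using someI_ex[of "\<lambda>A'. A ** A' = mat 1 \<and> A' ** A = mat 1"] assms
  unfolding invertible_def matrix_inv_def by auto

lemma matrix_inv_eqI:
  fixes A B :: "('n::finite) sqmat"
  assumes "A ** B = mat 1"
  shows "matrix_inv A = B"
proof -
  have "B ** A = mat 1" using assms matrix_left_right_inverse by blast
  then have "invertible A" using assms by (auto simp: invertible_def)
  then have "matrix_inv A = (B ** A) ** matrix_inv A" using \<open>B ** A = mat 1\<close> by simp
  also have "\<dots> = B" using matrix_inv_lr[OF \<open>invertible A\<close>] by (simp add: matrix_mul_assoc[symmetric])
  finally show ?thesis .
qed

lemma posdef_invertible:
  fixes A :: "('n::finite) sqmat"
  assumes "posdef A"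
  shows "invertible A"
proof -
  have "\<forall>x. A *v x = 0 \<longrightarrow> x = 0"
    using posdefD(2)[OF assms] by (metis inner_zero_right less_irrefl)
  then obtain B where "B ** A = mat 1" using matrix_left_invertible_ker by blast
  then show ?thesis by (auto simp: invertible_def matrix_left_right_inverse)
qed

lemmas posdef_inv = matrix_inv_lr[OF posdef_invertible]

lemma matrix_vector_inv:
  fixes A :: "('n::finite) sqmat"
  assumes "invertible A"
  shows "A *v (matrix_inv A *v x) = x" "matrix_inv A *v (A *v x) = x"
  using matrix_inv_lr[OF assms] by (simp_all add: matrix_vector_mul_assoc)

lemma posdef_matrix_inv:
  fixes A :: "('n::finite) sqmat"
  assumes "posdef A"
  shows "posdef (matrix_inv A)"
  unfolding posdef_def
proof (intro conjI allI impI)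
  note inv = posdef_inv[OF assms]
  have "A ** transpose (matrix_inv A) = transpose (matrix_inv A ** A)"
    by (simp add: matrix_transpose_mul posdefD(1)[OF assms])
  also have "\<dots> = mat 1" by (simp add: inv transpose_mat)
  finally show "transpose (matrix_inv A) = matrix_inv A" using matrix_inv_eqI by metis
  fix v :: "'n rvec" assume "v \<noteq> 0"
  define w where "w = matrix_inv A *v v"
  have Aw: "A *v w = v" by (simp add: w_def matrix_vector_inv posdef_invertible assms)
  then have "w \<noteq> 0" using \<open>v \<noteq> 0\<close> by auto
  then have "w \<bullet> (A *v w) > 0" using posdefD(2)[OF assms] by blast
  then show "0 < v \<bullet> (matrix_inv A *v v)" using Aw by (simp add: w_def[symmetric] inner_commute)
qed

lemma norm_matrix_vector_mult_le:
  fixes A :: "real^'n^'m"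
  shows "norm (A *v x) \<le> norm A * norm x"
proof -
  have "norm (A *v x) = L2_set (\<lambda>i. norm (A $ i \<bullet> x)) UNIV"
    unfolding norm_vec_def by (rule arg_cong2[where f=L2_set]) (auto simp: matrix_vector_mul_component)
  also have "\<dots> \<le> L2_set (\<lambda>i. norm (A $ i) * norm x) UNIV"
    by (rule L2_set_mono) (auto simp: Cauchy_Schwarz_ineq2)
  also have "\<dots> = norm A * norm x"
    unfolding norm_vec_def[of A] by (simp add: L2_set_left_distrib)
  finally show ?thesis .
qed

lemma quadratic_form_bound:
  fixes A :: "('n::finite) sqmat"
  shows "\<bar>v \<bullet> (A *v v)\<bar> \<le> norm A * (v \<bullet> v)"
proof -
  have "\<bar>v \<bullet> (A *v v)\<bar> \<le> norm v * norm (A *v v)" by (rule Cauchy_Schwarz_ineq2)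
  also have "\<dots> \<le> norm v * (norm A * norm v)" by (intro mult_left_mono norm_matrix_vector_mult_le) auto
  finally show ?thesis by (simp add: dot_square_norm power2_eq_square mult_ac)
qed

section \<open>The Gaussian law\<close>

lemma nn_integral_lborel_vec_prod:
  fixes f :: "'n::finite \<Rightarrow> real \<Rightarrow> ennreal"
  assumes [measurable]: "\<And>i. f i \<in> borel_measurable borel"
  shows "(\<integral>\<^sup>+x. (\<Prod>i\<in>UNIV. f i (x $ i)) \<partial>(lborel :: 'n rvec measure)) = (\<Prod>i\<in>UNIV. \<integral>\<^sup>+t. f i t \<partial>lborel)"
proof -
  let ?e = "\<lambda>i::'n. axis i (1::real)"
  let ?g = "\<lambda>b. f (inv ?e b)"
  have inj: "inj ?e" by (auto simp: inj_on_def axis_eq_axis)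
  have B: "(Basis :: 'n rvec set) = range ?e"
    by (auto simp: Basis_vec_def)
  have "(\<integral>\<^sup>+x. (\<Prod>i\<in>UNIV. f i (x $ i)) \<partial>(lborel :: 'n rvec measure))
      = (\<integral>\<^sup>+x. (\<Prod>b\<in>Basis. ?g b (x \<bullet> b)) \<partial>lborel)"
    unfolding B by (simp add: prod.reindex[OF inj] inv_f_f[OF inj] inner_axis)
  also have "\<dots> = (\<Prod>b\<in>Basis. (\<integral>\<^sup>+t. ?g b t \<partial>lborel))"
    by (rule nn_integral_lborel_prod) auto
  also have "\<dots> = (\<Prod>i\<in>UNIV. \<integral>\<^sup>+t. f i t \<partial>lborel)"
    unfolding B by (simp add: prod.reindex[OF inj] inv_f_f[OF inj])
  finally show ?thesis .
qed

lemma nn_integral_lborel_translate: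
  fixes f :: "'a::euclidean_space \<Rightarrow> ennreal"
  assumes [measurable]: "f \<in> borel_measurable borel"
  shows "(\<integral>\<^sup>+x. f (c + x) \<partial>lborel) = (\<integral>\<^sup>+x. f x \<partial>lborel)"
proof -
  have "(\<integral>\<^sup>+x. f x \<partial>lborel) = (\<integral>\<^sup>+x. f x \<partial>distr lborel borel ((+) c))"
    by (simp add: lborel_distr_plus)
  then show ?thesis by (simp add: nn_integral_distr)
qed

lemma borel_measurable_matrix_vector_mult[measurable]:
  fixes A :: "real^'n^'m"
  shows "f \<in> borel_measurable M \<Longrightarrow> (\<lambda>x. A *v f x) \<in> borel_measurable M"
  by (rule borel_measurable_continuous_on[where f="(*v) A"]) (auto intro!: continuous_intros)

lemma matrix_vimage_borel[measurable]:
  fixes A :: "real^'n^'m"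
  shows "S \<in> sets borel \<Longrightarrow> (*v) A -` S \<in> sets borel"
  using measurable_sets_borel[of "(*v) A" borel S] borel_measurable_matrix_vector_mult[of "\<lambda>x. x" borel A]
    by simp

lemma orthogonal_matrix_norm:
  fixes Q :: "('n::finite) sqmat"
  assumes "transpose Q ** Q = mat 1"
  shows "(Q *v x) \<bullet> (Q *v y) = x \<bullet> y"
  by (metis assms dot_lmul_matrix matrix_vector_mul_assoc matrix_vector_mul_lid transpose_matrix_vector
    transpose_transpose
      vector_transpose_matrix)

text \<open>
  The image of Lebesgue measure under an isometry is again translation invariant, and by Fubini two
  translation invariant measures that agree on the unit ball are equal.
\<close>

lemma nn_integral_lborel_orthogonal:
  fixes Q :: "('n::finite) sqmat" and f :: "'n rvec \<Rightarrow> ennreal"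
  assumes Q: "transpose Q ** Q = mat 1" and [measurable]: "f \<in> borel_measurable borel"
  shows "(\<integral>\<^sup>+x. f (Q *v x) \<partial>lborel) = (\<integral>\<^sup>+x. f x \<partial>lborel)"
proof -
  let ?b = "indicator (ball 0 1) :: 'n rvec \<Rightarrow> ennreal"
  define B where "B = (\<integral>\<^sup>+x. ?b x \<partial>lborel)"
  have B: "B \<noteq> 0" "B \<noteq> \<infinity>"
    using unit_ball_vol_pos[of "real DIM('n rvec)"]
    unfolding B_def by (auto simp: emeasure_ball simp del: unit_ball_vol_pos)
  have inner: "(\<integral>\<^sup>+y. c * ?b y \<partial>lborel) = c * B" for c
    unfolding B_def by (rule nn_integral_cmult) (auto intro!: borel_measurable_indicator borel_open)
  have [measurable]: "ball (0::'n rvec) 1 \<in> sets borel" by (rule borel_open) simp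
  have norm: "norm (Q *v x) = norm x" for x
    by (simp add: norm_eq_sqrt_inner orthogonal_matrix_norm[OF Q])
  have b: "?b (Q *v x) = ?b x" "?b (- x) = ?b x" for x
    by (auto simp: norm indicator_def)
  have QQ: "Q ** transpose Q = mat 1" using Q matrix_left_right_inverse by blast
  have inv: "Q *v (transpose Q *v y + x) = y + Q *v x" for x y
    by (simp add: matrix_vector_right_distrib matrix_vector_mul_assoc QQ del: transpose_matrix_vector)
  have "(\<integral>\<^sup>+x. f (Q *v x) \<partial>lborel) * B = (\<integral>\<^sup>+x. \<integral>\<^sup>+y. f (Q *v x) * ?b y \<partial>lborel \<partial>lborel)"
    by (simp only: inner nn_integral_multc) (simp add: nn_integral_multc)
  also have "\<dots> = (\<integral>\<^sup>+x. \<integral>\<^sup>+y. f (Q *v x) * ?b (- (Q *v x) + y) \<partial>lborel \<partial>lborel)"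
    by (intro nn_integral_cong nn_integral_lborel_translate[where f="\<lambda>y. f (Q *v _) * ?b y", symmetric])
      (auto intro!: borel_measurable_times_ennreal borel_measurable_indicator borel_open)
  also have "\<dots> = (\<integral>\<^sup>+y. \<integral>\<^sup>+x. f (Q *v x) * ?b (- (Q *v x) + y) \<partial>lborel \<partial>lborel)"
    by (subst lborel_pair.Fubini') auto
  also have "\<dots> = (\<integral>\<^sup>+y. \<integral>\<^sup>+x. f (Q *v (transpose Q *v y + x)) * ?b (- (Q *v (transpose Q *v y + x))
    + y) \<partial>lborel \<partial>lborel)"
    by (intro nn_integral_cong
        nn_integral_lborel_translate[where f="\<lambda>x. f (Q *v x) * ?b (- (Q *v x) + _)", symmetric]) measurable
  also have "\<dots> = (\<integral>\<^sup>+y. \<integral>\<^sup>+x. f (y + Q *v x) * ?b x \<partial>lborel \<partial>lborel)"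
    unfolding inv by (simp add: b)
  also have "\<dots> = (\<integral>\<^sup>+x. \<integral>\<^sup>+y. f (Q *v x + y) * ?b x \<partial>lborel \<partial>lborel)"
    by (subst lborel_pair.Fubini') (auto simp: add.commute)
  also have "\<dots> = (\<integral>\<^sup>+x. \<integral>\<^sup>+y. f y * ?b x \<partial>lborel \<partial>lborel)"
    by (intro nn_integral_cong nn_integral_lborel_translate[where f="\<lambda>y. f y * ?b _"]) measurable
  also have "\<dots> = (\<integral>\<^sup>+x. f x \<partial>lborel) * B"
    by (simp add: nn_integral_multc inner)
  finally show ?thesis
    using B by (auto simp: ennreal_mult_cancel_left mult.commute[of _ B])
qed

lemma mult_if:
  fixes c :: real
  shows "c * (if P then a else b) = (if P then c * a else c * b)" "(if P then a else b) * c = (if P then a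
    * c else b * c)"
  by auto

definition diag :: "('n \<Rightarrow> real) \<Rightarrow> ('n::finite) sqmat" where
  "diag d = (\<chi> i j. if i = j then d i else 0)"

lemma diag_mult_vec: "diag d *v x = (\<chi> i. d i * x $ i)"
  by (simp add: diag_def matrix_vector_mult_def vec_eq_iff mult_if cong: if_cong)

lemma det_diag: "det (diag d) = (\<Prod>i\<in>UNIV. d i)"
  by (simp add: det_diagonal diag_def)

lemma trace_diag: "trace (diag d) = (\<Sum>i\<in>UNIV. d i)"
  by (simp add: trace_def diag_def)

lemma diag_mult_diag: "diag c ** diag d = diag (\<lambda>i. c i * d i)"
  by (simp add: diag_def matrix_matrix_mult_def vec_eq_iff mult_if cong: if_cong)

lemma transpose_diag: "transpose (diag d) = diag d"
  by (simp add: diag_def transpose_def vec_eq_iff)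

lemma axis_nth: "axis i (1::real) $ j = (if i = j then 1 else 0)"
  by (simp add: axis_def)

lemma nn_integral_lborel_diag:
  fixes f :: "('n::finite) rvec \<Rightarrow> ennreal"
  assumes [measurable]: "f \<in> borel_measurable borel" and d: "\<And>i. d i > 0"
  shows "(\<integral>\<^sup>+x. f x \<partial>lborel) = ennreal (\<Prod>i\<in>UNIV. d i) * (\<integral>\<^sup>+x. f (diag d *v x) \<partial>lborel)"
proof -
  let ?e = "\<lambda>i::'n. axis i (1::real)"
  let ?c = "\<lambda>b. d (inv ?e b)"
  have inj: "inj ?e" by (auto simp: inj_on_def axis_eq_axis)
  have B: "(Basis :: 'n rvec set) = range ?e"
    by (auto simp: Basis_vec_def)
  have T: "(\<lambda>x. 0 + (\<Sum>j\<in>Basis. (?c j * (x \<bullet> j)) *\<^sub>R j)) = (\<lambda>x::'n rvec. diag d *v x)"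
    unfolding B sum.reindex[OF inj]
    by (auto simp: inv_f_f[OF inj] inner_axis diag_mult_vec vec_eq_iff fun_eq_iff axis_nth mult_if cong:
      if_cong)
  have "(lborel :: 'n rvec measure) = density (distr lborel borel (\<lambda>x. diag d *v x)) (\<lambda>_. (\<Prod>j\<in>Basis. \<bar>?c j\<bar>))"
    using lborel_affine_euclidean[of ?c 0] d unfolding T by (simp add: less_imp_neq[symmetric])
  also have "(\<Prod>j\<in>(Basis :: 'n rvec set). \<bar>?c j\<bar>) = (\<Prod>i\<in>UNIV. d i)"
    unfolding B using d by (simp add: prod.reindex[OF inj] inv_f_f[OF inj] abs_of_pos)
  finally have L: "(lborel :: 'n rvec measure) = density (distr lborel borel (\<lambda>x. diag d *v x)) (\<lambda>_. (\<Prod>i\<in>UNIV. d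
    i))" .
  show ?thesis
    by (subst L) (simp add: nn_integral_density nn_integral_distr nn_integral_cmult)
qed

lemma spectral_matrix:
  fixes A :: "('n::finite) sqmat"
  assumes "transpose A = A"
  obtains Q :: "'n sqmat" and d where "transpose Q ** Q = mat 1" "Q ** transpose Q = mat 1" "A
    = Q ** diag d ** transpose Q"
proof -
  obtain r m where r: "\<And>i j::'n. r i \<bullet> r j = (if i = j then 1 else 0)" "\<And>i. A *v r i = m i *\<^sub>R r i"
    using spectral_theorem[OF assms] by blast
  define Q :: "'n sqmat" where "Q = (\<chi> a i. r i $ a)"
  have Q1: "transpose Q ** Q = mat 1"
    using r(1) by (simp add: Q_def matrix_matrix_mult_def transpose_def mat_def vec_eq_iff inner_vec_def)
  then have Q2: "Q ** transpose Q = mat 1" using matrix_left_right_inverse by blast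
  have "A ** Q = Q ** diag m"
  proof -
    have "(A ** Q) $ a $ i = (A *v r i) $ a" for a i
      by (simp add: Q_def matrix_matrix_mult_def matrix_vector_mult_def)
    moreover have "(Q ** diag m) $ a $ i = (m i *\<^sub>R r i) $ a" for a i
      by (simp add: Q_def matrix_matrix_mult_def diag_def mult_if cong: if_cong)
    ultimately show ?thesis by (simp add: vec_eq_iff r(2))
  qed
  then have "A ** Q ** transpose Q = Q ** diag m ** transpose Q" by simp
  then have "A = Q ** diag m ** transpose Q" by (simp add: matrix_mul_assoc[symmetric] Q2)
  from that[OF Q1 Q2 this] show ?thesis .
qed

definition std_gauss :: "('n::finite) rvec measure" where
  "std_gauss = density lborel (\<lambda>z. ennreal (\<Prod>i\<in>UNIV. std_normal_density (z $ i)))"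

lemma sets_std_gauss[simp, measurable_cong]: "sets std_gauss = sets borel"
  and space_std_gauss[simp]: "space std_gauss = UNIV"
  by (simp_all add: std_gauss_def)

lemma sets_mvn[simp, measurable_cong]: "sets (mvn V) = sets borel"
  and space_mvn[simp]: "space (mvn V) = UNIV"
  by (simp_all add: mvn_def)

lemma std_gauss_density_eq:
  fixes z :: "('n::finite) rvec"
  shows "(\<Prod>i\<in>UNIV. std_normal_density (z $ i)) = exp (- (z \<bullet> z) / 2) / sqrt ((2 * pi) ^ CARD('n))"
proof -
  have "(\<Prod>i\<in>UNIV. std_normal_density (z $ i)) = (\<Prod>i\<in>UNIV. exp (- (z $ i)\<^sup>2 / 2)) / sqrt (2 * pi) ^ CARD('n)"
    by (simp add: normal_density_def prod_dividef)
  also have "(\<Prod>i\<in>UNIV. exp (- (z $ i)\<^sup>2 / 2)) = exp (- (z \<bullet> z) / 2)"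
    by (simp add: exp_sum[symmetric] inner_vec_def power2_eq_square sum_negf flip: sum_divide_distrib)
  finally show ?thesis by (simp only: real_sqrt_power)
qed

lemma prob_space_std_gauss: "prob_space (std_gauss :: ('n::finite) rvec measure)"
proof
  have "emeasure std_gauss (space (std_gauss :: 'n rvec measure))
      = (\<integral>\<^sup>+z. (\<Prod>i\<in>UNIV. ennreal (std_normal_density (z $ i))) \<partial>(lborel :: 'n rvec measure))"
    by (simp add: std_gauss_def emeasure_density prod_ennreal)
  also have "\<dots> = (\<Prod>i\<in>(UNIV :: 'n set). \<integral>\<^sup>+t. ennreal (std_normal_density t) \<partial>lborel)"
    by (rule nn_integral_lborel_vec_prod) auto
  also have "(\<integral>\<^sup>+t. ennreal (std_normal_density t) \<partial>lborel) = 1"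
    by (subst nn_integral_eq_integral) auto
  finally show "emeasure std_gauss (space (std_gauss :: 'n rvec measure)) = 1" by simp
qed

lemma emeasure_distr_std_gauss:
  fixes R :: "('n::finite) sqmat"
  assumes [measurable]: "A \<in> sets borel"
  shows "emeasure (distr std_gauss borel ((*v) R)) A
    = (\<integral>\<^sup>+z. ennreal (\<Prod>i\<in>UNIV. std_normal_density (z $ i)) * indicator A (R *v z) \<partial>lborel)"
proof -
  have m: "(*v) R \<in> measurable std_gauss borel" by measurable
  have "emeasure (distr std_gauss borel ((*v) R)) A = emeasure std_gauss ((*v) R -` A)"
    using emeasure_distr[OF m assms] by simp
  also have "\<dots> = (\<integral>\<^sup>+z. ennreal (\<Prod>i\<in>UNIV. std_normal_density (z $ i)) * indicator A (R *v z) \<partial>lborel)"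
    using emeasure_density[of "\<lambda>z. ennreal (\<Prod>i\<in>UNIV. std_normal_density (z $ i))" lborel "(*v) R -` A"]
    unfolding std_gauss_def by (simp add: indicator_vimage)
  finally show ?thesis .
qed

lemma distr_std_gauss_orthogonal:
  fixes Q :: "('n::finite) sqmat"
  assumes Q: "transpose Q ** Q = mat 1"
  shows "distr std_gauss borel ((*v) Q) = std_gauss"
proof (rule measure_eqI)
  fix A :: "'n rvec set" assume "A \<in> sets (distr std_gauss borel ((*v) Q))"
  then have [measurable]: "A \<in> sets borel" by simp
  let ?p = "\<lambda>z::'n rvec. exp (- (z \<bullet> z) / 2) / sqrt ((2 * pi) ^ CARD('n))"
  have "emeasure (distr std_gauss borel ((*v) Q)) A
      = (\<integral>\<^sup>+z. ennreal (?p (Q *v z)) * indicator A (Q *v z) \<partial>lborel)"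
    by (simp only: emeasure_distr_std_gauss[OF \<open>A \<in> sets borel\<close>] std_gauss_density_eq orthogonal_matrix_norm[OF
      Q])
  also have "\<dots> = (\<integral>\<^sup>+z. ennreal (?p z) * indicator A z \<partial>lborel)"
    by (rule nn_integral_lborel_orthogonal[OF Q, where f="\<lambda>z. ennreal (?p z) * indicator A z"]) measurable
  also have "\<dots> = emeasure std_gauss A"
    using emeasure_density[of "\<lambda>z. ennreal (?p z)" lborel A]
    unfolding std_gauss_def std_gauss_density_eq by simp
  finally show "emeasure (distr std_gauss borel ((*v) Q)) A = emeasure std_gauss A" .
qed (simp only: sets_distr sets_std_gauss)

lemma continuous_on_mvn_density:
  fixes V :: "('n::finite) sqmat"
  shows "continuous_on UNIV (mvn_density V)"
  unfolding mvn_density_def divide_inverse by (intro continuous_intros)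

lemma borel_measurable_mvn_density[measurable]: "mvn_density V \<in> borel_measurable borel"
  by (rule borel_measurable_continuous_onI[OF continuous_on_mvn_density])

lemma posdef_spectral:
  fixes V :: "('n::finite) sqmat"
  assumes "posdef V"
  obtains Q :: "'n sqmat" and d where "transpose Q ** Q = mat 1" "Q ** transpose Q = mat 1" "\<And>i. d i > 0"
    "V = Q ** diag d ** transpose Q"
proof -
  obtain Q :: "'n sqmat" and d where Q: "transpose Q ** Q = mat 1" "Q ** transpose Q = mat 1" "V
    = Q ** diag d ** transpose Q"
    by (rule spectral_matrix[OF posdefD(1)[OF assms]]) (rule that)
  have "d i > 0" for i
  proof -
    define v where "v = Q *v axis i 1"
    have n: "v \<bullet> v = 1" by (simp add: v_def orthogonal_matrix_norm[OF Q(1)] inner_axis)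
    have "transpose Q *v v = axis i 1"
      by (simp add: v_def matrix_vector_mul_assoc Q(1) del: transpose_matrix_vector)
    then have "V *v v = Q *v (diag d *v axis i 1)"
      by (simp add: Q(3) matrix_vector_mul_assoc[symmetric] del: transpose_matrix_vector)
    then have "v \<bullet> (V *v v) = axis i 1 \<bullet> (diag d *v axis i 1)"
      by (simp add: v_def orthogonal_matrix_norm[OF Q(1)])
    also have "\<dots> = d i" by (simp add: diag_mult_vec inner_axis inner_commute[of "axis i 1"])
    finally have "v \<bullet> (V *v v) = d i" .
    moreover have "v \<noteq> 0" using n by auto
    ultimately show ?thesis using posdefD(2)[OF assms, of v] by simp
  qed
  from that[OF Q(1,2) this Q(3)] show ?thesis .
qed

lemma det_orthogonal_square:
  fixes Q :: "('n::finite) sqmat"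
  assumes "transpose Q ** Q = mat 1"
  shows "det Q * det Q = 1"
  by (metis assms det_I det_mul det_transpose)

lemma det_posdef:
  fixes V :: "('n::finite) sqmat"
  assumes "posdef V"
  shows "det V > 0"
proof -
  obtain Q :: "'n sqmat" and d where Q: "transpose Q ** Q = mat 1" "Q ** transpose Q = mat 1" "\<And>i. d i > 0"
    "V = Q ** diag d ** transpose Q" by (rule posdef_spectral[OF assms]) (rule that)
  have "det V = (det Q * det Q) * det (diag d)"
    by (simp add: Q(4) det_mul mult_ac)
  then show ?thesis using Q(3) by (simp add: det_orthogonal_square[OF Q(1)] det_diag prod_pos)
qed

lemma matrix_inv_of_factor:
  fixes S Si V :: "('n::finite) sqmat"
  assumes V: "S ** transpose S = V" and Si: "Si ** S = mat 1"
  shows "matrix_inv V = transpose Si ** Si" "(S *v z) \<bullet> (matrix_inv V *v (S *v z)) = z \<bullet> z"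
proof -
  have S: "S ** Si = mat 1" using Si matrix_left_right_inverse by blast
  have ST: "transpose S ** transpose Si = mat 1"
    by (simp add: matrix_transpose_mul[symmetric] Si transpose_mat)
  have "V ** (transpose Si ** Si) = S ** (transpose S ** transpose Si) ** Si"
    by (simp only: V[symmetric] matrix_mul_assoc)
  also have "\<dots> = mat 1" by (simp add: ST S)
  finally show W: "matrix_inv V = transpose Si ** Si" by (rule matrix_inv_eqI)
  have "matrix_inv V *v (S *v z) = transpose Si *v (Si *v (S *v z))"
    unfolding W by (simp only: matrix_vector_mul_assoc matrix_mul_assoc)
  then have "(S *v z) \<bullet> (matrix_inv V *v (S *v z)) = (Si *v (S *v z)) \<bullet> (Si *v (S *v z))"
    by (metis dot_lmul_matrix transpose_matrix_vector inner_commute)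
  then show "(S *v z) \<bullet> (matrix_inv V *v (S *v z)) = z \<bullet> z"
    by (simp add: matrix_vector_mul_assoc Si)
qed

text \<open>
  With \<open>V = Q D Q\<^sup>T\<close> the substitution \<open>x = R z\<close>, \<open>R = Q D\<^sup>1\<^sup>/\<^sup>2\<close>, standardizes \<open>N(0, V)\<close>; the Jacobian
  is that of an isometry and of a scaling of the coordinates.
\<close>

lemma mvn_eq_distr_std_gauss:
  fixes V :: "('n::finite) sqmat"
  assumes V: "posdef V"
  obtains R :: "'n sqmat" where "R ** transpose R = V" "mvn V = distr std_gauss borel ((*v) R)"
proof -
  obtain Q :: "'n sqmat" and d where Q: "transpose Q ** Q = mat 1" "Q ** transpose Q = mat 1" "\<And>i. d i > 0"
    "V = Q ** diag d ** transpose Q" by (rule posdef_spectral[OF assms]) (rule that)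
  define s where "s i = sqrt (d i)" for i
  have s: "s i > 0" for i using Q(3) by (simp add: s_def)
  have ss: "s i * s i = d i" for i using Q(3)[of i] by (simp add: s_def)
  define R where "R = Q ** diag s"
  have RR: "R ** transpose R = V"
  proof -
    have "diag s ** diag s = diag d" by (simp add: diag_mult_diag ss)
    then show ?thesis
      by (simp add: R_def matrix_transpose_mul transpose_diag Q(4)) (metis matrix_mul_assoc)
  qed
  have Rv: "R *v z = Q *v (diag s *v z)" for z by (simp add: R_def matrix_vector_mul_assoc)
  have detV: "det V = (\<Prod>i\<in>UNIV. s i) * (\<Prod>i\<in>UNIV. s i)"
  proof -
    have "det V = (det Q * det Q) * det (diag d)"
      by (simp add: Q(4) det_mul mult_ac)
    then show ?thesis by (simp add: det_orthogonal_square[OF Q(1)] det_diag prod.distrib[symmetric] ss)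
  qed
  define P where "P = (\<Prod>i\<in>UNIV. s i)"
  have P: "P > 0" unfolding P_def by (rule prod_pos) (simp add: s)
  have "det R \<noteq> 0" using det_posdef[OF V] by (metis RR det_mul less_irrefl mult_zero_left)
  then have "invertible R" by (simp add: invertible_det_nz)
  note quad = matrix_inv_of_factor(2)[OF RR matrix_inv_lr(2)[OF this]]
  have dens: "P * mvn_density V (R *v z) = (\<Prod>i\<in>UNIV. std_normal_density (z $ i))" for z
    using P by (simp add: mvn_density_def quad detV std_gauss_density_eq P_def[symmetric] real_sqrt_mult)
  have "mvn V = distr std_gauss borel ((*v) R)"
  proof (rule measure_eqI)
    fix A :: "'n rvec set" assume "A \<in> sets (mvn V)"
    then have [measurable]: "A \<in> sets borel" by simp
    have "emeasure (mvn V) A = (\<integral>\<^sup>+x. ennreal (mvn_density V x) * indicator A x \<partial>lborel)"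
      by (simp add: mvn_def emeasure_density)
    also have "\<dots> = (\<integral>\<^sup>+x. ennreal (mvn_density V (Q *v x)) * indicator A (Q *v x) \<partial>lborel)"
      by (rule nn_integral_lborel_orthogonal[OF Q(1), where f="\<lambda>x. ennreal (mvn_density V x)
        * indicator A x", symmetric])
        measurable
    also have "\<dots> = ennreal P * (\<integral>\<^sup>+z. ennreal (mvn_density V (R *v z)) * indicator A (R *v z) \<partial>lborel)"
      unfolding Rv P_def
      by (rule nn_integral_lborel_diag[where f="\<lambda>x. ennreal (mvn_density V (Q *v x)) * indicator A (Q *v x)"])
        (measurable, rule s)
    also have "\<dots> = (\<integral>\<^sup>+z. ennreal (P * mvn_density V (R *v z)) * indicator A (R *v z) \<partial>lborel)"
      using P by (simp add: nn_integral_cmult[symmetric] ennreal_mult' mult.assoc)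
    also have "\<dots> = emeasure (distr std_gauss borel ((*v) R)) A"
      by (simp only: dens emeasure_distr_std_gauss[OF \<open>A \<in> sets borel\<close>])
    finally show "emeasure (mvn V) A = emeasure (distr std_gauss borel ((*v) R)) A" .
  qed (simp only: sets_distr sets_mvn)
  from that[OF RR this] show ?thesis .
qed

lemma prob_space_mvn:
  fixes V :: "('n::finite) sqmat"
  assumes "posdef V"
  shows "prob_space (mvn V)"
proof -
  obtain R :: "'n sqmat" where "mvn V = distr std_gauss borel ((*v) R)"
    by (rule mvn_eq_distr_std_gauss[OF assms]) (rule that)
  then show ?thesis
    by (simp add: prob_space.prob_space_distr[OF prob_space_std_gauss])
qed

section \<open>Quadratic forms in Gaussian vectors\<close>

lemma nn_integral_std_gauss_prod:
  fixes g :: "'n::finite \<Rightarrow> real \<Rightarrow> real"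
  assumes [measurable]: "\<And>i. g i \<in> borel_measurable borel" and nn: "\<And>i t. 0 \<le> g i t"
  shows "(\<integral>\<^sup>+z. ennreal (\<Prod>i\<in>UNIV. g i (z $ i)) \<partial>(std_gauss :: 'n rvec measure))
    = (\<Prod>i\<in>UNIV. \<integral>\<^sup>+t. ennreal (std_normal_density t * g i t) \<partial>lborel)"
proof -
  have "(\<integral>\<^sup>+z. ennreal (\<Prod>i\<in>UNIV. g i (z $ i)) \<partial>(std_gauss :: 'n rvec measure))
      = (\<integral>\<^sup>+z. ennreal (\<Prod>i\<in>UNIV. std_normal_density (z $ i)) * ennreal (\<Prod>i\<in>UNIV. g i (z $ i)) \<partial>lborel)"
    unfolding std_gauss_def by (subst nn_integral_density) auto
  also have "\<dots> = (\<integral>\<^sup>+z. (\<Prod>i\<in>UNIV. ennreal (std_normal_density (z $ i) * g i (z $ i))) \<partial>(lborel :: 'n rvec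
    measure))"
    by (simp add: prod_ennreal[symmetric] prod.distrib[symmetric] nn ennreal_mult')
  also have "\<dots> = (\<Prod>i\<in>UNIV. \<integral>\<^sup>+t. ennreal (std_normal_density t * g i t) \<partial>lborel)"
    by (rule nn_integral_lborel_vec_prod) auto
  finally show ?thesis .
qed

lemma nn_integral_std_normal_even_moment:
  "(\<integral>\<^sup>+t. ennreal (std_normal_density t * t ^ (2 * k)) \<partial>lborel) = ennreal (fact (2 * k) / (2 ^ k * fact k))"
  using has_bochner_integral_integral_eq[OF std_normal_moment_even[of k]]
    integrable.intros[OF std_normal_moment_even[of k]]
  by (subst nn_integral_eq_integral) (auto simp: power_mult)

lemma std_gauss_moment:
  fixes c :: "'n::finite \<Rightarrow> nat"
  shows "has_bochner_integral std_gauss (\<lambda>z. \<Prod>r\<in>UNIV. (z $ r) ^ (2 * c r))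
    (\<Prod>r\<in>UNIV. fact (2 * c r) / (2 ^ c r * fact (c r)))"
proof (rule has_bochner_integral_nn_integral)
  show "(\<integral>\<^sup>+z. ennreal (\<Prod>r\<in>UNIV. (z $ r) ^ (2 * c r)) \<partial>(std_gauss :: 'n rvec measure))
    = ennreal (\<Prod>r\<in>UNIV. fact (2 * c r) / (2 ^ c r * fact (c r)))"
    by (subst nn_integral_std_gauss_prod[where g="\<lambda>r t. t ^ (2 * c r)"])
      (auto simp: power_mult nn_integral_std_normal_even_moment[unfolded power_mult] prod_ennreal)
qed (auto intro!: prod_nonneg simp: power_mult)

lemma std_gauss_moment2:
  "has_bochner_integral std_gauss (\<lambda>z::('n::finite) rvec. (z $ i)\<^sup>2) 1"
proof -
  let ?c = "\<lambda>r. if r = i then 1 else 0 :: nat"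
  have "(\<Prod>r\<in>UNIV. (z $ r) ^ (2 * ?c r)) = (z $ i)\<^sup>2" for z :: "'n rvec"
    using prod.delta[of UNIV i "\<lambda>r. (z $ r)\<^sup>2"] by (simp add: if_distrib[of "\<lambda>k. _ ^ (2 * k)"] cong: if_cong)
  moreover have "(\<Prod>r\<in>UNIV. fact (2 * ?c r) / (2 ^ ?c r * fact (?c r))) = (1 :: real)"
    by (rule prod.neutral) (auto simp: fact_numeral)
  ultimately show ?thesis using std_gauss_moment[of ?c] by (simp only:)
qed

lemma std_gauss_moment22:
  "has_bochner_integral std_gauss (\<lambda>z::('n::finite) rvec. (z $ i)\<^sup>2 * (z $ j)\<^sup>2) (if i = j then 3 else 1)"
proof -
  let ?c = "\<lambda>r. (if r = i then 1 else 0) + (if r = j then 1 else 0 :: nat)"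
  have "(\<Prod>r\<in>UNIV. (z $ r) ^ (2 * ?c r)) = (z $ i)\<^sup>2 * (z $ j)\<^sup>2" for z :: "'n rvec"
  proof -
    have "(\<Prod>r\<in>UNIV. (z $ r) ^ (2 * ?c r))
        = (\<Prod>r\<in>UNIV. if r = i then (z $ r)\<^sup>2 else 1) * (\<Prod>r\<in>UNIV. if r = j then (z $ r)\<^sup>2 else 1)"
      unfolding prod.distrib[symmetric] by (rule prod.cong) (auto simp: power2_eq_square power4_eq_xxxx)
    then show ?thesis by (simp add: prod.delta)
  qed
  moreover have "(\<Prod>r\<in>UNIV. fact (2 * ?c r) / (2 ^ ?c r * fact (?c r))) = (if i = j then 3 else 1 :: real)"
  proof -
    have "(\<Prod>r\<in>UNIV. fact (2 * ?c r) / (2 ^ ?c r * fact (?c r))) = (\<Prod>r\<in>UNIV. if r = i then (if i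
      = j then 3 else 1) else 1 :: real)"
      by (rule prod.cong) (auto simp: fact_numeral)
    then show ?thesis by (simp add: prod.delta)
  qed
  ultimately show ?thesis using std_gauss_moment[of ?c] by (simp only:)
qed

lemma std_gauss_chi_square_variance:
  fixes \<mu> :: "'n::finite \<Rightarrow> real"
  shows "has_bochner_integral std_gauss (\<lambda>z. ((\<Sum>i\<in>UNIV. \<mu> i * ((z $ i)\<^sup>2 - 1)) / 2)\<^sup>2) ((\<Sum>i\<in>UNIV. (\<mu> i)\<^sup>2) / 2)"
proof -
  have one: "has_bochner_integral std_gauss (\<lambda>z::'n rvec. 1) (1::real)"
  proof -
    interpret prob_space "std_gauss :: 'n rvec measure" by (rule prob_space_std_gauss)
    show ?thesis using prob_space by (simp add: has_bochner_integral_iff)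
  qed
  have "has_bochner_integral std_gauss (\<lambda>z. \<Sum>i\<in>UNIV. \<Sum>j\<in>UNIV. \<mu> i * \<mu> j / 4 *
        (((z $ i)\<^sup>2 * (z $ j)\<^sup>2 - (z $ i)\<^sup>2) - ((z $ j)\<^sup>2 - 1)))
      (\<Sum>i\<in>UNIV. \<Sum>j\<in>UNIV. \<mu> i * \<mu> j / 4 * (((if i = j then 3 else 1) - 1) - (1 - 1)))"
    by (intro has_bochner_integral_sum has_bochner_integral_mult_right has_bochner_integral_diff
        std_gauss_moment2 std_gauss_moment22 one)
  moreover have "(\<Sum>i\<in>UNIV. \<Sum>j\<in>UNIV. \<mu> i * \<mu> j / 4 * (((z $ i)\<^sup>2 * (z $ j)\<^sup>2 - (z $ i)\<^sup>2) - ((z $ j)\<^sup>2 - 1)))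
      = ((\<Sum>i\<in>UNIV. \<mu> i * ((z $ i)\<^sup>2 - 1)) / 2)\<^sup>2" for z :: "'n rvec"
  proof -
    have "((\<Sum>i\<in>UNIV. \<mu> i * ((z $ i)\<^sup>2 - 1)) / 2)\<^sup>2
        = (\<Sum>i\<in>UNIV. \<Sum>j\<in>UNIV. (\<mu> i * ((z $ i)\<^sup>2 - 1)) * (\<mu> j * ((z $ j)\<^sup>2 - 1))) / 4"
      by (simp add: power_divide power2_eq_square[of "sum _ _"] sum_product)
    also have "\<dots> = (\<Sum>i\<in>UNIV. \<Sum>j\<in>UNIV. (\<mu> i * ((z $ i)\<^sup>2 - 1)) * (\<mu> j * ((z $ j)\<^sup>2 - 1)) / 4)"
      by (simp add: sum_divide_distrib)
    also have "\<dots> = (\<Sum>i\<in>UNIV. \<Sum>j\<in>UNIV. \<mu> i * \<mu> j / 4 * (((z $ i)\<^sup>2 * (z $ j)\<^sup>2 - (z $ i)\<^sup>2) - ((z $ j)\<^sup>2 - 1)))"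
      by (intro sum.cong refl) (simp add: field_simps)
    finally show ?thesis by (rule sym)
  qed
  moreover have "(\<Sum>i\<in>UNIV. \<Sum>j\<in>UNIV. \<mu> i * \<mu> j / 4 * (((if i = j then 3 else 1) - 1) - (1 - 1)))
      = (\<Sum>i\<in>UNIV. (\<mu> i)\<^sup>2) / 2"
  proof -
    have "(\<Sum>j\<in>UNIV. \<mu> i * \<mu> j / 4 * (((if i = j then 3 else 1) - 1) - (1 - 1))) = (\<mu> i)\<^sup>2 / 2" for i
    proof -
      have "(\<Sum>j\<in>UNIV. \<mu> i * \<mu> j / 4 * (((if i = j then 3 else 1) - 1) - (1 - 1)))
          = (\<Sum>j\<in>UNIV. if i = j then \<mu> i * \<mu> j / 2 else 0)"
        by (rule sum.cong) auto
      then show ?thesis by (simp add: power2_eq_square)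
    qed
    then show ?thesis by (simp only: sum_divide_distrib)
  qed
  ultimately show ?thesis by (simp only:)
qed

text \<open>
  Whitening turns \<open>V\<close> into the identity; the rotation that then diagonalizes \<open>D\<close> preserves the
  standard normal law.
\<close>

lemma mvn_simultaneous_diagonalization:
  fixes V D :: "('n::finite) sqmat"
  assumes V: "posdef V" and D: "transpose D = D"
  obtains S Si :: "'n sqmat" and \<mu> where "S ** transpose S = V" "Si ** S = mat 1" "S ** Si = mat 1"
    "D = S ** diag \<mu> ** transpose S" "mvn V = distr std_gauss borel ((*v) S)"
proof -
  obtain R :: "'n sqmat" where R: "R ** transpose R = V" "mvn V = distr std_gauss borel ((*v) R)"
    by (rule mvn_eq_distr_std_gauss[OF V]) (rule that)
  have "det R \<noteq> 0" using det_posdef[OF V] by (metis R(1) det_mul less_irrefl mult_zero_left)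
  then have "invertible R" by (simp add: invertible_det_nz)
  note Ri = matrix_inv_lr[OF this]
  define N where "N = matrix_inv R ** D ** transpose (matrix_inv R)"
  have "transpose N = N" by (simp add: N_def matrix_transpose_mul D matrix_mul_assoc)
  then obtain Q :: "'n sqmat" and \<mu> where Q: "transpose Q ** Q = mat 1" "Q ** transpose Q = mat 1"
      "N = Q ** diag \<mu> ** transpose Q"
    by (rule spectral_matrix) (rule that)
  define S where "S = R ** Q"
  define Si where "Si = transpose Q ** matrix_inv R"
  have "S ** transpose S = R ** (Q ** transpose Q) ** transpose R"
    by (simp only: S_def matrix_transpose_mul matrix_mul_assoc)
  then have 1: "S ** transpose S = V" by (simp add: Q R)
  have "Si ** S = transpose Q ** (matrix_inv R ** R) ** Q"
    by (simp only: S_def Si_def matrix_mul_assoc)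
  then have 2: "Si ** S = mat 1" by (simp add: Q Ri)
  then have 3: "S ** Si = mat 1" using matrix_left_right_inverse by blast
  have RiT: "transpose (matrix_inv R) ** transpose R = mat 1"
    by (simp add: matrix_transpose_mul[symmetric] Ri transpose_mat)
  have "S ** diag \<mu> ** transpose S = R ** (Q ** diag \<mu> ** transpose Q) ** transpose R"
    by (simp only: S_def matrix_transpose_mul matrix_mul_assoc)
  also have "\<dots> = (R ** matrix_inv R) ** D ** (transpose (matrix_inv R) ** transpose R)"
    by (simp only: Q(3)[symmetric] N_def matrix_mul_assoc)
  finally have 4: "D = S ** diag \<mu> ** transpose S" by (simp add: Ri RiT)
  have "distr std_gauss borel ((*v) S) = distr (distr std_gauss borel ((*v) Q)) borel ((*v) R)"
    by (subst distr_distr) (auto simp: comp_def S_def matrix_vector_mul_assoc)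
  then have 5: "mvn V = distr std_gauss borel ((*v) S)"
    by (simp add: distr_std_gauss_orthogonal[OF Q(1)] R(2))
  from that[OF 1 2 3 4 5] show ?thesis .
qed

text \<open>
  For \<open>W = V\<^sup>-\<^sup>1\<close> this is the derivative of the log density of \<open>N(0, V)\<close> at \<open>x\<close> when \<open>V\<close> moves in the
  direction \<open>D\<close>.
\<close>

definition gscore :: "('n::finite) sqmat \<Rightarrow> 'n sqmat \<Rightarrow> 'n rvec \<Rightarrow> real" where
  "gscore W D x = (x \<bullet> ((W ** D ** W) *v x) - trace (W ** D)) / 2"

text \<open>
  In coordinates that diagonalize \<open>V\<close> and \<open>D\<close> simultaneously the score is a linear combination of
  independent centred \<open>\<chi>\<^sup>2\<close> variables.
\<close>

lemma gscore_variance: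
  fixes V D :: "('n::finite) sqmat"
  assumes V: "posdef V" and D: "transpose D = D"
  defines "W \<equiv> matrix_inv V"
  shows "has_bochner_integral (mvn V) (\<lambda>x. (gscore W D x)\<^sup>2) (trace (W ** D ** W ** D) / 2)"
    and "0 \<le> trace (W ** D ** W ** D)" and "trace (W ** D ** W ** D) = 0 \<Longrightarrow> D = 0"
proof -
  obtain S Si :: "'n sqmat" and \<mu> where S: "S ** transpose S = V" "Si ** S = mat 1" "S ** Si = mat 1"
    "D = S ** diag \<mu> ** transpose S" "mvn V = distr std_gauss borel ((*v) S)"
    by (rule mvn_simultaneous_diagonalization[OF V D]) (rule that)
  have ST: "transpose S ** transpose Si = mat 1"
    by (simp add: matrix_transpose_mul[symmetric] S(2) transpose_mat)
  have W: "W = transpose Si ** Si" unfolding W_def by (rule matrix_inv_of_factor(1)[OF S(1,2)])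
  have "W ** D = transpose Si ** (Si ** S) ** diag \<mu> ** transpose S"
    by (simp only: W S(4) matrix_mul_assoc)
  then have WD: "W ** D = transpose Si ** diag \<mu> ** transpose S" by (simp add: S(2))
  have "W ** D ** W = transpose Si ** diag \<mu> ** (transpose S ** transpose Si) ** Si"
    unfolding WD unfolding W by (simp only: matrix_mul_assoc)
  then have WDW: "W ** D ** W = transpose Si ** diag \<mu> ** Si" by (simp add: ST)
  have trWD: "trace (W ** D) = (\<Sum>i\<in>UNIV. \<mu> i)"
  proof -
    have "trace (W ** D) = trace (transpose S ** (transpose Si ** diag \<mu>))"
      unfolding WD by (rule trace_mul_sym)
    then show ?thesis by (simp add: matrix_mul_assoc ST trace_diag)
  qed
  have "W ** D ** W ** D = transpose Si ** diag \<mu> ** (Si ** S) ** diag \<mu> ** transpose S"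
    unfolding WDW by (simp only: S(4) matrix_mul_assoc)
  also have "\<dots> = transpose Si ** (diag \<mu> ** diag \<mu>) ** transpose S"
    by (simp add: S(2) matrix_mul_assoc)
  also have "trace \<dots> = trace (transpose S ** (transpose Si ** (diag \<mu> ** diag \<mu>)))"
    by (rule trace_mul_sym)
  finally have trWDWD: "trace (W ** D ** W ** D) = (\<Sum>i\<in>UNIV. (\<mu> i)\<^sup>2)"
    by (simp add: matrix_mul_assoc ST) (simp add: diag_mult_diag trace_diag power2_eq_square)
  show "0 \<le> trace (W ** D ** W ** D)" unfolding trWDWD by (simp add: sum_nonneg)
  show "D = 0" if "trace (W ** D ** W ** D) = 0"
  proof -
    have "\<mu> i = 0" for i using that unfolding trWDWD by (simp add: sum_nonneg_eq_0_iff)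
    then have "diag \<mu> = 0" by (simp add: diag_def vec_eq_iff)
    then show ?thesis by (simp add: S(4))
  qed
  have quad: "(S *v z) \<bullet> ((W ** D ** W) *v (S *v z)) = (\<Sum>i\<in>UNIV. \<mu> i * (z $ i)\<^sup>2)" for z
  proof -
    have "(W ** D ** W) *v (S *v z) = (transpose Si ** diag \<mu> ** (Si ** S)) *v z"
      unfolding WDW by (simp only: matrix_vector_mul_assoc matrix_mul_assoc)
    also have "\<dots> = transpose Si *v (diag \<mu> *v z)"
      by (simp add: S(2) matrix_vector_mul_assoc[symmetric] del: transpose_matrix_vector)
    also have "(S *v z) \<bullet> \<dots> = (Si *v (S *v z)) \<bullet> (diag \<mu> *v z)"
      by (metis dot_lmul_matrix transpose_matrix_vector inner_commute)
    also have "\<dots> = (\<Sum>i\<in>UNIV. \<mu> i * (z $ i)\<^sup>2)"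
      by (simp add: matrix_vector_mul_assoc S(2) diag_mult_vec inner_vec_def power2_eq_square mult_ac)
    finally show ?thesis .
  qed
  have "gscore W D (S *v z) = (\<Sum>i\<in>UNIV. \<mu> i * ((z $ i)\<^sup>2 - 1)) / 2" for z
    unfolding gscore_def quad trWD by (simp add: right_diff_distrib sum_subtractf)
  then have "has_bochner_integral std_gauss (\<lambda>z. (gscore W D (S *v z))\<^sup>2) (trace (W ** D ** W ** D) / 2)"
    using std_gauss_chi_square_variance[of \<mu>] unfolding trWDWD by (simp only:)
  then show "has_bochner_integral (mvn V) (\<lambda>x. (gscore W D x)\<^sup>2) (trace (W ** D ** W ** D) / 2)"
    unfolding S(5) by (subst has_bochner_integral_distr) (auto simp: gscore_def[abs_def])
qed

lemma trace_diff: "trace (A - B :: real^'n^'n) = trace A - trace B"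
  by (simp add: trace_def sum_subtractf)

lemma matrix_add_rdistrib: "(A + B) ** C = A ** C + B ** (C :: real^'n^'m)"
  by (simp add: matrix_matrix_mult_def vec_eq_iff sum.distrib distrib_right)

lemma gscore_add: "gscore W (D + D') x = gscore W D x + gscore W D' x"
  unfolding gscore_def
  by (simp add: matrix_add_ldistrib matrix_add_rdistrib matrix_vector_mult_add_rdistrib trace_add
    inner_add_right
      field_simps)

text \<open>
  Polarization of the variance formula, the score being additive in the direction.
\<close>

lemma gscore_covariance:
  fixes V D D' :: "('n::finite) sqmat"
  assumes V: "posdef V" and D: "transpose D = D" and D': "transpose D' = D'"
  defines "W \<equiv> matrix_inv V"
  shows "(\<integral>x. gscore W D x * gscore W D' x \<partial>mvn V) = trace (W ** D ** W ** D') / 2"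
proof -
  have DD: "transpose (D + D') = D + D'" using D D' by (simp add: transpose_def vec_eq_iff)
  note 1 = gscore_variance(1)[OF V D, folded W_def]
  note 2 = gscore_variance(1)[OF V D', folded W_def]
  note 3 = gscore_variance(1)[OF V DD, folded W_def]
  have "has_bochner_integral (mvn V) (\<lambda>x. ((gscore W (D + D') x)\<^sup>2 - (gscore W D x)\<^sup>2 - (gscore W D' x)\<^sup>2) / 2)
     ((trace (W ** (D + D') ** W ** (D + D')) / 2 - trace (W ** D ** W ** D) / 2 - trace (W ** D' ** W ** D') /
       2) / 2)"
    by (intro has_bochner_integral_divide_zero has_bochner_integral_diff 1 2 3) 
  moreover have "((gscore W (D + D') x)\<^sup>2 - (gscore W D x)\<^sup>2 - (gscore W D' x)\<^sup>2) / 2 = gscore W D x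
    * gscore W D' x" for x
    unfolding gscore_add by (simp add: power2_eq_square algebra_simps)
  moreover have "trace (W ** D' ** W ** D) = trace (W ** D ** W ** D')"
    using trace_mul_sym[of "W ** D'" "W ** D"] by (simp add: matrix_mul_assoc)
  then have "(trace (W ** (D + D') ** W ** (D + D')) / 2 - trace (W ** D ** W ** D) / 2 - trace (W ** D' ** W **
    D') / 2) / 2
      = trace (W ** D ** W ** D') / 2"
    by (simp add: matrix_add_ldistrib matrix_add_rdistrib trace_add field_simps)
  ultimately show ?thesis by (simp add: has_bochner_integral_iff)
qed

section \<open>Convolution, level sets and contiguity of Gaussian laws\<close>

lemma mvn_density_factor:
  fixes V :: "('n::finite) sqmat"
  assumes "posdef V"
  obtains c where "c > 0" "\<And>x. mvn_density V x = c * exp (- (x \<bullet> (matrix_inv V *v x)) / 2)"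
proof
  show "inverse (sqrt ((2 * pi) ^ CARD('n) * det V)) > 0"
    using det_posdef[OF assms] by simp
  show "mvn_density V x = inverse (sqrt ((2 * pi) ^ CARD('n) * det V)) * exp (- (x \<bullet> (matrix_inv V *v x)) / 2)"
    for x
    unfolding mvn_density_def divide_inverse by (rule mult.commute)
qed

lemma mvn_density_pos:
  fixes V :: "('n::finite) sqmat"
  assumes "posdef V"
  shows "mvn_density V x > 0"
proof -
  obtain c where c: "c > 0" "\<And>x. mvn_density V x = c * exp (- (x \<bullet> (matrix_inv V *v x)) / 2)"
    by (rule mvn_density_factor[OF assms]) (rule that)
  show ?thesis unfolding c(2) using c(1) by simp
qed

text \<open>
  \<open>w y\<close> is the conditional expectation of \<open>s \<sim> N(0, H)\<close> given \<open>z + K s = y\<close>, where \<open>z \<sim> N(0, V\<^sub>2)\<close> is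
  independent of \<open>s\<close>, and \<open>G\<close> is the conditional precision. Both sides agree because
  \<open>G (w y) = K\<^sup>T V\<^sub>2\<^sup>-\<^sup>1 y\<close>.
\<close>

lemma completing_square:
  fixes V\<^sub>1 V\<^sub>2 :: "('b::finite) sqmat" and H :: "('d::finite) sqmat" and K :: "real^'d^'b"
  assumes V2: "posdef V\<^sub>2" and H: "posdef H" and V1: "posdef V\<^sub>1" "V\<^sub>1 = V\<^sub>2 + K ** H ** transpose K"
  defines "G \<equiv> matrix_inv H + transpose K ** matrix_inv V\<^sub>2 ** K"
  defines "w \<equiv> \<lambda>y. H *v (transpose K *v (matrix_inv V\<^sub>1 *v y))"
  shows "s \<bullet> (matrix_inv H *v s) + (y - K *v s) \<bullet> (matrix_inv V\<^sub>2 *v (y - K *v s))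
    = (s - w y) \<bullet> (G *v (s - w y)) + y \<bullet> (matrix_inv V\<^sub>1 *v y)"
proof -
  let ?Hi = "matrix_inv H" and ?V2i = "matrix_inv V\<^sub>2" and ?u = "matrix_inv V\<^sub>1 *v y"
  have adj: "a \<bullet> (transpose K *v b) = (K *v a) \<bullet> b" for a b
    by (metis dot_lmul_matrix transpose_matrix_vector inner_commute)
  have sHi: "transpose ?Hi = ?Hi" and sV2i: "transpose ?V2i = ?V2i"
    using posdefD(1)[OF posdef_matrix_inv[OF H]] posdefD(1)[OF posdef_matrix_inv[OF V2]] by auto
  have V1u: "V\<^sub>1 *v ?u = y" by (simp add: matrix_vector_inv posdef_invertible V1(1))
  have KHK: "K *v (w y) = y - V\<^sub>2 *v ?u"
  proof -
    have "V\<^sub>1 *v ?u = V\<^sub>2 *v ?u + K *v (w y)"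
    proof -
      have "V\<^sub>1 *v v = V\<^sub>2 *v v + K *v (H *v (transpose K *v v))" for v
        unfolding V1(2) matrix_vector_mult_add_rdistrib by (simp only: matrix_vector_mul_assoc matrix_mul_assoc)
      then show ?thesis unfolding w_def .
    qed
    then show ?thesis using V1u by (simp add: algebra_simps)
  qed
  have Gv: "G *v v = ?Hi *v v + transpose K *v (?V2i *v (K *v v))" for v
    unfolding G_def by (simp only: matrix_vector_mult_add_rdistrib matrix_vector_mul_assoc matrix_mul_assoc)
  have V2iV2: "?V2i *v (V\<^sub>2 *v v) = v" for v by (simp add: matrix_vector_inv posdef_invertible V2)
  have Gw: "G *v w y = transpose K *v (?V2i *v y)"
  proof -
    have "?Hi *v w y = transpose K *v ?u"
      unfolding w_def by (simp only: matrix_vector_inv[OF posdef_invertible[OF H]])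
    moreover have "transpose K *v (?V2i *v (K *v w y)) = transpose K *v (?V2i *v y) - transpose K *v ?u"
      unfolding KHK by (simp only: matrix_vector_mult_diff_distrib V2iV2)
    ultimately show ?thesis unfolding Gv by (simp only: add_diff_cancel_left' diff_add_cancel add.commute
      add_diff_eq)
  qed
  have sG: "a \<bullet> (G *v b) = b \<bullet> (G *v a)" for a b
    unfolding Gv inner_add_right adj
    using symmetric_inner[OF sHi, of a b] symmetric_inner[OF sV2i, of "K *v a" "K *v b"] by simp
  have "(s - w y) \<bullet> (G *v (s - w y)) = s \<bullet> (G *v s) - 2 * (s \<bullet> (G *v w y)) + w y \<bullet> (G *v w y)"
    using sG[of "w y" s] by (simp add: matrix_vector_mult_diff_distrib inner_diff_left inner_diff_right)
  also have "\<dots> = s \<bullet> (?Hi *v s) + (K *v s) \<bullet> (?V2i *v (K *v s)) - 2 * ((K *v s) \<bullet> (?V2i *v y))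
      + (y - V\<^sub>2 *v ?u) \<bullet> (?V2i *v y)"
    unfolding Gw unfolding Gv inner_add_right adj KHK by simp
  also have "(y - V\<^sub>2 *v ?u) \<bullet> (?V2i *v y) = y \<bullet> (?V2i *v y) - y \<bullet> ?u"
    using symmetric_inner[OF sV2i, of y "V\<^sub>2 *v ?u"] symmetric_inner[OF sV2i, of "V\<^sub>2 *v ?u" y]
    by (simp add: inner_diff_left V2iV2)
  finally show ?thesis
    using symmetric_inner[OF sV2i, of y "K *v s"]
    by (simp add: matrix_vector_mult_diff_distrib inner_diff_left inner_diff_right)
qed

text \<open>
  If \<open>s \<sim> N(0, H)\<close> and \<open>z \<sim> N(0, V\<^sub>2)\<close> are independent, then \<open>z + K s \<sim> N(0, V\<^sub>2 + K H K\<^sup>T)\<close>.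
  Completing the square makes the integral over \<open>s\<close> a multiple of the claimed density; the multiple is
  \<open>1\<close> because both sides have total mass \<open>1\<close>.
\<close>

lemma mvn_convolution:
  fixes V\<^sub>1 V\<^sub>2 :: "('b::finite) sqmat" and H :: "('d::finite) sqmat" and K :: "real^'d^'b"
  assumes V2: "posdef V\<^sub>2" and H: "posdef H" and V1: "posdef V\<^sub>1" "V\<^sub>1 = V\<^sub>2 + K ** H ** transpose K"
    and E: "E \<in> sets borel"
  shows "(\<integral>\<^sup>+s. emeasure (mvn V\<^sub>2) {z. z + K *v s \<in> E} \<partial>mvn H) = emeasure (mvn V\<^sub>1) E"
proof -
  obtain c\<^sub>H where cH: "c\<^sub>H > 0" "\<And>x. mvn_density H x = c\<^sub>H * exp (- (x \<bullet> (matrix_inv H *v x)) / 2)"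
    by (rule mvn_density_factor[OF H]) (rule that)
  obtain c\<^sub>2 where c2: "c\<^sub>2 > 0" "\<And>x. mvn_density V\<^sub>2 x = c\<^sub>2 * exp (- (x \<bullet> (matrix_inv V\<^sub>2 *v x)) / 2)"
    by (rule mvn_density_factor[OF V2]) (rule that)
  obtain c\<^sub>1 where c1: "c\<^sub>1 > 0" "\<And>x. mvn_density V\<^sub>1 x = c\<^sub>1 * exp (- (x \<bullet> (matrix_inv V\<^sub>1 *v x)) / 2)"
    by (rule mvn_density_factor[OF V1(1)]) (rule that)
  define G where "G = matrix_inv H + transpose K ** matrix_inv V\<^sub>2 ** K"
  define w where "w y = H *v (transpose K *v (matrix_inv V\<^sub>1 *v y))" for y
  have [measurable]: "mvn_density H \<in> borel_measurable borel" "mvn_density V\<^sub>2 \<in> borel_measurable borel" by auto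
  define Z where "Z = (\<integral>\<^sup>+s. ennreal (exp (- (s \<bullet> (G *v s)) / 2)) \<partial>lborel)"
  define q where "q = ennreal (c\<^sub>H * c\<^sub>2 / c\<^sub>1) * Z"
  have Gm[measurable]: "(\<lambda>s. ennreal (exp (- (s \<bullet> (G *v s)) / 2))) \<in> borel_measurable borel"
    by measurable
  have inner: "(\<integral>\<^sup>+s. ennreal (mvn_density H s * mvn_density V\<^sub>2 (y - K *v s)) \<partial>lborel) = q
    * ennreal (mvn_density V\<^sub>1 y)" for y
  proof -
    have "mvn_density H s * mvn_density V\<^sub>2 (y - K *v s)
        = (c\<^sub>H * c\<^sub>2 / c\<^sub>1 * mvn_density V\<^sub>1 y) * exp (- ((- w y + s) \<bullet> (G *v (- w y + s))) / 2)" for s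
    proof -
      have "mvn_density H s * mvn_density V\<^sub>2 (y - K *v s)
          = c\<^sub>H * c\<^sub>2 * exp (- (s \<bullet> (matrix_inv H *v s) + (y - K *v s) \<bullet> (matrix_inv V\<^sub>2 *v (y - K *v s))) / 2)"
        unfolding cH c2 by (simp add: exp_add[symmetric] add_divide_distrib)
      also have "\<dots> = c\<^sub>H * c\<^sub>2 * exp (- ((- w y + s) \<bullet> (G *v (- w y + s)) + y \<bullet> (matrix_inv V\<^sub>1 *v y)) / 2)"
        unfolding completing_square[OF V2 H V1] G_def[symmetric] w_def[symmetric] by (simp add: add.commute)
      also have "\<dots> = (c\<^sub>H * c\<^sub>2 / c\<^sub>1 * mvn_density V\<^sub>1 y) * exp (- ((- w y + s) \<bullet> (G *v (- w y + s))) / 2)"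
        unfolding c1(2) using c1(1) by (simp add: mult_exp_exp add_divide_distrib)
      finally show ?thesis .
    qed
    then have "(\<integral>\<^sup>+s. ennreal (mvn_density H s * mvn_density V\<^sub>2 (y - K *v s)) \<partial>lborel)
        = (\<integral>\<^sup>+s. ennreal (c\<^sub>H * c\<^sub>2 / c\<^sub>1 * mvn_density V\<^sub>1 y) * ennreal (exp (- ((- w y + s) \<bullet> (G *v (- w y
          + s))) / 2)) \<partial>lborel)"
      by (simp only:) (rule nn_integral_cong, rule ennreal_mult'', simp)
    also have "\<dots> = ennreal (c\<^sub>H * c\<^sub>2 / c\<^sub>1 * mvn_density V\<^sub>1 y) * (\<integral>\<^sup>+s. ennreal (exp (- ((- w y + s) \<bullet> (G *v
      (- w y + s))) / 2)) \<partial>lborel)"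
      by (rule nn_integral_cmult) measurable
    also have "(\<integral>\<^sup>+s. ennreal (exp (- ((- w y + s) \<bullet> (G *v (- w y + s))) / 2)) \<partial>lborel) = Z"
      unfolding Z_def by (rule nn_integral_lborel_translate[where f="\<lambda>s. ennreal (exp (- (s \<bullet> (G *v s)) / 2))",
        OF Gm])
    also have "ennreal (c\<^sub>H * c\<^sub>2 / c\<^sub>1 * mvn_density V\<^sub>1 y) * Z = q * ennreal (mvn_density V\<^sub>1 y)"
      by (subst ennreal_mult''[OF less_imp_le[OF mvn_density_pos[OF V1(1)]]]) (simp only: q_def mult_ac)
    finally show ?thesis .
  qed
  have conv: "(\<integral>\<^sup>+s. emeasure (mvn V\<^sub>2) {z. z + K *v s \<in> F} \<partial>mvn H) = q * emeasure (mvn V\<^sub>1) F"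
    if [measurable]: "F \<in> sets borel" for F
  proof -
    have em: "emeasure (mvn V\<^sub>2) {z. z + K *v s \<in> F}
        = (\<integral>\<^sup>+y. ennreal (mvn_density V\<^sub>2 (y - K *v s)) * indicator F y \<partial>lborel)" for s
    proof -
      have [measurable]: "{z. z + K *v s \<in> F} \<in> sets borel" by measurable
      have "emeasure (mvn V\<^sub>2) {z. z + K *v s \<in> F}
          = (\<integral>\<^sup>+z. ennreal (mvn_density V\<^sub>2 z) * indicator {z. z + K *v s \<in> F} z \<partial>lborel)"
        unfolding mvn_def by (rule emeasure_density) auto
      also have "\<dots> = (\<integral>\<^sup>+z. ennreal (mvn_density V\<^sub>2 ((K *v s + z) - K *v s)) * indicator F (K *v s
        + z) \<partial>lborel)"
        by (rule nn_integral_cong) (simp add: indicator_def add.commute)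
      also have "\<dots> = (\<integral>\<^sup>+y. ennreal (mvn_density V\<^sub>2 (y - K *v s)) * indicator F y \<partial>lborel)"
        by (rule nn_integral_lborel_translate[where f="\<lambda>y. ennreal (mvn_density V\<^sub>2 (y - K *v s))
          * indicator F y"]) measurable
      finally show ?thesis .
    qed
    have "(\<integral>\<^sup>+s. emeasure (mvn V\<^sub>2) {z. z + K *v s \<in> F} \<partial>mvn H)
        = (\<integral>\<^sup>+s. ennreal (mvn_density H s) * (\<integral>\<^sup>+y. ennreal (mvn_density V\<^sub>2 (y - K *v s))
          * indicator F y \<partial>lborel) \<partial>lborel)"
      unfolding em by (subst mvn_def[of H], rule nn_integral_density) measurable
    also have "\<dots> = (\<integral>\<^sup>+s. \<integral>\<^sup>+y. ennreal (mvn_density H s * mvn_density V\<^sub>2 (y - K *v s))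
      * indicator F y \<partial>lborel \<partial>lborel)"
      using mvn_density_pos[OF H] mvn_density_pos[OF V2]
      by (simp add: nn_integral_cmult[symmetric] ennreal_mult less_imp_le mult.assoc)
    also have "\<dots> = (\<integral>\<^sup>+y. \<integral>\<^sup>+s. ennreal (mvn_density H s * mvn_density V\<^sub>2 (y - K *v s))
      * indicator F y \<partial>lborel \<partial>lborel)"
      by (rule lborel_pair.Fubini'[symmetric]) measurable
    also have "\<dots> = (\<integral>\<^sup>+y. q * (ennreal (mvn_density V\<^sub>1 y) * indicator F y) \<partial>lborel)"
      by (simp add: nn_integral_multc inner mult.assoc)
    also have "\<dots> = q * emeasure (mvn V\<^sub>1) F"
      by (subst nn_integral_cmult) (auto simp: mvn_def emeasure_density)
    finally show ?thesis .
  qed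
  have "q = 1"
    using conv[of UNIV] prob_space.emeasure_space_1[OF prob_space_mvn[OF V2]]
      prob_space.emeasure_space_1[OF prob_space_mvn[OF H]] prob_space.emeasure_space_1[OF prob_space_mvn[OF
        V1(1)]]
    by simp
  then show ?thesis using conv[OF E] by simp
qed

text \<open>
  After standardization the level sets of the density lie on spheres.
\<close>

lemma mvn_level_null:
  fixes V :: "('n::finite) sqmat"
  assumes V: "posdef V"
  shows "emeasure (mvn V) {x. mvn_density V x = c} = 0"
proof -
  obtain S Si :: "'n sqmat" and \<mu> where S: "S ** transpose S = V" "Si ** S = mat 1" "S ** Si = mat 1"
    "V = S ** diag \<mu> ** transpose S" "mvn V = distr std_gauss borel ((*v) S)"
    by (rule mvn_simultaneous_diagonalization[OF V posdefD(1)[OF V]]) (rule that)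
  obtain c' where c': "c' > 0" "\<And>x. mvn_density V x = c' * exp (- (x \<bullet> (matrix_inv V *v x)) / 2)"
    by (rule mvn_density_factor[OF V]) (rule that)
  note quad = matrix_inv_of_factor(2)[OF S(1,2)]
  have sub: "(*v) S -` {x. mvn_density V x = c} \<subseteq> sphere 0 (sqrt (- 2 * ln (c / c')))"
  proof
    fix z assume "z \<in> (*v) S -` {x. mvn_density V x = c}"
    then have "exp (- (z \<bullet> z) / 2) = c / c'" using c'(1) by (simp add: c'(2) quad field_simps)
    then have "- (z \<bullet> z) / 2 = ln (c / c')" by (metis ln_exp)
    then have "- 2 * ln (c / c') = (norm z)\<^sup>2" by (simp add: dot_square_norm)
    then show "z \<in> sphere 0 (sqrt (- 2 * ln (c / c')))" by simp
  qed
  have "negligible (sphere (0 :: 'n rvec) (sqrt (- 2 * ln (c / c'))))" by (rule negligible_sphere)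
  then have "emeasure lborel (sphere (0 :: 'n rvec) (sqrt (- 2 * ln (c / c')))) = 0"
    unfolding negligible_iff_null_sets null_sets_completion_iff2
    by (auto simp: null_sets_def) (metis emeasure_mono le_zero_eq sets_lborel)
  moreover have Ls: "{x. mvn_density V x = c} \<in> sets borel" by measurable
  ultimately have "emeasure lborel ((*v) S -` {x. mvn_density V x = c}) = 0"
    using emeasure_mono[OF sub, of lborel] by (simp add: borel_closed)
  then have "(*v) S -` {x. mvn_density V x = c} \<in> null_sets lborel"
    using matrix_vimage_borel[OF Ls] by (auto simp: null_sets_def)
  then have "emeasure std_gauss ((*v) S -` {x. mvn_density V x = c}) = 0"
    unfolding std_gauss_def
    by (intro null_setsD1 absolutely_continuousI_density[unfolded absolutely_continuous_def, THEN subsetD])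
      measurable
  moreover have "emeasure (mvn V) {x. mvn_density V x = c} = emeasure std_gauss ((*v) S -` {x. mvn_density V x
    = c} \<inter> space std_gauss)"
    unfolding S(5) by (rule emeasure_distr) (use Ls in \<open>auto\<close>)
  ultimately show ?thesis by simp
qed

lemma AE_mvn_iff:
  assumes "posdef V"
  shows "(AE x in mvn V. P x) \<longleftrightarrow> (AE x in lborel. P x)"
  unfolding mvn_def using mvn_density_pos[OF assms]
  by (subst AE_density) auto

text \<open>
  By nullity of the level sets, the density, as a random variable under \<open>N(0, V)\<close>, has a continuous
  distribution function, to which the intermediate value theorem applies.
\<close>

lemma mvn_hpd_threshold:
  fixes V :: "('n::finite) sqmat"
  assumes V: "posdef V" and \<alpha>: "0 < \<alpha>" "\<alpha> < 1"
  obtains c where "c > 0" "measure (mvn V) {x. c \<le> mvn_density V x} = 1 - \<alpha>"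
    "\<And>\<delta>. \<delta> > 0 \<Longrightarrow> \<exists>r>0. r < c \<and> measure (mvn V) {x. c - r \<le> mvn_density V x \<and> mvn_density V x \<le> c + r} \<le> \<delta>"
proof -
  interpret prob_space "mvn V" by (rule prob_space_mvn[OF V])
  define \<rho> where "\<rho> = distr (mvn V) borel (mvn_density V)"
  interpret \<rho>: real_distribution \<rho>
    unfolding \<rho>_def by (rule real_distribution_distr) measurable
  have m: "measure \<rho> A = measure (mvn V) {x. mvn_density V x \<in> A}" if "A \<in> sets borel" for A
    unfolding \<rho>_def by (subst measure_distr) (use that in \<open>auto simp: vimage_def\<close>)
  have cdf: "cdf \<rho> t = measure (mvn V) {x. mvn_density V x \<le> t}" for t
    unfolding cdf_def by (subst m) auto
  have cont: "isCont (cdf \<rho>) t" for t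
    unfolding \<rho>.isCont_cdf by (subst m) (auto simp: measure_def mvn_level_null[OF V])
  have c0: "cdf \<rho> 0 = 0"
  proof -
    have "{x. mvn_density V x \<le> 0} = {}" using mvn_density_pos[OF V] by (auto simp: not_le)
    then show ?thesis unfolding cdf by simp
  qed
  obtain T where T: "T > 0" "cdf \<rho> T > \<alpha>"
  proof -
    have "eventually (\<lambda>t. cdf \<rho> t > \<alpha>) at_top"
      using \<rho>.cdf_lim_at_top_prob \<alpha>(2) by (rule order_tendstoD)
    then have "eventually (\<lambda>t. cdf \<rho> t > \<alpha> \<and> t > 0) at_top"
      using eventually_gt_at_top[of 0] by eventually_elim auto
    then show ?thesis using that by (auto simp: eventually_at_top_linorder)
  qed
  then obtain c where c: "0 \<le> c" "c \<le> T" "cdf \<rho> c = \<alpha>"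
    using IVT[of "cdf \<rho>" 0 \<alpha> T] cont c0 \<alpha> by auto
  have "c > 0" using c(1,3) c0 \<alpha>(1) by (cases "c = 0") auto
  moreover have "measure (mvn V) {x. c \<le> mvn_density V x} = 1 - \<alpha>"
  proof -
    have "{x. mvn_density V x \<le> c} = {x. mvn_density V x < c} \<union> {x. mvn_density V x = c}" by auto
    then have "measure (mvn V) {x. mvn_density V x \<le> c} = measure (mvn V) {x. mvn_density V x < c}"
      by (auto simp: measure_def mvn_level_null[OF V] emeasure_Un_null_set null_setsI)
    then have "measure (mvn V) {x. mvn_density V x < c} = \<alpha>" using c(3) cdf by simp
    moreover have "{x. c \<le> mvn_density V x} = space (mvn V) - {x. mvn_density V x < c}" by auto
    moreover have "{x. mvn_density V x < c} \<in> events" by measurable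
    ultimately show ?thesis using prob_compl by metis
  qed
  moreover have "\<exists>r>0. r < c \<and> measure (mvn V) {x. c - r \<le> mvn_density V x \<and> mvn_density V x \<le> c + r} \<le> \<delta>"
    if \<delta>: "\<delta> > 0" for \<delta>
  proof -
    obtain d where d: "d > 0" "\<And>t. \<bar>t - c\<bar> < d \<Longrightarrow> \<bar>cdf \<rho> t - cdf \<rho> c\<bar> < \<delta> / 2"
      using cont[of c] \<delta> unfolding continuous_at_eps_delta dist_real_def by (meson half_gt_zero)
    define r where "r = min (d / 3) (c / 3)"
    have r: "r > 0" "2 * r < d" "r < c" using d(1) \<open>c > 0\<close> by (auto simp: r_def min_def)
    have "measure (mvn V) {x. c - r \<le> mvn_density V x \<and> mvn_density V x \<le> c + r}
        \<le> measure \<rho> {c - 2 * r <.. c + r}"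
    proof (subst m)
      show "measure (mvn V) {x. c - r \<le> mvn_density V x \<and> mvn_density V x \<le> c + r}
          \<le> measure (mvn V) {x. mvn_density V x \<in> {c - 2 * r<..c + r}}"
        using r(1) by (intro finite_measure_mono) auto
    qed simp
    also have "\<dots> = cdf \<rho> (c + r) - cdf \<rho> (c - 2 * r)"
      using \<rho>.cdf_diff_eq[of "c - 2 * r" "c + r"] r by simp
    also have "\<dots> \<le> \<delta>"
      using d(2)[of "c + r"] d(2)[of "c - 2 * r"] r by linarith
    finally show ?thesis using r by blast
  qed
  ultimately show ?thesis using that by blast
qed

lemma mvn_tail:
  fixes V :: "('n::finite) sqmat"
  assumes V: "posdef V" and \<delta>: "\<delta> > 0"
  obtains R where "R > 0" "measure (mvn V) {x. R < norm x} < \<delta>"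
proof -
  interpret prob_space "mvn V" by (rule prob_space_mvn[OF V])
  have "(\<lambda>n. measure (mvn V) {x. real n < norm x}) \<longlonglongrightarrow> measure (mvn V) (\<Inter>n. {x. real n < norm x})"
    by (rule finite_Lim_measure_decseq) (auto simp: decseq_def)
  moreover have "(\<Inter>n. {x. real n < norm x}) = ({} :: 'n rvec set)"
  proof -
    have "\<exists>n. \<not> real n < norm x" for x :: "'n rvec"
      using reals_Archimedean2[of "norm x"] by (meson less_imp_le not_le)
    then show ?thesis by auto
  qed
  ultimately have "(\<lambda>n. measure (mvn V) {x. real n < norm x}) \<longlonglongrightarrow> 0" by simp
  then have "eventually (\<lambda>n. measure (mvn V) {x. real n < norm x} < \<delta>) sequentially"
    using \<delta> by (rule order_tendstoD)
  then have "eventually (\<lambda>n. measure (mvn V) {x. real n < norm x} < \<delta> \<and> n > 0) sequentially"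
    using eventually_gt_at_top[of 0] by eventually_elim auto
  then obtain n where "n > 0" "measure (mvn V) {x. real n < norm x} < \<delta>"
    by (auto simp: eventually_sequentially)
  then show ?thesis using that[of "real n"] by simp
qed

text \<open>
  Normal laws on the same space dominate each other, uniformly over bounded shifts: up to a tail, the
  shifted density of one is at most a constant times the density of the other.
\<close>

lemma mvn_shift_contiguous:
  fixes V\<^sub>1 V\<^sub>2 :: "('n::finite) sqmat"
  assumes V1: "posdef V\<^sub>1" and V2: "posdef V\<^sub>2" and \<delta>: "\<delta> > 0"
  obtains \<eta> where "\<eta> > 0" "\<And>(A :: 'n rvec set) t. \<lbrakk>A \<in> sets borel; norm t \<le> B; measure (mvn V\<^sub>1) A \<le> \<eta>\<rbrakk>
    \<Longrightarrow> measure (mvn V\<^sub>2) {z :: 'n rvec. z + t \<in> A} \<le> \<delta>"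
proof -
  interpret Q1: prob_space "mvn V\<^sub>1" by (rule prob_space_mvn[OF V1])
  interpret Q2: prob_space "mvn V\<^sub>2" by (rule prob_space_mvn[OF V2])
  have "\<delta> / 2 > 0" using \<delta> by simp
  then obtain R where R: "R > 0" "measure (mvn V\<^sub>2) {x. R < norm x} < \<delta> / 2"
    by (rule mvn_tail[OF V2]) (rule that)
  let ?K = "cball (0 :: 'n rvec) (R + \<bar>B\<bar>)"
  have ne: "?K \<noteq> {}" using R(1) by auto
  obtain z\<^sub>1 where z1: "\<And>z. z \<in> ?K \<Longrightarrow> mvn_density V\<^sub>1 z\<^sub>1 \<le> mvn_density V\<^sub>1 z"
    using continuous_attains_inf[OF compact_cball ne continuous_on_subset[OF continuous_on_mvn_density]]
      by (metis subset_UNIV)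
  define m where "m = mvn_density V\<^sub>1 z\<^sub>1"
  have m: "m > 0" unfolding m_def by (rule mvn_density_pos[OF V1])
  obtain M where M: "M > 0" "\<And>x. mvn_density V\<^sub>2 x \<le> M"
  proof -
    obtain c where c: "c > 0" "\<And>x. mvn_density V\<^sub>2 x = c * exp (- (x \<bullet> (matrix_inv V\<^sub>2 *v x)) / 2)"
      by (rule mvn_density_factor[OF V2]) (rule that)
    have "0 \<le> x \<bullet> (matrix_inv V\<^sub>2 *v x)" for x
      using posdefD(2)[OF posdef_matrix_inv[OF V2], of x] by (cases "x = 0") auto
    then have "mvn_density V\<^sub>2 x \<le> c" for x unfolding c(2) using c(1) by (simp add: mult_left_le)
    then show ?thesis using that c(1) by blast
  qed
  show ?thesis
  proof (rule that)
    show "\<delta> * m / (2 * M) > 0" using \<delta> m M(1) by simp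
    fix A :: "'n rvec set" and t :: "'n rvec"
    assume [measurable]: "A \<in> sets borel" and t: "norm t \<le> B" and A: "measure (mvn V\<^sub>1) A \<le> \<delta> * m / (2 * M)"
    let ?D = "{z :: 'n rvec. z + t \<in> A \<and> norm z \<le> R}"
    have [measurable]: "?D \<in> sets borel" "{z :: 'n rvec. z + t \<in> A} \<in> sets borel" "{x::'n rvec. R < norm x}
      \<in> sets borel" by measurable
    have "emeasure (mvn V\<^sub>2) ?D = (\<integral>\<^sup>+z. ennreal (mvn_density V\<^sub>2 z) * indicator ?D z \<partial>lborel)"
      unfolding mvn_def by (rule emeasure_density) auto
    also have "\<dots> \<le> (\<integral>\<^sup>+z. ennreal (M / m) * (ennreal (mvn_density V\<^sub>1 (t + z)) * indicator A (t + z)) \<partial>lborel)"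
    proof (rule nn_integral_mono)
      fix z
      show "ennreal (mvn_density V\<^sub>2 z) * indicator ?D z
          \<le> ennreal (M / m) * (ennreal (mvn_density V\<^sub>1 (t + z)) * indicator A (t + z))"
      proof (cases "z \<in> ?D")
        case True
        then have "norm (t + z) \<le> R + \<bar>B\<bar>" using t norm_triangle_ineq[of t z] by auto
        then have "m \<le> mvn_density V\<^sub>1 (t + z)" unfolding m_def by (intro z1) simp
        then have "M * 1 \<le> M * (mvn_density V\<^sub>1 (t + z) / m)" using m M(1) by (intro mult_left_mono) auto
        then have "mvn_density V\<^sub>2 z \<le> M / m * mvn_density V\<^sub>1 (t + z)" using M(2)[of z] by simp
        then show ?thesis using True m M(1) mvn_density_pos[OF V1, of "t + z"]
          by (simp add: add.commute ennreal_mult[symmetric] ennreal_leI)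
      qed simp
    qed
    also have "\<dots> = (\<integral>\<^sup>+z. ennreal (M / m) * (ennreal (mvn_density V\<^sub>1 z) * indicator A z) \<partial>lborel)"
      by (rule nn_integral_lborel_translate[where f="\<lambda>z. ennreal (M / m) * (ennreal (mvn_density V\<^sub>1 z)
        * indicator A z)"]) measurable
    also have "\<dots> = ennreal (M / m) * emeasure (mvn V\<^sub>1) A"
      by (subst nn_integral_cmult) (auto simp: mvn_def emeasure_density)
    also have "\<dots> = ennreal (M / m * measure (mvn V\<^sub>1) A)"
      using m M(1) by (simp only: Q1.emeasure_eq_measure, subst ennreal_mult) auto
    finally have "measure (mvn V\<^sub>2) ?D \<le> M / m * measure (mvn V\<^sub>1) A"
      using m M(1) by (simp add: Q2.emeasure_eq_measure)
    also have "\<dots> \<le> M / m * (\<delta> * m / (2 * M))" using A m M(1) by (intro mult_left_mono) auto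
    also have "\<dots> = \<delta> / 2" using m M(1) by simp
    finally have D: "measure (mvn V\<^sub>2) ?D \<le> \<delta> / 2" .
    have "measure (mvn V\<^sub>2) {z :: 'n rvec. z + t \<in> A} \<le> measure (mvn V\<^sub>2) (?D \<union> {x. R < norm x})"
      by (rule Q2.finite_measure_mono) auto
    also have "\<dots> \<le> measure (mvn V\<^sub>2) ?D + measure (mvn V\<^sub>2) {x. R < norm x}"
      by (rule measure_Un_le) auto
    finally show "measure (mvn V\<^sub>2) {z :: 'n rvec. z + t \<in> A} \<le> \<delta>" using D R(2) by simp
  qed
qed

text \<open>
  The indicator of the superlevel set is continuous off the level set, which is null, so dominated
  convergence applies.
\<close>

lemma mvn_shifted_probability_continuous:
  fixes V\<^sub>1 V\<^sub>2 :: "('n::finite) sqmat"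
  assumes V1: "posdef V\<^sub>1" and V2: "posdef V\<^sub>2"
  shows "continuous_on UNIV (\<lambda>t. measure (mvn V\<^sub>2) {z. z + t \<in> {x. c \<le> mvn_density V\<^sub>1 x}})"
proof -
  interpret prob_space "mvn V\<^sub>2" by (rule prob_space_mvn[OF V2])
  let ?E = "{x. c \<le> mvn_density V\<^sub>1 x}" and ?N = "{x. mvn_density V\<^sub>1 x = c}"
  have E[measurable]: "?E \<in> sets borel" and N[measurable]: "?N \<in> sets borel" by measurable
  have E'[measurable]: "{z. z + t \<in> ?E} \<in> sets borel" for t by measurable
  have "AE x in mvn V\<^sub>1. x \<notin> ?N"
    by (rule AE_I[OF _ mvn_level_null[OF V1, of c]]) auto
  then have AE1: "AE x in lborel. x \<notin> ?N" unfolding AE_mvn_iff[OF V1] .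
  have "continuous (at t) (\<lambda>t. measure (mvn V\<^sub>2) {z. z + t \<in> ?E})" for t
    unfolding continuous_at_sequentially comp_def
  proof (intro allI impI)
    fix s :: "nat \<Rightarrow> 'n rvec" assume s: "s \<longlonglongrightarrow> t"
    have shift: "AE z in lborel. z + t \<notin> ?N"
    proof -
      have "(\<integral>\<^sup>+z. indicator ?N (t + z) \<partial>lborel) = (\<integral>\<^sup>+z. indicator ?N z \<partial>lborel)"
        by (rule nn_integral_lborel_translate) measurable
      also have "\<dots> = 0" using AE1 by (subst nn_integral_0_iff_AE) auto
      finally have "AE z in lborel. indicator ?N (t + z) = (0 :: ennreal)"
        by (subst (asm) nn_integral_0_iff_AE) measurable
      then show ?thesis by eventually_elim (auto simp: indicator_def add.commute split: if_splits)
    qed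
    have "(\<lambda>n. \<integral>z. indicator {z. z + s n \<in> ?E} z \<partial>mvn V\<^sub>2) \<longlonglongrightarrow> (\<integral>z. indicator {z. z + t \<in> ?E} z \<partial>mvn V\<^sub>2 :: real)"
    proof (rule integral_dominated_convergence[where w="\<lambda>_. 1"])
      show "AE z in mvn V\<^sub>2. (\<lambda>n. indicator {z. z + s n \<in> ?E} z) \<longlonglongrightarrow> (indicator {z. z + t \<in> ?E} z :: real)"
        unfolding AE_mvn_iff[OF V2] using shift
      proof eventually_elim
        fix z assume z: "z + t \<notin> ?N"
        have "isCont (mvn_density V\<^sub>1) (z + t)"
          using continuous_on_mvn_density[of V\<^sub>1] by (simp add: continuous_on_eq_continuous_at)
        moreover have "(\<lambda>n. z + s n) \<longlonglongrightarrow> z + t" by (intro tendsto_intros s)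
        ultimately have lim: "(\<lambda>n. mvn_density V\<^sub>1 (z + s n)) \<longlonglongrightarrow> mvn_density V\<^sub>1 (z + t)"
          by (rule isCont_tendsto_compose)
        show "(\<lambda>n. indicator {z. z + s n \<in> ?E} z) \<longlonglongrightarrow> (indicator {z. z + t \<in> ?E} z :: real)"
        proof (rule tendsto_eventually)
          consider "c < mvn_density V\<^sub>1 (z + t)" | "mvn_density V\<^sub>1 (z + t) < c" using z by force
          then show "eventually (\<lambda>n. indicator {z. z + s n \<in> ?E} z = (indicator {z. z + t
            \<in> ?E} z :: real)) sequentially"
          proof cases
            case 1
            from order_tendstoD(1)[OF lim 1] show ?thesis by eventually_elim (use 1 in \<open>auto
              simp: indicator_def\<close>)
          next
            case 2
            from order_tendstoD(2)[OF lim 2] show ?thesis by eventually_elim (use 2 in \<open>auto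
              simp: indicator_def\<close>)
          qed
        qed
      qed
    qed (auto simp: E' indicator_def)
    then show "(\<lambda>n. measure (mvn V\<^sub>2) {z. z + s n \<in> ?E}) \<longlonglongrightarrow> measure (mvn V\<^sub>2) {z. z + t \<in> ?E}"
      using E' by simp
  qed
  then show ?thesis by (simp add: continuous_on_eq_continuous_at)
qed

section \<open>Derivatives of the determinant and of the inverse matrix\<close>

lemma matrix_diff_rdistrib: "(A - B) ** C = A ** C - B ** (C :: real^'n^'m)"
  by (simp add: matrix_matrix_mult_def vec_eq_iff sum_subtractf left_diff_distrib)

lemma matrix_diff_ldistrib: "A ** (B - C) = A ** B - A ** (C :: real^'n^'m)"
  by (simp add: matrix_matrix_mult_def vec_eq_iff sum_subtractf right_diff_distrib)

lemma continuous_on_det: "continuous_on UNIV (det :: ('n::finite) sqmat \<Rightarrow> real)"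
  unfolding det_def by (intro continuous_intros)

text \<open>
  Cramer's rule; it makes inversion a rational, hence continuous, operation.
\<close>

lemma matrix_inv_component:
  fixes A :: "('n::finite) sqmat"
  assumes "invertible A"
  shows "matrix_inv A $ i $ j = det (\<chi> a b. if b = i then (axis j 1 :: 'n rvec) $ a else A $ a $ b) / det A"
proof -
  have "det A \<noteq> 0" using assms by (simp add: invertible_det_nz)
  moreover have "A *v (matrix_inv A *v axis j 1) = axis j 1" by (rule matrix_vector_inv[OF assms])
  ultimately have "matrix_inv A *v axis j 1
      = (\<chi> k. det (\<chi> a b. if b = k then (axis j 1 :: 'n rvec) $ a else A $ a $ b) / det A)"
    using cramer by blast
  then have "(matrix_inv A *v axis j 1) $ i = det (\<chi> a b. if b = i then (axis j 1 :: 'n rvec) $ a else A $ a $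
    b) / det A"
    by (metis (no_types, lifting) vec_lambda_beta)
  moreover have "(matrix_inv A *v axis j 1) $ i = matrix_inv A $ i $ j"
    by (simp add: matrix_vector_mult_basis column_def)
  ultimately show ?thesis by simp
qed

lemma continuous_on_matrix_inv: "continuous_on {A :: ('n::finite) sqmat. invertible A} matrix_inv"
proof -
  have if_cont: "continuous_on S (\<lambda>A :: 'n sqmat. if b = i then c else A $ a $ b)" for S a b i c
    by (cases "b = i") (auto intro!: continuous_intros)
  have "continuous_on {A :: 'n sqmat. invertible A} (\<lambda>A. \<chi> i j. det (\<chi> a b. if b = i then (axis j 1 :: 'n rvec)
    $ a else A $ a $ b) / det A)"
    by (intro continuous_on_vec_lambda continuous_on_divide continuous_on_compose2[OF continuous_on_det])
      (auto intro!: if_cont simp: invertible_det_nz)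
  then show ?thesis
    by (rule continuous_on_eq) (simp add: vec_eq_iff matrix_inv_component)
qed

lemma open_invertible: "open {A :: ('n::finite) sqmat. invertible A}"
proof -
  have "{A :: 'n sqmat. invertible A} = det -` (- {0})" by (auto simp: invertible_det_nz)
  moreover have "open (det -` (- {0}) :: 'n sqmat set)" by (rule open_vimage[OF _ continuous_on_det]) (simp add:
    open_Compl)
  ultimately show ?thesis by simp
qed

lemma isCont_matrix_inv:
  fixes A :: "('n::finite) sqmat"
  assumes "invertible A"
  shows "isCont matrix_inv A"
  using continuous_on_matrix_inv[where 'n='n] assms unfolding continuous_on_eq_continuous_at[OF open_invertible]
    by simp

lemma has_derivative_det_id: "((det :: ('n::finite) sqmat \<Rightarrow> real) has_derivative trace) (at (mat 1))"
proof -
  let ?P = "{p :: 'n \<Rightarrow> 'n. p permutes UNIV}"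
  let ?I = "mat 1 :: 'n sqmat"
  have comp: "((\<lambda>A :: 'n sqmat. A $ i $ j) has_derivative (\<lambda>H. H $ i $ j)) (at ?I)" for i j
    by (intro bounded_linear_imp_has_derivative bounded_linear_compose[OF bounded_linear_vec_nth]
      bounded_linear_vec_nth)
  have "((\<lambda>A :: 'n sqmat. \<Sum>p\<in>?P. of_int (sign p) * (\<Prod>i\<in>UNIV. A $ i $ p i)) has_derivative
     (\<lambda>H. \<Sum>p\<in>?P. of_int (sign p) * (\<Sum>i\<in>UNIV. H $ i $ p i * (\<Prod>j\<in>UNIV - {i}. ?I $ j $ p j)))) (at ?I)"
    by (intro has_derivative_sum has_derivative_mult_right has_derivative_prod comp)
  moreover have "(\<Sum>p\<in>?P. of_int (sign p) * (\<Sum>i\<in>UNIV. H $ i $ p i * (\<Prod>j\<in>UNIV - {i}. ?I $ j $ p j))) = trace H"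
    for H :: "'n sqmat"
  proof -
    \<comment> \<open>a permutation other than the identity moves an index different from any given one\<close>
    have zero: "(\<Prod>j\<in>UNIV - {i}. ?I $ j $ p j) = 0" if p: "p \<in> ?P" "p \<noteq> id" for p i
    proof -
      obtain a where a: "p a \<noteq> a" using p(2) by (auto simp: fun_eq_iff)
      have "p (p a) \<noteq> p a" using a p(1) by (auto dest: permutes_inj injD)
      then obtain j where "j \<noteq> i" "p j \<noteq> j" using a by (cases "a = i") auto
      then show ?thesis by (intro prod_zero bexI[of _ j]) (auto simp: mat_def)
    qed
    have "(\<Sum>p\<in>?P. of_int (sign p) * (\<Sum>i\<in>UNIV. H $ i $ p i * (\<Prod>j\<in>UNIV - {i}. ?I $ j $ p j)))
        = (\<Sum>p\<in>?P. if p = id then trace H else 0)"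
    proof (rule sum.cong[OF refl])
      fix p assume p: "p \<in> ?P"
      show "of_int (sign p) * (\<Sum>i\<in>UNIV. H $ i $ p i * (\<Prod>j\<in>UNIV - {i}. ?I $ j $ p j)) = (if p
        = id then trace H else 0)"
      proof (cases "p = id")
        case True
        have "(\<Prod>j\<in>UNIV - {i}. ?I $ j $ j) = 1" for i by (simp add: mat_def)
        then show ?thesis using True by (simp add: sign_id trace_def)
      qed (simp add: zero[OF p])
    qed
    also have "\<dots> = trace H" by (simp add: finite_permutations permutes_id)
    finally show ?thesis .
  qed
  ultimately show ?thesis unfolding det_def[abs_def] by simp
qed

lemma bounded_linear_matrix_mult_right: "bounded_linear (\<lambda>X :: real^'n^'m. (A :: real^'m^'k) ** X)"
  by (rule linear_conv_bounded_linear[THEN iffD1]) (auto intro!: linearI simp: matrix_matrix_mult_def vec_eq_iff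
    sum_distrib_left distrib_left sum.distrib mult_ac)

text \<open>
  Multiplicativity, \<open>det X = det A \<cdot> det (A\<^sup>-\<^sup>1 X)\<close>, moves the point of differentiation to the
  identity.
\<close>

lemma has_derivative_det:
  fixes A :: "('n::finite) sqmat"
  assumes "invertible A"
  shows "(det has_derivative (\<lambda>H. det A * trace (matrix_inv A ** H))) (at A)"
proof -
  have "((\<lambda>X. matrix_inv A ** X) has_derivative (\<lambda>H. matrix_inv A ** H)) (at A)"
    by (rule bounded_linear_imp_has_derivative[OF bounded_linear_matrix_mult_right])
  moreover have "(det has_derivative trace) (at (matrix_inv A ** A))"
    using has_derivative_det_id by (simp add: matrix_inv_lr[OF assms])
  ultimately have "((\<lambda>X. det (matrix_inv A ** X)) has_derivative (\<lambda>H. trace (matrix_inv A ** H))) (at A)"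
    by (rule has_derivative_compose)
  then have "((\<lambda>X. det A * det (matrix_inv A ** X)) has_derivative (\<lambda>H. det A * trace (matrix_inv A ** H))) (at
    A)"
    by (rule has_derivative_mult_right)
  moreover have "det A * det (matrix_inv A ** X) = det X" for X :: "'n sqmat"
    using matrix_inv_lr(1)[OF assms] by (metis det_I det_mul mult.assoc mult_1)
  ultimately show ?thesis by simp
qed

text \<open>
  By \<open>X\<^sup>-\<^sup>1 - A\<^sup>-\<^sup>1 = - X\<^sup>-\<^sup>1 (X - A) A\<^sup>-\<^sup>1\<close> the error of the linear approximation is
  \<open>(A\<^sup>-\<^sup>1 - X\<^sup>-\<^sup>1) (X - A) A\<^sup>-\<^sup>1\<close>, so that continuity of inversion suffices.
\<close>

lemma has_derivative_inverse_quadratic: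
  fixes A :: "('n::finite) sqmat"
  assumes inv: "invertible A"
  shows "((\<lambda>X. x \<bullet> (matrix_inv X *v x)) has_derivative
    (\<lambda>H. - (x \<bullet> ((matrix_inv A ** H ** matrix_inv A) *v x)))) (at A)"
proof -
  let ?W = "matrix_inv A"
  let ?L = "\<lambda>H. - (x \<bullet> ((?W ** H ** ?W) *v x))"
  have L: "?L H = - ((x v* ?W) \<bullet> (H *v (?W *v x)))" for H
    by (simp add: matrix_vector_mul_assoc dot_lmul_matrix matrix_mul_assoc)
  have lin: "bounded_linear ?L"
    unfolding L by (intro linear_conv_bounded_linear[THEN iffD1] linearI)
      (auto simp: matrix_vector_mult_add_rdistrib inner_add_right scaleR_matrix_vector_assoc[symmetric])
  have cont: "(\<lambda>X. matrix_inv X) \<midarrow>A\<rightarrow> ?W"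
    using isCont_matrix_inv[OF inv] by (simp add: isCont_def)
  have lim: "((\<lambda>X. norm x * norm (?W - matrix_inv X) * norm (?W *v x)) \<longlongrightarrow> norm x * norm (?W - ?W)
    * norm (?W *v x)) (at A)"
    by (intro tendsto_intros cont)
  have "((\<lambda>X. norm (x \<bullet> (matrix_inv X *v x) - x \<bullet> (?W *v x) - ?L (X - A)) / norm (X - A)) \<longlongrightarrow> 0) (at A)"
  proof (rule tendsto_sandwich[of "\<lambda>_. 0", OF _ _ tendsto_const])
    show "((\<lambda>X. norm x * norm (?W - matrix_inv X) * norm (?W *v x)) \<longlongrightarrow> 0) (at A)" using lim by simp
    have "eventually (\<lambda>X. invertible X) (at A)"
      using open_invertible inv by (auto simp: eventually_at_topological)
    then show "eventually (\<lambda>X. norm (x \<bullet> (matrix_inv X *v x) - x \<bullet> (?W *v x) - ?L (X - A)) / norm (X - A)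
        \<le> norm x * norm (?W - matrix_inv X) * norm (?W *v x)) (at A)"
    proof (eventually_elim)
      fix X :: "'n sqmat" assume X: "invertible X"
      have "(?W - matrix_inv X) *v ((X - A) *v (?W *v x)) = (?W ** (X - A) ** ?W) *v x - matrix_inv X *v ((X
        - A) *v (?W *v x))"
        by (simp only: matrix_vector_mult_diff_rdistrib[of ?W
          "matrix_inv X"] matrix_vector_mul_assoc[symmetric])
      also have "matrix_inv X *v ((X - A) *v (?W *v x)) = ?W *v x - matrix_inv X *v x"
        by (simp add: matrix_vector_mult_diff_rdistrib matrix_vector_mult_diff_distrib matrix_vector_inv[OF X]
          matrix_vector_inv[OF inv])
      finally have eq: "x \<bullet> (matrix_inv X *v x) - x \<bullet> (?W *v x) - ?L (X - A)
          = x \<bullet> ((?W - matrix_inv X) *v ((X - A) *v (?W *v x)))"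
        by (simp add: inner_diff_right)
      have "norm (x \<bullet> ((?W - matrix_inv X) *v ((X - A) *v (?W *v x))))
          \<le> norm x * (norm (?W - matrix_inv X) * (norm (X - A) * norm (?W *v x)))"
        using Cauchy_Schwarz_ineq2[of x "(?W - matrix_inv X) *v ((X - A) *v (?W *v x))"]
          norm_matrix_vector_mult_le[of "?W - matrix_inv X" "(X - A) *v (?W *v x)"]
          norm_matrix_vector_mult_le[of "X - A" "?W *v x"]
        by (smt (verit, best) mult_left_mono norm_ge_zero real_norm_def)
      then show "norm (x \<bullet> (matrix_inv X *v x) - x \<bullet> (?W *v x) - ?L (X - A)) / norm (X - A)
        \<le> norm x * norm (?W - matrix_inv X) * norm (?W *v x)"
        unfolding eq by (cases "X = A") (auto simp: divide_le_eq mult_ac)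
    qed
  qed auto
  then show ?thesis
    using lin unfolding has_derivative_iff_norm by simp
qed

section \<open>The parametrization by the distinct entries\<close>

lemma Rep_upper_le: "fst (Rep_upper u) \<le> snd (Rep_upper (u :: 'p::linorder upper))"
  using Rep_upper[of u] by auto

lemma Abs_upper_Rep: "i \<le> j \<Longrightarrow> Rep_upper (Abs_upper (i, j)) = (i, j)"
  by (rule Abs_upper_inverse) auto

lemma Sig_nth: "Sig \<theta> $ i $ j = \<theta> $ Abs_upper (min i j, max i j)"
  by (simp add: Sig_def)

lemma theta_nth: "theta \<Sigma> $ u = \<Sigma> $ fst (Rep_upper u) $ snd (Rep_upper u)"
  by (simp add: theta_def)

lemma transpose_Sig: "transpose (Sig \<theta>) = Sig \<theta>"
  by (simp add: transpose_def vec_eq_iff Sig_nth min.commute max.commute)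

lemma theta_Sig: "theta (Sig \<theta>) = \<theta>"
proof -
  have "Abs_upper (min (fst (Rep_upper u)) (snd (Rep_upper u)), max (fst (Rep_upper u)) (snd (Rep_upper u)))
    = u"
    for u :: "'a upper"
    by (simp only: min_absorb1[OF Rep_upper_le] max_absorb2[OF Rep_upper_le] prod.collapse Rep_upper_inverse)
  then show ?thesis
    by (simp add: vec_eq_iff theta_nth Sig_nth)
qed

lemma Sig_theta:
  fixes \<Sigma> :: "('p::{finite,linorder}) sqmat"
  assumes "transpose \<Sigma> = \<Sigma>"
  shows "Sig (theta \<Sigma>) = \<Sigma>"
proof -
  have "\<Sigma> $ i $ j = \<Sigma> $ j $ i" for i j using assms by (metis transpose_def vec_lambda_beta)
  then show ?thesis
    by (auto simp: vec_eq_iff Sig_nth theta_nth Abs_upper_Rep min_def max_def)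
qed

lemma linear_Sig: "linear (Sig :: ('p::{finite,linorder}) param \<Rightarrow> _)"
  by (rule linearI) (simp_all add: vec_eq_iff Sig_nth)

lemma bounded_linear_Sig: "bounded_linear (Sig :: ('p::{finite,linorder}) param \<Rightarrow> _)"
  using linear_Sig by (simp add: linear_linear)

lemmas Sig_diff = linear_diff[OF linear_Sig]
  and Sig_scaleR = linear_scale[OF linear_Sig]
  and Sig_zero = linear_0[OF linear_Sig]

lemma Sig_eq_0_iff: "Sig \<theta> = 0 \<longleftrightarrow> \<theta> = 0"
proof
  assume "Sig \<theta> = 0"
  then have "theta (Sig \<theta>) = theta 0" by simp
  then show "\<theta> = 0" by (simp add: theta_Sig) (simp add: theta_def vec_eq_iff)
qed (simp add: Sig_zero)

definition unit_sym :: "('p::{finite,linorder}) upper \<Rightarrow> 'p sqmat" where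
  "unit_sym u = Sig (axis u 1)"

lemma Sig_eq_sum: "Sig \<theta> = (\<Sum>u\<in>UNIV. \<theta> $ u *\<^sub>R unit_sym u)"
proof -
  have "\<theta> = (\<Sum>u\<in>UNIV. \<theta> $ u *\<^sub>R axis u 1)"
    by (simp add: vec_eq_iff axis_def mult_if sum.delta cong: if_cong)
  then have "Sig \<theta> = Sig (\<Sum>u\<in>UNIV. \<theta> $ u *\<^sub>R axis u 1)" by simp
  then show ?thesis by (simp add: linear_sum[OF linear_Sig] Sig_scaleR unit_sym_def)
qed

text \<open>
  The bilinear form \<open>(h, k) \<mapsto> tr (W \<Sigma>(h) W \<Sigma>(k)) / 2\<close>; at \<open>W = \<Sigma>\<^sup>-\<^sup>1\<close> it is the Fisher information of
  the Gaussian covariance model.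
\<close>

definition info :: "('p::{finite,linorder}) sqmat \<Rightarrow> 'p upper sqmat" where
  "info W = (\<chi> u v. trace (W ** unit_sym u ** W ** unit_sym v) / 2)"

lemma trace_scaleR: "trace (c *\<^sub>R (A :: real^'n^'n)) = c * trace A"
  by (simp add: trace_def sum_distrib_left)

lemma linear_trace: "linear (trace :: real^'n^'n \<Rightarrow> real)"
  by (rule linearI) (simp_all add: trace_add trace_scaleR)

lemma linear_mult_mid: "linear (\<lambda>X :: real^'n^'n. A ** X ** B)"
  by (rule linearI) (simp_all add: matrix_matrix_mult_def vec_eq_iff sum.distrib distrib_left distrib_right
      sum_distrib_left sum_distrib_right mult_ac)

lemma info_bilinear: "h \<bullet> (info W *v k) = trace (W ** Sig h ** W ** Sig k) / 2"
proof -
  have l1: "linear (\<lambda>X. trace (W ** X ** (W ** Sig k)))"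
    using linear_compose[OF linear_mult_mid linear_trace] by (simp add: comp_def)
  have l2: "linear (\<lambda>X. trace ((W ** unit_sym u ** W) ** X))" for u
    using linear_compose[OF linear_mult_mid[where B="mat 1"] linear_trace]
      by (simp only: comp_def matrix_mul_rid)
  have "trace (W ** Sig h ** W ** Sig k) = trace (W ** (\<Sum>u\<in>UNIV. h $ u *\<^sub>R unit_sym u) ** (W ** Sig k))"
    by (simp only: Sig_eq_sum[of h] matrix_mul_assoc)
  also have "\<dots> = (\<Sum>u\<in>UNIV. h $ u * trace (W ** unit_sym u ** (W ** Sig k)))"
    by (simp add: linear_sum[OF l1] linear_scale[OF l1])
  also have "\<dots> = (\<Sum>u\<in>UNIV. h $ u * (\<Sum>v\<in>UNIV. k $ v * trace (W ** unit_sym u ** W ** unit_sym v)))"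
  proof (rule sum.cong[OF refl])
    fix u
    have "trace (W ** unit_sym u ** (W ** Sig k)) = trace ((W ** unit_sym u ** W) ** (\<Sum>v\<in>UNIV. k $ v *\<^sub>R
      unit_sym v))"
      by (simp only: Sig_eq_sum[of k] matrix_mul_assoc)
    also have "\<dots> = (\<Sum>v\<in>UNIV. k $ v * trace (W ** unit_sym u ** W ** unit_sym v))"
      by (simp only: linear_sum[OF l2] linear_scale[OF l2] real_scaleR_def)
    finally show "h $ u * trace (W ** unit_sym u ** (W ** Sig k)) = h $ u * (\<Sum>v\<in>UNIV. k $ v
      * trace (W ** unit_sym u ** W ** unit_sym v))"
      by simp
  qed
  finally show ?thesis
    by (simp add: inner_vec_def matrix_vector_mult_def info_def mult.commute flip: sum_divide_distrib)
qed

lemma posdef_info: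
  fixes \<Sigma> :: "('p::{finite,linorder}) sqmat"
  assumes "posdef \<Sigma>"
  shows "posdef (info (matrix_inv \<Sigma>))"
  unfolding posdef_def
proof (intro conjI allI impI)
  let ?W = "matrix_inv \<Sigma>"
  have "trace (?W ** unit_sym v ** ?W ** unit_sym u) = trace (?W ** unit_sym u ** ?W ** unit_sym v)" for u v
    using trace_mul_sym[of "?W ** unit_sym v" "?W ** unit_sym u"] by (simp add: matrix_mul_assoc)
  then show "transpose (info ?W) = info ?W"
    by (simp add: info_def transpose_def vec_eq_iff)
  fix v :: "'p param" assume "v \<noteq> 0"
  then have "Sig v \<noteq> 0" by (simp add: Sig_eq_0_iff)
  then show "0 < v \<bullet> (info ?W *v v)"
    using gscore_variance(2,3)[OF assms transpose_Sig[of v]] unfolding info_bilinear by force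
qed

lemma isCont_info:
  fixes W :: "('p::{finite,linorder}) sqmat"
  shows "isCont info W"
proof -
  have "continuous_on UNIV (info :: 'p sqmat \<Rightarrow> _)"
    unfolding info_def trace_def matrix_matrix_mult_def
    by (intro continuous_on_vec_lambda continuous_on_divide continuous_on_sum) (auto intro!: continuous_intros)
  then show ?thesis by (simp add: continuous_on_eq_continuous_at)
qed

lemma posdef_stable:
  fixes A X :: "('n::finite) sqmat"
  assumes "\<And>v. c * (v \<bullet> v) \<le> v \<bullet> (A *v v)"
  shows "(c - norm (X - A)) * (v \<bullet> v) \<le> v \<bullet> (X *v v)"
proof -
  have "v \<bullet> (X *v v) = v \<bullet> (A *v v) + v \<bullet> ((X - A) *v v)"
    by (simp add: matrix_vector_mult_diff_rdistrib inner_diff_right)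
  then show ?thesis
    using assms[of v] quadratic_form_bound[of v "X - A"] by (simp add: left_diff_distrib)
qed

lemma open_posdef_Sig: "open {\<theta> :: ('p::{finite,linorder}) param. posdef (Sig \<theta>)}"
proof (subst open_contains_ball, safe)
  fix \<theta> :: "'p param" assume "posdef (Sig \<theta>)"
  then obtain c where c: "c > 0" "\<And>v. c * (v \<bullet> v) \<le> v \<bullet> (Sig \<theta> *v v)" by (rule posdef_coercive) (rule that)
  obtain B where B: "B > 0" "\<And>h. norm (Sig h :: 'p sqmat) \<le> norm h * B"
    using bounded_linear.pos_bounded[OF bounded_linear_Sig] by blast
  show "\<exists>d>0. ball \<theta> d \<subseteq> {\<theta>. posdef (Sig \<theta>)}"
  proof (intro exI conjI subsetI CollectI)
    show "c / B > 0" using B c by simp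
    fix \<theta>' assume "\<theta>' \<in> ball \<theta> (c / B)"
    then have "norm (\<theta>' - \<theta>) * B < c" using B(1) by (simp add: dist_norm norm_minus_commute pos_less_divide_eq)
    then have "norm (Sig \<theta>' - Sig \<theta>) < c" using B(2)[of "\<theta>' - \<theta>"] by (simp add: Sig_diff)
    then have "0 < v \<bullet> (Sig \<theta>' *v v)" if "v \<noteq> 0" for v
      using posdef_stable[OF c(2), where X="Sig \<theta>'" and v=v] that
      by (smt (verit, best) inner_gt_zero_iff mult_pos_pos)
    then show "posdef (Sig \<theta>')" by (simp add: posdef_def transpose_Sig)
  qed
qed

section \<open>Score, information and maximum likelihood\<close>

lemma has_derivative_ln_mvn_density:
  fixes \<theta> :: "('p::{finite,linorder}) param"
  assumes pd: "posdef (Sig \<theta>)"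
  shows "((\<lambda>\<theta>'. ln (mvn_density (Sig \<theta>') x)) has_derivative (\<lambda>h. gscore (matrix_inv (Sig \<theta>)) (Sig h) x)) (at \<theta>)"
proof -
  let ?W = "matrix_inv (Sig \<theta>)" and ?\<kappa> = "(2 * pi) ^ CARD('p)"
  have inv: "invertible (Sig \<theta>)" by (rule posdef_invertible[OF pd])
  have dpos: "det (Sig \<theta>) > 0" by (rule det_posdef[OF pd])
  have dS: "(Sig has_derivative Sig) (at \<theta>)"
    by (rule bounded_linear_imp_has_derivative[OF bounded_linear_Sig])
  have d1: "((\<lambda>\<theta>'. x \<bullet> (matrix_inv (Sig \<theta>') *v x)) has_derivative (\<lambda>h. - (x \<bullet> ((?W ** Sig h ** ?W) *v x)))) (at
    \<theta>)"
    by (rule has_derivative_compose[OF dS has_derivative_inverse_quadratic[OF inv]])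
  have d2: "((\<lambda>\<theta>'. det (Sig \<theta>')) has_derivative (\<lambda>h. det (Sig \<theta>) * trace (?W ** Sig h))) (at \<theta>)"
    by (rule has_derivative_compose[OF dS has_derivative_det[OF inv]])
  have d3: "((\<lambda>\<theta>'. ln (det (Sig \<theta>'))) has_derivative (\<lambda>h. (det (Sig \<theta>) * trace (?W ** Sig h))
    * inverse (det (Sig \<theta>)))) (at \<theta>)"
    by (rule has_derivative_ln[OF dpos d2])
  have "((\<lambda>\<theta>'. - (x \<bullet> (matrix_inv (Sig \<theta>') *v x)) / 2 - ln ?\<kappa> / 2 - ln (det (Sig \<theta>')) / 2) has_derivative
     (\<lambda>h. - (- (x \<bullet> ((?W ** Sig h ** ?W) *v x))) / 2 - 0 - ((det (Sig \<theta>) * trace (?W ** Sig h))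
       * inverse (det (Sig \<theta>))) / 2)) (at \<theta>)"
    by (intro has_derivative_diff bounded_linear.has_derivative[OF bounded_linear_divide] has_derivative_minus
      has_derivative_const d1 d3)
  moreover have "- (- (x \<bullet> ((?W ** Sig h ** ?W) *v x))) / 2 - 0 - ((det (Sig \<theta>) * trace (?W ** Sig h))
    * inverse (det (Sig \<theta>))) / 2
      = gscore ?W (Sig h) x" for h
    using dpos by (simp add: gscore_def field_simps)
  ultimately have "((\<lambda>\<theta>'. - (x \<bullet> (matrix_inv (Sig \<theta>') *v x)) / 2 - ln ?\<kappa> / 2 - ln (det (Sig \<theta>')) / 2)
    has_derivative
     (\<lambda>h. gscore ?W (Sig h) x)) (at \<theta>)" by simp
  then show ?thesis
  proof (rule has_derivative_transform_within_open[OF _ open_posdef_Sig])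
    show "\<theta> \<in> {\<theta>. posdef (Sig \<theta>)}" using pd by simp
    fix \<theta>' :: "'p param" assume "\<theta>' \<in> {\<theta>. posdef (Sig \<theta>)}"
    then have "det (Sig \<theta>') > 0" using det_posdef by blast
    then have "ln (sqrt (?\<kappa> * det (Sig \<theta>'))) = ln ?\<kappa> / 2 + ln (det (Sig \<theta>')) / 2"
      by (subst ln_sqrt) (auto simp: ln_mult)
    then show "- (x \<bullet> (matrix_inv (Sig \<theta>') *v x)) / 2 - ln ?\<kappa> / 2 - ln (det (Sig \<theta>')) / 2
      = ln (mvn_density (Sig \<theta>') x)"
      unfolding mvn_density_def using \<open>det (Sig \<theta>') > 0\<close> by (subst ln_div) auto
  qed
qed

lemma grad_eqI:
  assumes "(f has_derivative f') (at \<theta>)"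
  shows "grad f \<theta> $ u = f' (axis u 1)"
  using frechet_derivative_at[OF assms] by (simp add: grad_def)

lemma fisher_eq_info:
  assumes "posdef (Sig \<theta>)"
  shows "fisher \<theta> = info (matrix_inv (Sig \<theta>))"
  unfolding fisher_def info_def grad_eqI[OF has_derivative_ln_mvn_density[OF assms]] unit_sym_def[symmetric]
  using gscore_covariance[OF assms, of "unit_sym _" "unit_sym _"] by (simp add: unit_sym_def transpose_Sig
    vec_eq_iff)

lemma transpose_sample_cov: "transpose (sample_cov n x) = sample_cov n x"
  by (simp add: sample_cov_def transpose_def vec_eq_iff mult.commute)

lemma quadratic_form_trace: "x \<bullet> (M *v x) = trace (M ** (\<chi> a b. x $ a * x $ b))"
  by (simp add: inner_vec_def matrix_vector_mult_def trace_def matrix_matrix_mult_def sum_distrib_left mult_ac)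

lemma sum_gscore:
  fixes \<theta> :: "('p::{finite,linorder}) param"
  assumes n: "n > 0" and pd: "posdef (Sig \<theta>)"
  defines "W \<equiv> matrix_inv (Sig \<theta>)"
  shows "(\<Sum>i<n. gscore W (Sig h) (x i)) = real n * (h \<bullet> (info W *v (theta (sample_cov n x) - \<theta>)))"
proof -
  let ?M = "W ** Sig h ** W" and ?S = "sample_cov n x"
  have lin: "linear (\<lambda>X. trace (?M ** X))"
    using linear_compose[OF linear_mult_mid[where B="mat 1"] linear_trace]
      by (simp only: comp_def matrix_mul_rid)
  have S: "real n *\<^sub>R ?S = (\<Sum>i<n. \<chi> a b. x i $ a * x i $ b)" using n by (simp add: sample_cov_def)
  have "(\<Sum>i<n. x i \<bullet> (?M *v x i)) = (\<Sum>i<n. trace (?M ** (\<chi> a b. x i $ a * x i $ b)))"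
    by (simp only: quadratic_form_trace)
  also have "\<dots> = trace (?M ** (real n *\<^sub>R ?S))" unfolding S by (rule linear_sum[OF lin, symmetric])
  also have "\<dots> = real n * trace (?M ** ?S)" by (simp only: linear_scale[OF lin] real_scaleR_def)
  finally have q: "(\<Sum>i<n. x i \<bullet> (?M *v x i)) = real n * trace (?M ** ?S)" .
  have t: "trace (W ** Sig h) = trace (?M ** Sig \<theta>)"
    by (simp add: W_def matrix_mul_assoc[symmetric] posdef_inv[OF pd])
  have "Sig (theta ?S - \<theta>) = ?S - Sig \<theta>" by (simp add: Sig_diff Sig_theta transpose_sample_cov)
  then have "h \<bullet> (info W *v (theta ?S - \<theta>)) = (trace (?M ** ?S) - trace (?M ** Sig \<theta>)) / 2"
    unfolding info_bilinear by (simp add: matrix_diff_ldistrib trace_diff)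
  moreover have "(\<Sum>i<n. gscore W (Sig h) (x i)) = (real n * trace (?M ** ?S) - real n * trace (?M ** Sig \<theta>)) /
    2"
    unfolding gscore_def t q[symmetric] by (simp add: sum_subtractf sum_divide_distrib diff_divide_distrib)
  ultimately show ?thesis by (simp only: right_diff_distrib times_divide_eq_right)
qed

text \<open>
  The score of the whole sample is an invertible linear image of \<open>S\<^sub>n - \<Sigma>\<close>; everything that follows
  about the maximum likelihood estimators rests on this exact formula.
\<close>

lemma has_derivative_loglik:
  fixes \<theta> :: "('p::{finite,linorder}) param"
  assumes n: "n > 0" and pd: "posdef (Sig \<theta>)"
  shows "(loglik n x has_derivative
    (\<lambda>h. real n * (h \<bullet> (info (matrix_inv (Sig \<theta>)) *v (theta (sample_cov n x) - \<theta>))))) (at \<theta>)"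
proof -
  have "((\<lambda>\<theta>'. \<Sum>i<n. ln (mvn_density (Sig \<theta>') (x i))) has_derivative
      (\<lambda>h. \<Sum>i<n. gscore (matrix_inv (Sig \<theta>)) (Sig h) (x i))) (at \<theta>)"
    by (intro has_derivative_sum has_derivative_ln_mvn_density pd)
  then show ?thesis
    unfolding sum_gscore[OF n pd]
  proof (rule has_derivative_transform_within_open[OF _ open_posdef_Sig])
    show "\<theta> \<in> {\<theta>. posdef (Sig \<theta>)}" using pd by simp
    fix \<theta>' :: "'p param" assume "\<theta>' \<in> {\<theta>. posdef (Sig \<theta>)}"
    then have "mvn_density (Sig \<theta>') (x i) \<noteq> 0" for i
      using mvn_density_pos[of "Sig \<theta>'" "x i"] by simp
    then show "(\<Sum>i<n. ln (mvn_density (Sig \<theta>') (x i))) = loglik n x \<theta>'"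
      unfolding loglik_def lik_def by (subst ln_prod) auto
  qed
qed

lemma grad_loglik:
  assumes "n > 0" "posdef (Sig \<theta>)"
  shows "grad (loglik n x) \<theta> = real n *\<^sub>R (info (matrix_inv (Sig \<theta>)) *v (theta (sample_cov n x) - \<theta>))"
  by (simp add: vec_eq_iff grad_eqI[OF has_derivative_loglik[OF assms]] inner_axis inner_commute[of "axis _ _"])

text \<open>
  The derivative at a maximizer vanishes also in the direction \<open>\<theta>(S\<^sub>n) - \<theta>\<close>, where it is a positive
  definite form evaluated at that very vector.
\<close>

lemma mle_full_eq:
  fixes \<theta> :: "('p::{finite,linorder}) param"
  assumes n: "n > 0" and max: "is_arg_max (loglik n x) (\<lambda>\<theta>. posdef (Sig \<theta>)) \<theta>"
  shows "\<theta> = theta (sample_cov n x)"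
proof -
  let ?d = "theta (sample_cov n x) - \<theta>"
  have pd: "posdef (Sig \<theta>)" and le: "\<And>\<theta>'. posdef (Sig \<theta>') \<Longrightarrow> loglik n x \<theta>' \<le> loglik n x \<theta>"
    using max by (auto simp: is_arg_max_linorder)
  have "(\<lambda>h. real n * (h \<bullet> (info (matrix_inv (Sig \<theta>)) *v ?d))) = (\<lambda>h. 0)"
    by (rule differential_zero_maxmin[OF _ open_posdef_Sig has_derivative_loglik[OF n pd]]) (use pd le in auto)
  then have "?d \<bullet> (info (matrix_inv (Sig \<theta>)) *v ?d) = 0" using n by (auto dest: fun_cong[of _ _ ?d])
  then have "?d = 0" using posdefD(2)[OF posdef_info[OF pd], of ?d] by fastforce
  then show ?thesis by simp
qed

lemma linear_zero_ext: "linear (zero_ext e)"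
  by (rule linearI) (auto simp: zero_ext_def vec_eq_iff)

lemma mle_band_stationary:
  fixes e :: "'b::finite \<Rightarrow> ('p::{finite,linorder}) upper"
  assumes inj: "inj e" and n: "n > 0"
    and max: "is_arg_max (\<lambda>t. loglik n x (zero_ext e t)) (\<lambda>t. posdef (Sig (zero_ext e t))) t"
  shows "band_part e (info (matrix_inv (Sig (zero_ext e t))) *v (theta (sample_cov n x) - zero_ext e t)) = 0"
proof -
  let ?\<theta> = "zero_ext e t" and ?Z = "zero_ext e :: 'b rvec \<Rightarrow> 'p param"
  let ?g = "info (matrix_inv (Sig ?\<theta>)) *v (theta (sample_cov n x) - ?\<theta>)"
  have pd: "posdef (Sig ?\<theta>)" and le: "\<And>t'. posdef (Sig (zero_ext e t')) \<Longrightarrow> loglik n x (zero_ext e t')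
    \<le> loglik n x ?\<theta>"
    using max by (auto simp: is_arg_max_linorder)
  have bl: "bounded_linear ?Z" using linear_zero_ext by (simp add: linear_linear)
  have op: "open {t. posdef (Sig (zero_ext e t))}"
    using open_vimage[OF open_posdef_Sig linear_continuous_on[OF bl]] by (simp add: vimage_def)
  have d: "((\<lambda>t. loglik n x (?Z t)) has_derivative (\<lambda>h. real n * (?Z h \<bullet> ?g))) (at t)"
    by (rule has_derivative_compose[OF bounded_linear_imp_has_derivative[OF bl] has_derivative_loglik[OF n pd]])
  have "(\<lambda>h. real n * (?Z h \<bullet> ?g)) = (\<lambda>h. 0)"
    by (rule differential_zero_maxmin[OF _ op d]) (use pd le in auto)
  then have z: "?Z h \<bullet> ?g = 0" for h using n by (auto dest: fun_cong[of _ _ h])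
  have "?Z (axis a 1) = axis (e a) 1" for a
    using inj by (auto simp: zero_ext_def vec_eq_iff axis_def inj_eq)
  then have "?g $ e a = 0" for a using z[of "axis a 1"] by (simp add: inner_axis inner_commute[of "axis _ _"])
  then show ?thesis by (simp add: band_part_def vec_eq_iff)
qed

section \<open>Blocks of the information matrix\<close>

definition select :: "('b \<Rightarrow> 'd) \<Rightarrow> real^('d::finite)^('b::finite)" where
  "select e = (\<chi> a u. if u = e a then 1 else 0)"

lemma select_mult_nth: "(select e ** A) $ a $ v = A $ e a $ v"
  by (simp add: select_def matrix_matrix_mult_def mult_if cong: if_cong)

lemma mult_select_nth: "(A ** transpose (select e)) $ u $ b = A $ u $ e b"
  by (simp add: select_def transpose_def matrix_matrix_mult_def mult_if cong: if_cong)

lemma select_vec: "select e *v x = (\<chi> a. x $ e a)"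
  by (simp add: select_def matrix_vector_mult_def vec_eq_iff mult_if cong: if_cong)

lemma band_part_eq: "band_part e \<theta> = select e *v \<theta>"
  by (simp add: select_vec band_part_def)

definition block :: "('b \<Rightarrow> 'd) \<Rightarrow> ('d::finite) sqmat \<Rightarrow> ('b::finite) sqmat" where
  "block e A = select e ** A ** transpose (select e)"

lemma block_nth: "block e A $ a $ b = A $ e a $ e b"
  by (simp add: block_def mult_select_nth select_mult_nth)

lemma fisher11_eq: "fisher11 e \<theta> = block e (fisher \<theta>)"
  by (simp add: fisher11_def vec_eq_iff block_nth)

lemma select_transpose_vec: "(transpose (select e) *v x) $ u = (\<Sum>a\<in>UNIV. if u = e a then x $ a else 0)"
  by (simp add: select_def transpose_def matrix_vector_mult_def mult_if del: transpose_matrix_vector cong: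
    if_cong)

lemma transpose_select_zero_ext: "inj e \<Longrightarrow> transpose (select e) *v t = zero_ext e t"
  unfolding vec_eq_iff select_transpose_vec zero_ext_def
  by (auto simp: inj_eq sum.delta intro!: sum.neutral)

lemma select_select:
  assumes "inj e"
  shows "select e ** transpose (select e) = mat 1"
  using assms by (simp add: vec_eq_iff mult_select_nth) (auto simp: select_def mat_def inj_eq)

lemma posdef_block:
  fixes A :: "('d::finite) sqmat"
  assumes A: "posdef A" and inj: "inj e"
  shows "posdef (block e A)"
  unfolding posdef_def
proof (intro conjI allI impI)
  show "transpose (block e A) = block e A"
    using posdefD(1)[OF A] by (simp add: vec_eq_iff block_nth transpose_def)
  fix v :: "(real, 'a) vec" assume v: "v \<noteq> 0"
  have "select e *v (transpose (select e) *v v) = v"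
    by (simp add: matrix_vector_mul_assoc select_select[OF inj] del: transpose_matrix_vector)
  then have "transpose (select e) *v v \<noteq> 0" using v by (metis matrix_vector_mult_0_right)
  then have "0 < (transpose (select e) *v v) \<bullet> (A *v (transpose (select e) *v v))" by (rule posdefD(2)[OF A])
  also have "\<dots> = v \<bullet> (block e A *v v)"
    unfolding block_def matrix_vector_mul_assoc[symmetric]
    by (metis dot_lmul_matrix transpose_matrix_vector)
  finally show "0 < v \<bullet> (block e A *v v)" .
qed

text \<open>
  The matrix inverted in \<open>block_inv\<close> is block diagonal and positive definite, so its inverse times
  itself is the identity blockwise.
\<close>

lemma block_inv_left:
  fixes H :: "('d::finite) sqmat"
  assumes H: "posdef H" and uw: "u \<in> J" "w \<in> J"
  shows "(\<Sum>v\<in>J. block_inv J H $ u $ v * H $ v $ w) = (if u = w then 1 else 0)"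
proof -
  define B :: "'d sqmat" where "B = (\<chi> u v. if u \<in> J \<and> v \<in> J then H $ u $ v else if u = v then 1 else 0)"
  have "posdef B"
    unfolding posdef_def
  proof (intro conjI allI impI)
    have "H $ i $ j = H $ j $ i" for i j using posdefD(1)[OF H] by (metis transpose_def vec_lambda_beta)
    then show "transpose B = B" by (auto simp: B_def transpose_def vec_eq_iff)
    fix x :: "(real, 'd) vec" assume x: "x \<noteq> 0"
    define y :: "(real, 'd) vec" where "y = (\<chi> u. if u \<in> J then x $ u else 0)"
    have "x \<bullet> (B *v x) = (\<Sum>u\<in>UNIV. \<Sum>v\<in>UNIV. x $ u * (B $ u $ v * x $ v))"
      by (simp add: inner_vec_def matrix_vector_mult_def sum_distrib_left)
    also have "\<dots> = (\<Sum>u\<in>UNIV. \<Sum>v\<in>UNIV. y $ u * (H $ u $ v * y $ v) + (if u = v then (if u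
      \<in> J then 0 else (x $ u)\<^sup>2) else 0))"
      by (intro sum.cong refl) (auto simp: B_def y_def power2_eq_square)
    also have "\<dots> = y \<bullet> (H *v y) + (\<Sum>u\<in>UNIV. if u \<in> J then 0 else (x $ u)\<^sup>2)"
      by (simp add: inner_vec_def matrix_vector_mult_def sum_distrib_left sum.distrib)
    finally have eq: "x \<bullet> (B *v x) = y \<bullet> (H *v y) + (\<Sum>u\<in>UNIV. if u \<in> J then 0 else (x $ u)\<^sup>2)" .
    show "0 < x \<bullet> (B *v x)"
    proof (cases "y = 0")
      case False
      then show ?thesis unfolding eq using posdefD(2)[OF H] by (intro add_pos_nonneg sum_nonneg) auto
    next
      case True
      obtain u where u: "x $ u \<noteq> 0" using x by (auto simp: vec_eq_iff)
      have "y $ u = 0" using True by simp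
      then have "u \<notin> J" using u by (auto simp: y_def)
      then have "0 < (\<Sum>u\<in>UNIV. if u \<in> J then 0 else (x $ u)\<^sup>2)"
        using u by (intro sum_pos2[of _ u]) auto
      then show ?thesis unfolding eq using True by simp
    qed
  qed
  then have "matrix_inv B ** B = mat 1" by (rule posdef_inv)
  then have "(\<Sum>v\<in>UNIV. matrix_inv B $ u $ v * B $ v $ w) = (if u = w then 1 else 0)"
    by (simp add: vec_eq_iff matrix_matrix_mult_def mat_def)
  moreover have "(\<Sum>v\<in>J. matrix_inv B $ u $ v * H $ v $ w) = (\<Sum>v\<in>UNIV. matrix_inv B $ u $ v * B $ v $ w)"
    using uw(2) by (intro sum.mono_neutral_cong_left) (auto simp: B_def)
  ultimately show ?thesis by (simp add: block_inv_def B_def[symmetric])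
qed

text \<open>
  Eliminating the coordinates outside the band from the equations \<open>I I\<^sup>-\<^sup>1 = 1\<close> leaves the Schur
  complement times the band block of \<open>I\<^sup>-\<^sup>1\<close>.
\<close>

lemma matrix_inv_fisher11_2:
  fixes e :: "'b::finite \<Rightarrow> ('p::{finite,linorder}) upper"
  assumes pd: "posdef (fisher \<theta>)" and inj: "inj e"
  shows "matrix_inv (fisher11_2 e \<theta>) = block e (matrix_inv (fisher \<theta>))"
proof (rule matrix_inv_eqI)
  define H where "H = fisher \<theta>"
  define G where "G = matrix_inv H"
  define J where "J = - range e"
  define N where "N = block_inv J H"
  have pdH: "posdef H" using pd by (simp add: H_def)
  have HG: "(\<Sum>w\<in>UNIV. H $ u $ w * G $ w $ v) = (if u = v then 1 else 0)" for u v
    using posdef_inv(1)[OF pdH] by (simp add: G_def vec_eq_iff matrix_matrix_mult_def mat_def)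
  have split: "(\<Sum>c\<in>UNIV. H $ u $ e c * G $ e c $ v) = (if u = v then 1 else 0) - (\<Sum>w\<in>J. H $ u $ w * G $ w $ v)"
    for u v
  proof -
    have "(\<Sum>c\<in>UNIV. H $ u $ e c * G $ e c $ v) = (\<Sum>w\<in>range e. H $ u $ w * G $ w $ v)"
      by (simp add: sum.reindex[OF inj] comp_def)
    moreover have "(\<Sum>w\<in>UNIV. H $ u $ w * G $ w $ v) = (\<Sum>w\<in>range e. H $ u $ w * G $ w $ v) + (\<Sum>w\<in>J. H $ u $ w
      * G $ w $ v)"
      unfolding J_def by (subst sum.union_disjoint[symmetric]) (auto simp: Compl_partition)
    ultimately show ?thesis using HG[of u v] by simp
  qed
  have "(\<Sum>c\<in>UNIV. fisher11_2 e \<theta> $ a $ c * G $ e c $ e b) = (if a = b then 1 else 0)" for a b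
  proof -
    have "(\<Sum>c\<in>UNIV. fisher11_2 e \<theta> $ a $ c * G $ e c $ e b)
        = (\<Sum>c\<in>UNIV. H $ e a $ e c * G $ e c $ e b)
          - (\<Sum>c\<in>UNIV. \<Sum>u\<in>J. \<Sum>v\<in>J. H $ e a $ u * N $ u $ v * (H $ v $ e c * G $ e c $ e b))"
      by (simp add: fisher11_2_def fisher11_def H_def[symmetric] J_def[symmetric] N_def[symmetric]
          left_diff_distrib sum_subtractf sum_distrib_right mult.assoc)
    also have "(\<Sum>c\<in>UNIV. \<Sum>u\<in>J. \<Sum>v\<in>J. H $ e a $ u * N $ u $ v * (H $ v $ e c * G $ e c $ e b))
        = (\<Sum>u\<in>J. \<Sum>v\<in>J. H $ e a $ u * N $ u $ v * (\<Sum>c\<in>UNIV. H $ v $ e c * G $ e c $ e b))"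
      unfolding sum_distrib_left by (subst sum.swap, rule sum.cong[OF refl], subst sum.swap, rule refl)
    also have "\<dots> = (\<Sum>u\<in>J. \<Sum>v\<in>J. \<Sum>w\<in>J. - (H $ e a $ u * (N $ u $ v * H $ v $ w) * G $ w $ e b))"
      by (intro sum.cong refl) (auto simp: split J_def sum_distrib_left sum_negf mult.assoc)
    also have "\<dots> = (\<Sum>u\<in>J. \<Sum>w\<in>J. - (H $ e a $ u * (\<Sum>v\<in>J. N $ u $ v * H $ v $ w) * G $ w $ e b))"
      unfolding sum_distrib_left sum_distrib_right sum_negf[symmetric]
      by (rule sum.cong[OF refl], subst sum.swap, rule refl)
    also have "\<dots> = (\<Sum>u\<in>J. \<Sum>w\<in>J. if u = w then - (H $ e a $ u * G $ u $ e b) else 0)"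
      by (intro sum.cong refl) (auto simp: N_def block_inv_left[OF pdH])
    also have "\<dots> = (\<Sum>u\<in>J. - (H $ e a $ u * G $ u $ e b))" by simp
    finally show ?thesis using inj by (simp add: split sum_negf inj_eq)
  qed
  then show "fisher11_2 e \<theta> ** block e (matrix_inv (fisher \<theta>)) = mat 1"
    unfolding G_def H_def by (simp add: vec_eq_iff matrix_matrix_mult_def block_nth mat_def)
qed

section \<open>The gap between the two maximum likelihood estimators\<close>

text \<open>
  \<open>mle_gap e H y\<close> is \<open>n\<^sup>1\<^sup>/\<^sup>2\<close> times the difference between the restricted and the unrestricted
  estimator of \<open>\<theta>\<^sub>1\<close> as a function of \<open>y = n\<^sup>1\<^sup>/\<^sup>2 (\<theta>(S\<^sub>n) - \<theta>\<^sub>0)\<close>, when \<open>H\<close> is the information at the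
  restricted estimator.
\<close>

definition mle_gap :: "('b \<Rightarrow> 'd) \<Rightarrow> ('d::finite) sqmat \<Rightarrow> real^'d \<Rightarrow> real^('b::finite)" where
  "mle_gap e H y = matrix_inv (block e H) *v (select e *v (H *v y)) - select e *v y"

lemma mle_gap_of_score:
  fixes H :: "('d::finite) sqmat"
  shows "mle_gap e H (matrix_inv H *v s) = (matrix_inv (block e H) ** select e ** (H ** matrix_inv H)
    - select e ** matrix_inv H) *v s"
  by (simp add: mle_gap_def matrix_vector_mult_diff_rdistrib matrix_vector_mul_assoc matrix_mul_assoc)

text \<open>
  Asymptotically the gap is independent of the restricted estimator, so its variance is the difference
  of the two asymptotic variances.
\<close>

lemma mle_gap_variance:
  fixes H :: "('d::finite) sqmat"
  assumes H: "posdef H" and inj: "inj e"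
  defines "K \<equiv> matrix_inv (block e H) ** select e - select e ** matrix_inv H"
  shows "block e (matrix_inv H) = matrix_inv (block e H) + K ** H ** transpose K"
proof -
  let ?V = "matrix_inv (block e H)" and ?E = "select e" and ?G = "matrix_inv H"
  note T = matrix_transpose_mul
  have sV: "transpose ?V = ?V" and sG: "transpose ?G = ?G"
    using posdefD(1)[OF posdef_matrix_inv[OF posdef_block[OF H inj]]] posdefD(1)[OF posdef_matrix_inv[OF H]]
      by auto
  have VB: "?V ** block e H = mat 1" by (rule posdef_inv[OF posdef_block[OF H inj]])
  have GH: "?G ** H = mat 1" and HG: "H ** ?G = mat 1" using posdef_inv[OF H] by auto
  have tK: "transpose K = transpose ?E ** ?V - ?G ** transpose ?E"
  proof -
    have "transpose (A - B) = transpose A - transpose B" for A B :: "real^'d^'a"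
      by (simp add: transpose_def vec_eq_iff)
    then show ?thesis unfolding K_def by (simp only: T sV sG)
  qed
  have KH: "K ** H = ?V ** ?E ** H - ?E"
    unfolding K_def by (simp only: matrix_diff_rdistrib matrix_mul_assoc[symmetric] GH matrix_mul_rid)
  have "K ** H ** transpose K = (?V ** ?E ** H ** (transpose ?E ** ?V) - ?E ** (transpose ?E ** ?V))
      - (?V ** ?E ** H ** (?G ** transpose ?E) - ?E ** (?G ** transpose ?E))"
    unfolding KH tK by (simp only: matrix_diff_rdistrib matrix_diff_ldistrib)
  also have "?V ** ?E ** H ** (transpose ?E ** ?V) = (?V ** block e H) ** ?V"
    unfolding block_def by (simp only: matrix_mul_assoc)
  also have "\<dots> = ?V" by (simp add: VB)
  also have "?E ** (transpose ?E ** ?V) = ?V" by (simp add: matrix_mul_assoc select_select[OF inj])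
  also have "?V ** ?E ** H ** (?G ** transpose ?E) = ?V ** ?E ** (H ** ?G) ** transpose ?E"
    by (simp only: matrix_mul_assoc)
  also have "\<dots> = ?V" by (simp add: HG matrix_mul_assoc[symmetric] select_select[OF inj])
  finally show ?thesis by (simp add: block_def matrix_mul_assoc)
qed

text \<open>
  Stationarity says that the information form vanishes between \<open>\<theta>(S\<^sub>n) - (t, 0)\<close> and all banded
  directions, so that \<open>t - t\<^sub>0\<close> is exactly the generalized least squares projection of
  \<open>\<theta>(S\<^sub>n) - (t\<^sub>0, 0)\<close>; no expansion of the likelihood is involved.
\<close>

lemma mle_gap_eq:
  fixes e :: "'b::finite \<Rightarrow> ('p::{finite,linorder}) upper"
  assumes inj: "inj e" and n: "n > 0"
    and max: "is_arg_max (\<lambda>t. loglik n x (zero_ext e t)) (\<lambda>t. posdef (Sig (zero_ext e t))) t"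
  defines "H \<equiv> info (matrix_inv (Sig (zero_ext e t)))"
  shows "mle_gap e H (theta (sample_cov n x) - zero_ext e t\<^sub>0) = t - band_part e (theta (sample_cov n x))"
proof -
  let ?S = "theta (sample_cov n x)"
  have pd: "posdef H"
    using max by (auto simp: H_def is_arg_max_linorder intro: posdef_info)
  have "select e *v (H *v (?S - zero_ext e t)) = 0"
    using mle_band_stationary[OF inj n max] by (simp add: band_part_eq H_def)
  moreover have "?S - zero_ext e t = (?S - zero_ext e t\<^sub>0) - transpose (select e) *v (t - t\<^sub>0)"
    by (simp add: matrix_vector_mult_diff_distrib transpose_select_zero_ext[OF inj] linear_diff[OF
      linear_zero_ext]
        del: transpose_matrix_vector)
  ultimately have "select e *v (H *v (?S - zero_ext e t\<^sub>0)) = block e H *v (t - t\<^sub>0)"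
    by (simp add: matrix_vector_mult_diff_distrib block_def matrix_vector_mul_assoc matrix_mul_assoc
        del: transpose_matrix_vector)
  then have "matrix_inv (block e H) *v (select e *v (H *v (?S - zero_ext e t\<^sub>0))) = t - t\<^sub>0"
    by (simp only: matrix_vector_inv[OF posdef_invertible[OF posdef_block[OF pd inj]]])
  moreover have "select e *v zero_ext e t\<^sub>0 = t\<^sub>0"
    by (simp add: transpose_select_zero_ext[OF inj, symmetric] matrix_vector_mul_assoc select_select[OF inj]
        del: transpose_matrix_vector)
  ultimately show ?thesis
    by (simp add: mle_gap_def band_part_eq matrix_vector_mult_diff_distrib)
qed

section \<open>Total variation distance\<close>

lemma abs_measure_diff_le_1:
  assumes "subprob_space P" "subprob_space Q"
  shows "\<bar>measure P A - measure Q A\<bar> \<le> 1"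
  using subprob_space.subprob_measure_le_1[OF assms(1), of A] subprob_space.subprob_measure_le_1[OF assms(2), of
    A]
    measure_nonneg[of P A] measure_nonneg[of Q A] by linarith

lemma tv_dist_bdd:
  assumes "subprob_space P" "subprob_space Q"
  shows "bdd_above ((\<lambda>A. \<bar>measure P A - measure Q A\<bar>) ` sets P)"
  by (rule bdd_aboveI2) (rule abs_measure_diff_le_1[OF assms])

lemma abs_diff_le_tv_dist:
  assumes "subprob_space P" "subprob_space Q" "A \<in> sets P"
  shows "\<bar>measure P A - measure Q A\<bar> \<le> tv_dist P Q"
  unfolding tv_dist_def using assms by (intro cSUP_upper tv_dist_bdd)

lemma tv_dist_nonneg: "subprob_space P \<Longrightarrow> subprob_space Q \<Longrightarrow> 0 \<le> tv_dist P Q"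
  using abs_diff_le_tv_dist[of P Q "{}"] by simp

lemma tv_dist_le_1:
  assumes "subprob_space P" "subprob_space Q"
  shows "tv_dist P Q \<le> 1"
  unfolding tv_dist_def
  by (rule cSUP_least) (use abs_measure_diff_le_1[OF assms] sets.top in blast)+

text \<open>
  By regularity, finite unions of basic open sets approximate any Borel set under two measures at
  once. Hence the total variation distance is a countable supremum, and so a measurable function of a
  parameter on which the measures depend measurably.
\<close>

lemma borel_approx_finite_union:
  fixes P Q :: "('a::polish_space) measure"
  assumes P: "finite_measure P" "sets P = sets borel" and Q: "finite_measure Q" "sets Q = sets borel"
    and \<B>: "countable \<B>" "topological_basis \<B>" and A: "A \<in> sets borel" and \<epsilon>: "\<epsilon> > 0"
  obtains \<G> where "finite \<G>" "\<G> \<subseteq> \<B>" "\<bar>measure P A - measure P (\<Union>\<G>)\<bar> < \<epsilon>" "\<bar>measure Q A - measure Q (\<Union>\<G>)\<bar> < \<epsilon>"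
proof -
  have outer: "\<exists>U. open U \<and> A \<subseteq> U \<and> measure M U < measure M A + \<epsilon> / 2"
    if M: "finite_measure M" "sets M = sets borel" for M :: "'a measure"
  proof -
    interpret finite_measure M by (rule M)
    have "emeasure M A = (INF U\<in>{U. A \<subseteq> U \<and> open U}. emeasure M U)"
      by (rule outer_regular) (use M A in auto)
    moreover have "emeasure M A < emeasure M A + ennreal (\<epsilon> / 2)"
      using \<epsilon> by (simp add: emeasure_eq_measure ennreal_plus[symmetric] ennreal_less_iff del: ennreal_plus)
    ultimately obtain U where "A \<subseteq> U" "open U" "emeasure M U < emeasure M A + ennreal (\<epsilon> / 2)"
      by (auto simp: INF_less_iff)
    then show ?thesis
      using \<epsilon> by (auto simp: emeasure_eq_measure ennreal_plus[symmetric] ennreal_less_iff simp del: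
        ennreal_plus)
  qed
  interpret P: finite_measure P by (rule P)
  interpret Q: finite_measure Q by (rule Q)
  obtain U\<^sub>P where UP: "open U\<^sub>P" "A \<subseteq> U\<^sub>P" "measure P U\<^sub>P < measure P A + \<epsilon> / 2" using outer[OF P] by blast
  obtain U\<^sub>Q where UQ: "open U\<^sub>Q" "A \<subseteq> U\<^sub>Q" "measure Q U\<^sub>Q < measure Q A + \<epsilon> / 2" using outer[OF Q] by blast
  define U where "U = U\<^sub>P \<inter> U\<^sub>Q"
  have U: "open U" "A \<subseteq> U" using UP UQ by (auto simp: U_def)
  have PA: "measure P A \<le> measure P U" "measure P U \<le> measure P U\<^sub>P"
    using U UP UQ P(2) by (auto intro!: P.finite_measure_mono simp: U_def)
  have QA: "measure Q A \<le> measure Q U" "measure Q U \<le> measure Q U\<^sub>Q"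
    using U UP UQ Q(2) by (auto intro!: Q.finite_measure_mono simp: U_def)
  obtain \<B>' where B': "\<B>' \<subseteq> \<B>" "U = \<Union>\<B>'"
    using \<B>(2) U(1) unfolding topological_basis_def by metis
  show ?thesis
  proof (cases "\<B>' = {}")
    case True
    then show ?thesis using that[of "{}"] B'(2) PA QA UP(3) UQ(3) \<epsilon> by auto
  next
    case False
    have cB: "countable \<B>'" using B'(1) \<B>(1) countable_subset by blast
    define b where "b = from_nat_into \<B>'"
    define F where "F n = (\<Union>i\<le>n. b i)" for n :: nat
    have bB: "range b = \<B>'" unfolding b_def by (rule range_from_nat_into[OF False cB])
    have Fop: "open (F n)" for n
    proof -
      have "open (b i)" for i using topological_basis_open[OF \<B>(2)] bB B'(1) by blast
      then show ?thesis unfolding F_def by (intro open_UN) auto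
    qed
    have incF: "incseq F" by (force simp: F_def incseq_def)
    have UF: "(\<Union>n. F n) = U" using bB B'(2) by (auto simp: F_def)
    have "(\<lambda>n. measure P (F n)) \<longlonglongrightarrow> measure P U"
      unfolding UF[symmetric] using Fop P(2) by (intro P.finite_Lim_measure_incseq incF) auto
    then have "eventually (\<lambda>n. measure P U - \<epsilon> / 2 < measure P (F n)) sequentially"
      using \<epsilon> by (intro order_tendstoD(1)) auto
    moreover have "(\<lambda>n. measure Q (F n)) \<longlonglongrightarrow> measure Q U"
      unfolding UF[symmetric] using Fop Q(2) by (intro Q.finite_Lim_measure_incseq incF) auto
    then have "eventually (\<lambda>n. measure Q U - \<epsilon> / 2 < measure Q (F n)) sequentially"
      using \<epsilon> by (intro order_tendstoD(1)) auto
    ultimately have "eventually (\<lambda>n. measure P U - \<epsilon> / 2 < measure P (F n) \<and> measure Q U - \<epsilon> / 2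
      < measure Q (F n)) sequentially"
      by eventually_elim auto
    then obtain n where n: "measure P U - \<epsilon> / 2 < measure P (F n)" "measure Q U - \<epsilon> / 2 < measure Q (F n)"
      by (auto simp: eventually_sequentially)
    have FU: "F n \<subseteq> U" using UF by blast
    have "U \<in> sets P" "U \<in> sets Q" using U(1) P(2) Q(2) by auto
    then have le: "measure P (F n) \<le> measure P U" "measure Q (F n) \<le> measure Q U"
      using P.finite_measure_mono[OF FU] Q.finite_measure_mono[OF FU] by blast+
    have "\<bar>measure P A - measure P (F n)\<bar> < \<epsilon>" "\<bar>measure Q A - measure Q (F n)\<bar> < \<epsilon>"
      using n le PA QA UP(3) UQ(3) by linarith+
    moreover have "F n = \<Union>(b ` {..n})" by (simp add: F_def)
    moreover have "b ` {..n} \<subseteq> \<B>" using bB B'(1) by blast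
    ultimately show ?thesis using that[of "b ` {..n}"] by simp
  qed
qed

lemma borel_measurable_tv_dist:
  fixes P :: "'x \<Rightarrow> ('a::polish_space) measure"
  assumes P: "\<And>x. x \<in> space N \<Longrightarrow> subprob_space (P x)" "\<And>x. x \<in> space N \<Longrightarrow> sets (P x) = sets borel"
    and Q: "subprob_space Q" "sets Q = sets borel"
    and m: "\<And>A. A \<in> sets borel \<Longrightarrow> (\<lambda>x. measure (P x) A) \<in> borel_measurable N"
  shows "(\<lambda>x. tv_dist (P x) Q) \<in> borel_measurable N"
proof -
  obtain \<B> :: "'a set set" where \<B>: "countable \<B>" "topological_basis \<B>" using ex_countable_basis by blast
  define \<F> where "\<F> = Union ` {\<G>. finite \<G> \<and> \<G> \<subseteq> \<B>}"
  have cF: "countable \<F>" unfolding \<F>_def by (intro countable_image countable_Collect_finite_subset \<B>)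
  have neF: "\<F> \<noteq> {}" by (auto simp: \<F>_def)
  have F: "\<F> \<subseteq> sets borel"
    using topological_basis_open[OF \<B>(2)] by (force simp: \<F>_def)
  have eq: "tv_dist (P x) Q = (SUP A\<in>\<F>. \<bar>measure (P x) A - measure Q A\<bar>)" if x: "x \<in> space N" for x
  proof (rule antisym)
    note bdd = tv_dist_bdd[OF P(1)[OF x] Q(1)]
    have bddF: "bdd_above ((\<lambda>A. \<bar>measure (P x) A - measure Q A\<bar>) ` \<F>)"
      by (rule bdd_above_mono[OF bdd]) (use F P(2)[OF x] in auto)
    show "(SUP A\<in>\<F>. \<bar>measure (P x) A - measure Q A\<bar>) \<le> tv_dist (P x) Q"
      unfolding tv_dist_def by (rule cSUP_subset_mono[OF neF bdd]) (use F P(2)[OF x] in auto)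
    show "tv_dist (P x) Q \<le> (SUP A\<in>\<F>. \<bar>measure (P x) A - measure Q A\<bar>)"
      unfolding tv_dist_def
    proof (rule cSUP_least)
      fix A assume "A \<in> sets (P x)"
      then have A: "A \<in> sets borel" using P(2)[OF x] by simp
      show "\<bar>measure (P x) A - measure Q A\<bar> \<le> (SUP A\<in>\<F>. \<bar>measure (P x) A - measure Q A\<bar>)"
      proof (rule field_le_epsilon)
        fix \<epsilon> :: real assume "\<epsilon> > 0"
        then have "\<epsilon> / 2 > 0" by simp
        then obtain \<G> where G: "finite \<G>" "\<G> \<subseteq> \<B>" "\<bar>measure (P x) A - measure (P x) (\<Union>\<G>)\<bar> < \<epsilon> / 2"
            "\<bar>measure Q A - measure Q (\<Union>\<G>)\<bar> < \<epsilon> / 2"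
          using borel_approx_finite_union[OF subprob_space.axioms(1)[OF P(1)[OF x]] P(2)[OF x]
              subprob_space.axioms(1)[OF Q(1)] Q(2) \<B> A] by metis
        have "\<bar>measure (P x) (\<Union>\<G>) - measure Q (\<Union>\<G>)\<bar> \<le> (SUP A\<in>\<F>. \<bar>measure (P x) A - measure Q A\<bar>)"
          by (rule cSUP_upper[OF _ bddF]) (use G in \<open>auto simp: \<F>_def\<close>)
        then show "\<bar>measure (P x) A - measure Q A\<bar> \<le> (SUP A\<in>\<F>. \<bar>measure (P x) A - measure Q A\<bar>) + \<epsilon>"
          using G(3,4) by linarith
      qed
    qed (use sets.top in blast)
  qed
  have "(\<lambda>x. SUP A\<in>\<F>. \<bar>measure (P x) A - measure Q A\<bar>) \<in> borel_measurable N"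
  proof (rule borel_measurable_cSUP[OF cF])
    fix x assume x: "x \<in> space N"
    show "bdd_above ((\<lambda>A. \<bar>measure (P x) A - measure Q A\<bar>) ` \<F>)"
      by (rule bdd_above_mono[OF tv_dist_bdd[OF P(1)[OF x] Q(1)]]) (use F P(2)[OF x] in auto)
  qed (use F m in auto)
  then show ?thesis by (subst measurable_cong[OF eq]) auto
qed

section \<open>Normalized densities depending on a parameter\<close>

lemma sets_normalized[simp, measurable_cong]: "sets (normalized f) = sets borel"
  and space_normalized[simp]: "space (normalized f) = UNIV"
  by (simp_all add: normalized_def)

text \<open>
  If the integral of \<open>f\<close> is zero or infinite, then \<open>normalized f\<close> is the zero measure.
\<close>

lemma subprob_space_normalized:
  fixes f :: "'a::euclidean_space \<Rightarrow> real"
  assumes [measurable]: "f \<in> borel_measurable borel"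
  shows "subprob_space (normalized f)"
proof
  let ?Z = "\<integral>\<^sup>+s. ennreal (f s) \<partial>lborel"
  have "emeasure (normalized f) (space (normalized f)) = (\<integral>\<^sup>+t. ennreal (f t) / ?Z \<partial>lborel)"
    by (simp add: normalized_def emeasure_density)
  also have "\<dots> = ?Z / ?Z" by (rule nn_integral_divide) measurable
  also have "\<dots> \<le> 1" by (cases "?Z = 0 \<or> ?Z = \<top>") (auto simp: ennreal_divide_self top.not_eq_extremum)
  finally show "emeasure (normalized f) (space (normalized f)) \<le> 1" .
qed simp

lemma borel_measurable_normalized_section:
  fixes f :: "'x \<Rightarrow> 'a::euclidean_space \<Rightarrow> real"
  assumes f[measurable]: "(\<lambda>(x, t). f x t) \<in> borel_measurable (N \<Otimes>\<^sub>M borel)"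
    and D[measurable]: "D \<in> sets (N \<Otimes>\<^sub>M borel)"
  shows "(\<lambda>x. measure (normalized (f x)) {t. (x, t) \<in> D}) \<in> borel_measurable N"
proof -
  have Z: "(\<lambda>x. \<integral>\<^sup>+s. ennreal (f x s) \<partial>lborel) \<in> borel_measurable N"
    by measurable
  have "(\<lambda>x. \<integral>\<^sup>+t. (ennreal (f x t) / (\<integral>\<^sup>+s. ennreal (f x s) \<partial>lborel)) * indicator D (x, t) \<partial>lborel)
    \<in> borel_measurable N"
    using Z by measurable
  then have "(\<lambda>x. enn2real (\<integral>\<^sup>+t. (ennreal (f x t) / (\<integral>\<^sup>+s. ennreal (f x s) \<partial>lborel))
    * indicator D (x, t) \<partial>lborel)) \<in> borel_measurable N"
    by measurable
  moreover have "measure (normalized (f x)) {t. (x, t) \<in> D}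
      = enn2real (\<integral>\<^sup>+t. (ennreal (f x t) / (\<integral>\<^sup>+s. ennreal (f x s) \<partial>lborel)) * indicator D (x, t) \<partial>lborel)"
    if x: "x \<in> space N" for x
  proof -
    have fx[measurable]: "f x \<in> borel_measurable borel"
      using measurable_Pair2[OF f x] by simp
    have "{t. (x, t) \<in> D} \<in> sets borel"
      using sets_Pair1[OF D, of x] by (simp add: vimage_def)
    then have "emeasure (normalized (f x)) {t. (x, t) \<in> D}
        = (\<integral>\<^sup>+t. (ennreal (f x t) / (\<integral>\<^sup>+s. ennreal (f x s) \<partial>lborel)) * indicator {t. (x, t) \<in> D} t \<partial>lborel)"
      unfolding normalized_def by (intro emeasure_density) auto
    then show ?thesis by (simp add: measure_def indicator_def)
  qed
  ultimately show ?thesis by (subst measurable_cong) auto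
qed

lemma borel_measurable_measure_distr_normalized:
  fixes f :: "'x \<Rightarrow> 'a::euclidean_space \<Rightarrow> real" and g :: "'x \<Rightarrow> 'a \<Rightarrow> 'b::topological_space"
  assumes f: "(\<lambda>(x, t). f x t) \<in> borel_measurable (N \<Otimes>\<^sub>M borel)"
    and g: "(\<lambda>(x, t). g x t) \<in> borel_measurable (N \<Otimes>\<^sub>M borel)" and A: "A \<in> sets borel"
  shows "(\<lambda>x. measure (distr (normalized (f x)) borel (g x)) A) \<in> borel_measurable N"
proof -
  have D: "{p \<in> space (N \<Otimes>\<^sub>M borel). (\<lambda>(x, t). g x t) p \<in> A} \<in> sets (N \<Otimes>\<^sub>M borel)"
    using measurable_sets[OF g A] by (simp add: vimage_def Int_def conj_commute)
  have "measure (distr (normalized (f x)) borel (g x)) A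
      = measure (normalized (f x)) {t. (x, t) \<in> {p \<in> space (N \<Otimes>\<^sub>M borel). (\<lambda>(x, t). g x t) p \<in> A}}"
    if x: "x \<in> space N" for x
  proof -
    have "g x \<in> borel_measurable borel" using measurable_Pair2[OF g x] by simp
    then have "measure (distr (normalized (f x)) borel (g x)) A = measure (normalized (f x)) (g x -` A \<inter> UNIV)"
      using A by (subst measure_distr) (auto simp: measurable_def)
    then show ?thesis using x by (simp add: vimage_def space_pair_measure)
  qed
  then show ?thesis
    using borel_measurable_normalized_section[OF f D] by (subst measurable_cong) auto
qed

lemma subprob_space_distr_borel:
  assumes M: "subprob_space M" and f: "f \<in> measurable M N" and N: "space N \<noteq> {}"
  shows "subprob_space (distr M N f)"
proof -
  interpret subprob_space M by (rule M)
  show ?thesis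
  proof
    show "emeasure (distr M N f) (space (distr M N f)) \<le> 1"
      using f by (simp add: emeasure_distr measurable_space emeasure_space_le_1)
        (metis emeasure_space emeasure_space_le_1 order_trans)
  qed (use N in simp)
qed

section \<open>Events of asymptotically large probability\<close>

text \<open>
  For fixed \<open>\<eta>\<close> this is weaker than \<open>with_high_prob\<close>; it also covers tightness, where the bound inside
  the event has to depend on \<open>\<eta>\<close>.
\<close>

definition likely :: "real \<Rightarrow> (nat \<Rightarrow> 'a measure) \<Rightarrow> (nat \<Rightarrow> 'a \<Rightarrow> bool) \<Rightarrow> bool" where
  "likely \<eta> P Q \<longleftrightarrow> (\<exists>G. (\<forall>n. G n \<in> sets (P n) \<and> (\<forall>x\<in>G n. Q n x)) \<and>
     eventually (\<lambda>n. measure (P n) (G n) \<ge> 1 - \<eta>) sequentially)"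

lemma with_high_prob_likely:
  assumes "with_high_prob P Q" "\<eta> > 0"
  shows "likely \<eta> P Q"
proof -
  obtain G where G: "\<forall>n. G n \<in> sets (P n) \<and> (\<forall>x\<in>G n. Q n x)" "(\<lambda>n. measure (P n) (G n)) \<longlonglongrightarrow> 1"
    using assms(1) by (auto simp: with_high_prob_def)
  have "eventually (\<lambda>n. 1 - \<eta> < measure (P n) (G n)) sequentially"
    using G(2) assms(2) by (intro order_tendstoD(1)) auto
  then have "eventually (\<lambda>n. 1 - \<eta> \<le> measure (P n) (G n)) sequentially" by eventually_elim simp
  then show ?thesis using G(1) by (auto simp: likely_def)
qed

lemma likely_mono:
  assumes "likely \<eta> P Q" "\<And>n x. n \<ge> n\<^sub>0 \<Longrightarrow> x \<in> space (P n) \<Longrightarrow> Q n x \<Longrightarrow> R n x"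
  shows "likely \<eta> P R"
proof -
  obtain G where G: "\<And>n. G n \<in> sets (P n)" "\<And>n x. x \<in> G n \<Longrightarrow> Q n x"
    "eventually (\<lambda>n. measure (P n) (G n) \<ge> 1 - \<eta>) sequentially"
    using assms(1) by (auto simp: likely_def)
  define G' where "G' n = (if n \<ge> n\<^sub>0 then G n else {})" for n
  have "eventually (\<lambda>n. measure (P n) (G' n) \<ge> 1 - \<eta>) sequentially"
    using G(3) eventually_ge_at_top[of n\<^sub>0] by eventually_elim (simp add: G'_def)
  moreover have "R n x" if "n\<^sub>0 \<le> n" "x \<in> G n" for n x
    using assms(2)[OF that(1) _ G(2)[OF that(2)]] sets.sets_into_space[OF G(1)] that(2) by blast
  then have "G' n \<in> sets (P n) \<and> (\<forall>x\<in>G' n. R n x)" for n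
    using G(1) by (auto simp: G'_def)
  ultimately show ?thesis by (auto simp: likely_def)
qed

lemma likely_conj:
  assumes "\<And>n. prob_space (P n)" and Q: "likely \<eta> P Q" and R: "likely \<eta>' P R"
  shows "likely (\<eta> + \<eta>') P (\<lambda>n x. Q n x \<and> R n x)"
proof -
  obtain G where G: "\<And>n. G n \<in> sets (P n)" "\<And>n x. x \<in> G n \<Longrightarrow> Q n x"
    "eventually (\<lambda>n. measure (P n) (G n) \<ge> 1 - \<eta>) sequentially"
    using Q by (auto simp: likely_def)
  obtain H where H: "\<And>n. H n \<in> sets (P n)" "\<And>n x. x \<in> H n \<Longrightarrow> R n x"
    "eventually (\<lambda>n. measure (P n) (H n) \<ge> 1 - \<eta>') sequentially"
    using R by (auto simp: likely_def)
  have "eventually (\<lambda>n. measure (P n) (G n \<inter> H n) \<ge> 1 - (\<eta> + \<eta>')) sequentially"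
    using G(3) H(3)
  proof eventually_elim
    fix n assume *: "1 - \<eta> \<le> measure (P n) (G n)" "1 - \<eta>' \<le> measure (P n) (H n)"
    interpret prob_space "P n" by (rule assms)
    have "prob (G n \<union> H n) = prob (G n) + prob (H n) - prob (G n \<inter> H n)"
      using finite_measure_Union'[OF G(1)[of n] H(1)[of n]] finite_measure_Diff'[OF H(1)[of n] G(1)[of n]]
      by (simp add: Int_commute)
    then show "1 - (\<eta> + \<eta>') \<le> prob (G n \<inter> H n)"
      using prob_le_1[of "G n \<union> H n"] * by linarith
  qed
  then show ?thesis
    unfolding likely_def using G(1,2) H(1,2) by (intro exI[of _ "\<lambda>n. G n \<inter> H n"]) auto
qed

lemma likely_of_conv_in_prob:
  assumes P: "\<And>n. prob_space (P n)" and m: "\<And>n. T n \<in> borel_measurable (P n)"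
    and T: "conv_in_prob P T c" and r: "r > 0" and \<eta>: "\<eta> > 0"
  shows "likely \<eta> P (\<lambda>n x. dist (T n x) c \<le> r)"
proof -
  let ?G = "\<lambda>n. {x \<in> space (P n). dist (T n x) c \<le> r}"
  have [measurable]: "T n \<in> borel_measurable (P n)" for n by (rule m)
  have Gm: "?G n \<in> sets (P n)" for n
  proof -
    have "{y. dist y c \<le> r} \<in> sets borel" by (intro borel_closed closed_Collect_le continuous_intros)
    from measurable_sets[OF m this] show ?thesis by (simp add: vimage_def Int_def conj_commute)
  qed
  have "eventually (\<lambda>n. measure (P n) {x \<in> space (P n). dist (T n x) c > r} < \<eta>) sequentially"
    using T r \<eta> unfolding conv_in_prob_def by (intro order_tendstoD(2)[where y=0]) auto
  then have "eventually (\<lambda>n. measure (P n) (?G n) \<ge> 1 - \<eta>) sequentially"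
  proof eventually_elim
    fix n assume *: "measure (P n) {x \<in> space (P n). dist (T n x) c > r} < \<eta>"
    interpret prob_space "P n" by (rule P)
    have "{x \<in> space (P n). dist (T n x) c > r} = space (P n) - ?G n" by auto
    then show "1 - \<eta> \<le> prob (?G n)" using * prob_compl[OF Gm] by simp
  qed
  then show ?thesis unfolding likely_def using Gm by (intro exI[of _ ?G]) auto
qed

lemma likely_of_integral_tendsto_0:
  fixes f :: "nat \<Rightarrow> 'a \<Rightarrow> real"
  assumes P: "\<And>n. prob_space (P n)" and m: "\<And>n. f n \<in> borel_measurable (P n)"
    and b: "\<And>n x. x \<in> space (P n) \<Longrightarrow> 0 \<le> f n x \<and> f n x \<le> 1"
    and lim: "(\<lambda>n. \<integral>x. f n x \<partial>P n) \<longlonglongrightarrow> 0" and \<delta>: "\<delta> > 0" and \<eta>: "\<eta> > 0"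
  shows "likely \<eta> P (\<lambda>n x. f n x \<le> \<delta>)"
proof -
  let ?G = "\<lambda>n. {x \<in> space (P n). f n x \<le> \<delta>}"
  have [measurable]: "f n \<in> borel_measurable (P n)" for n by (rule m)
  have Gm: "?G n \<in> sets (P n)" for n by measurable
  have "eventually (\<lambda>n. (\<integral>x. f n x \<partial>P n) < \<eta> * \<delta>) sequentially"
    using lim \<delta> \<eta> by (intro order_tendstoD(2)) auto
  then have "eventually (\<lambda>n. measure (P n) (?G n) \<ge> 1 - \<eta>) sequentially"
  proof eventually_elim
    fix n assume *: "(\<integral>x. f n x \<partial>P n) < \<eta> * \<delta>"
    interpret prob_space "P n" by (rule P)
    have int: "integrable (P n) (f n)"
      by (rule integrable_const_bound[where B=1]) (use b in \<open>auto intro!: AE_I2\<close>)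
    have "prob {x \<in> space (P n). f n x \<ge> \<delta>} \<le> (\<integral>x. f n x \<partial>P n) / \<delta>"
      by (rule integral_Markov_inequality_measure[where A="{}"]) (use int b \<delta> in \<open>auto intro!: AE_I2\<close>)
    also have "\<dots> \<le> \<eta>" using * \<delta> by (simp add: divide_le_eq)
    finally have "prob {x \<in> space (P n). f n x \<ge> \<delta>} \<le> \<eta>" .
    moreover have "prob (space (P n) - ?G n) \<le> prob {x \<in> space (P n). f n x \<ge> \<delta>}"
      by (rule finite_measure_mono) auto
    ultimately show "1 - \<eta> \<le> prob (?G n)" using prob_compl[OF Gm] by simp
  qed
  then show ?thesis unfolding likely_def using Gm by (intro exI[of _ ?G]) auto
qed

lemma integral_diff_tendsto_0:
  fixes X Y :: "nat \<Rightarrow> 'a \<Rightarrow> real"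
  assumes P: "\<And>n. prob_space (P n)"
    and mX: "\<And>n. X n \<in> borel_measurable (P n)" and mY: "\<And>n. Y n \<in> borel_measurable (P n)"
    and bX: "\<And>n x. x \<in> space (P n) \<Longrightarrow> 0 \<le> X n x \<and> X n x \<le> 1" and bY: "\<And>n x. x \<in> space (P n) \<Longrightarrow> 0 \<le> Y n x \<and> Y n x
      \<le> 1"
    and close: "\<And>\<delta> \<eta>. \<delta> > 0 \<Longrightarrow> \<eta> > 0 \<Longrightarrow> likely \<eta> P (\<lambda>n x. \<bar>X n x - Y n x\<bar> \<le> \<delta>)"
  shows "(\<lambda>n. (\<integral>x. X n x \<partial>P n) - (\<integral>x. Y n x \<partial>P n)) \<longlonglongrightarrow> 0"
proof (rule LIMSEQ_I)
  fix r :: real assume "r > 0"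
  then have "r / 3 > 0" by simp
  then obtain G where G: "\<And>n. G n \<in> sets (P n)" "\<And>n x. x \<in> G n \<Longrightarrow> \<bar>X n x - Y n x\<bar> \<le> r / 3"
    "eventually (\<lambda>n. measure (P n) (G n) \<ge> 1 - r / 3) sequentially"
    using close[of "r / 3" "r / 3"] by (auto simp: likely_def)
  from G(3) have "eventually (\<lambda>n. norm ((\<integral>x. X n x \<partial>P n) - (\<integral>x. Y n x \<partial>P n) - 0) < r) sequentially"
  proof eventually_elim
    fix n assume g: "measure (P n) (G n) \<ge> 1 - r / 3"
    interpret prob_space "P n" by (rule P)
    have [measurable]: "X n \<in> borel_measurable (P n)" "Y n \<in> borel_measurable (P n)" "G n \<in> events"
      using mX mY G by auto
    have iX: "integrable (P n) (X n)"
      by (rule integrable_const_bound[where B=1]) (use bX in \<open>auto intro!: AE_I2\<close>)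
    have iY: "integrable (P n) (Y n)"
      by (rule integrable_const_bound[where B=1]) (use bY in \<open>auto intro!: AE_I2\<close>)
    have iG: "integrable (P n) (\<lambda>x. indicator (space (P n) - G n) x :: real)"
      by (rule integrable_const_bound[where B=1]) (auto intro!: AE_I2)
    have "\<bar>(\<integral>x. X n x \<partial>P n) - (\<integral>x. Y n x \<partial>P n)\<bar> = \<bar>\<integral>x. X n x - Y n x \<partial>P n\<bar>"
      using iX iY by simp
    also have "\<dots> \<le> (\<integral>x. \<bar>X n x - Y n x\<bar> \<partial>P n)" by (rule integral_abs_bound)
    also have "\<dots> \<le> (\<integral>x. r / 3 + indicator (space (P n) - G n) x \<partial>P n)"
    proof (rule integral_mono)
      fix x assume x: "x \<in> space (P n)"
      show "\<bar>X n x - Y n x\<bar> \<le> r / 3 + indicator (space (P n) - G n) x"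
        using G(2)[of x n] bX[OF x] bY[OF x] x \<open>r > 0\<close> by (cases "x \<in> G n") auto
    qed (use iX iY iG in auto)
    also have "\<dots> = r / 3 + prob (space (P n) - G n)"
      using iG by (simp add: prob_space)
    also have "\<dots> \<le> r / 3 + r / 3" using g prob_compl[of "G n"] by simp
    also have "\<dots> < r" using \<open>r > 0\<close> by simp
    finally show "norm ((\<integral>x. X n x \<partial>P n) - (\<integral>x. Y n x \<partial>P n) - 0) < r" by simp
  qed
  then show "\<exists>no. \<forall>n\<ge>no. norm ((\<integral>x. X n x \<partial>P n) - (\<integral>x. Y n x \<partial>P n) - 0) < r"
    by (simp add: eventually_sequentially)
qed

text \<open>
  Convergence in distribution implies tightness: test against a continuous cutoff that lies between
  the indicators of two balls of large radius.
\<close>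

lemma likely_bounded_of_conv_in_distr:
  fixes s :: "nat \<Rightarrow> 'a \<Rightarrow> 'd::euclidean_space"
  assumes P: "\<And>n. prob_space (P n)" and m: "\<And>n. s n \<in> borel_measurable (P n)"
    and Q: "prob_space Q" "sets Q = sets borel" and conv: "conv_in_distr P s Q" and \<eta>: "\<eta> > 0"
  obtains R where "R > 0" "likely \<eta> P (\<lambda>n x. norm (s n x) \<le> R)"
proof -
  interpret Q: prob_space Q by (rule Q)
  have [measurable_cong]: "sets Q = sets borel" by (rule Q)
  have sQ: "space Q = UNIV" using Q(2) sets_eq_imp_space_eq by fastforce
  have "(\<lambda>k. measure Q {y. real k < norm y}) \<longlonglongrightarrow> measure Q (\<Inter>k. {y. real k < norm y})"
    by (rule Q.finite_Lim_measure_decseq) (auto simp: decseq_def Q(2))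
  moreover have "(\<Inter>k. {y. real k < norm y}) = ({} :: 'd set)"
  proof -
    have "\<exists>k. \<not> real k < norm y" for y :: 'd
      using reals_Archimedean2[of "norm y"] by (meson less_imp_le not_le)
    then show ?thesis by auto
  qed
  ultimately have "(\<lambda>k. measure Q {y. real k < norm y}) \<longlonglongrightarrow> 0" by simp
  then have "eventually (\<lambda>k. measure Q {y. real k < norm y} < \<eta> / 2) sequentially"
    using \<eta> by (intro order_tendstoD(2)) auto
  then obtain k where k: "measure Q {y. real k < norm y} < \<eta> / 2" by (auto simp: eventually_sequentially)
  define g where "g y = max 0 (min 1 (real k + 1 - norm y))" for y :: 'd
  have g: "continuous_on UNIV g" "\<And>y. 0 \<le> g y" "\<And>y. g y \<le> 1"
    by (auto simp: g_def intro!: continuous_intros)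
  then have "bounded (range g)" by (intro boundedI[where B=1]) (auto simp: abs_of_nonneg)
  then have lim: "(\<lambda>n. \<integral>x. g (s n x) \<partial>P n) \<longlonglongrightarrow> (\<integral>y. g y \<partial>Q)"
    using conv g(1) by (simp add: conv_in_distr_def)
  have gm[measurable]: "g \<in> borel_measurable borel" by (rule borel_measurable_continuous_onI[OF g(1)])
  have "1 - \<eta> / 2 < (\<integral>y. g y \<partial>Q)"
  proof -
    have km: "{y. real k < norm y} \<in> sets borel" "{y :: 'd. norm y \<le> real k} \<in> sets borel" by measurable
    have "measure Q {y. norm y \<le> real k} = 1 - measure Q {y. real k < norm y}"
    proof -
      have "{y :: 'd. norm y \<le> real k} = space Q - {y. real k < norm y}" using sQ by auto
      then show ?thesis using Q.prob_compl[of "{y. real k < norm y}"] km Q(2) by simp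
    qed
    moreover have "measure Q {y. norm y \<le> real k} = (\<integral>y. indicator {y. norm y \<le> real k} y \<partial>Q)"
      using km Q(2) sQ by simp
    moreover have "\<dots> \<le> (\<integral>y. g y \<partial>Q)"
    proof (rule integral_mono)
      show "integrable Q g" by (rule Q.integrable_const_bound[where B=1]) (use g in \<open>auto intro!: AE_I2\<close>)
      show "integrable Q (\<lambda>y. indicator {y. norm y \<le> real k} y :: real)"
        by (rule Q.integrable_const_bound[where B=1]) (use km in \<open>auto intro!: AE_I2\<close>)
      show "indicator {y. norm y \<le> real k} y \<le> g y" for y by (auto simp: g_def indicator_def)
    qed
    ultimately show ?thesis using k by linarith
  qed
  then have ev: "eventually (\<lambda>n. 1 - \<eta> / 2 < (\<integral>x. g (s n x) \<partial>P n)) sequentially"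
    using lim by (intro order_tendstoD(1)) auto
  let ?G = "\<lambda>n. {x \<in> space (P n). norm (s n x) \<le> real k + 1}"
  have [measurable]: "s n \<in> borel_measurable (P n)" for n by (rule m)
  have Gm: "?G n \<in> sets (P n)" for n by measurable
  have "eventually (\<lambda>n. measure (P n) (?G n) \<ge> 1 - \<eta>) sequentially"
    using ev
  proof eventually_elim
    fix n assume *: "1 - \<eta> / 2 < (\<integral>x. g (s n x) \<partial>P n)"
    interpret prob_space "P n" by (rule P)
    have "(\<integral>x. g (s n x) \<partial>P n) \<le> (\<integral>x. indicator (?G n) x \<partial>P n)"
    proof (rule integral_mono)
      show "integrable (P n) (\<lambda>x. g (s n x))" by (rule integrable_const_bound[where B=1]) (use g in \<open>auto
        intro!: AE_I2\<close>)
      show "integrable (P n) (\<lambda>x. indicator (?G n) x :: real)"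
        by (rule integrable_const_bound[where B=1]) (auto intro!: AE_I2)
      show "g (s n x) \<le> indicator (?G n) x" if "x \<in> space (P n)" for x using that by (auto
        simp: g_def indicator_def)
    qed
    also have "\<dots> = prob (?G n)" using Gm[of n] by (simp add: Int_absorb2 subsetI)
    finally show "1 - \<eta> \<le> prob (?G n)" using * \<eta> by linarith
  qed
  then have "likely \<eta> P (\<lambda>n x. norm (s n x) \<le> real k + 1)"
    unfolding likely_def using Gm by (intro exI[of _ ?G]) auto
  then show ?thesis using that[of "real k + 1"] by simp
qed

section \<open>Highest density regions\<close>

text \<open>
  If \<open>P\<close> is within \<open>\<eta>\<close> of the normal law \<open>Q\<close>, a highest density region of \<open>P\<close> nearly coincides with
  the superlevel set of \<open>Q\<close> of the same level: where the two sets differ in one direction, outside a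
  thin shell around the level \<open>c\<close>, the ratio of the densities stays away from \<open>1\<close>, so that the
  difference has small mass; equality of the levels handles the other direction.
\<close>

lemma hpd_region_close:
  fixes V :: "('b::finite) sqmat"
  assumes V: "posdef V" and c: "c > 0" and E: "measure (mvn V) {x. c \<le> mvn_density V x} = 1 - \<alpha>"
    and r: "0 < r" "r < c" and shell: "measure (mvn V) {x. c - r \<le> mvn_density V x \<and> mvn_density V x \<le> c + r}
      \<le> \<delta> / 8"
    and \<eta>: "0 < \<eta>" "\<eta> \<le> \<delta> / 4" "\<eta> \<le> \<delta> * r / (16 * c)"
    and P: "subprob_space P" "sets P = sets borel"
    and close: "\<And>A. A \<in> sets borel \<Longrightarrow> \<bar>measure P A - measure (mvn V) A\<bar> \<le> \<eta>"
    and C: "hpd_region \<alpha> P C"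
  shows "C \<in> sets borel"
    "measure (mvn V) ((C - {x. c \<le> mvn_density V x}) \<union> ({x. c \<le> mvn_density V x} - C)) \<le> \<delta>"
proof -
  interpret Q: prob_space "mvn V" by (rule prob_space_mvn[OF V])
  interpret P: subprob_space P by (rule P)
  let ?\<phi> = "mvn_density V" and ?Q = "measure (mvn V)"
  let ?E = "{x. c \<le> ?\<phi> x}"
  have \<phi>pos: "?\<phi> x > 0" for x by (rule mvn_density_pos[OF V])
  obtain f c' where f[measurable]: "f \<in> borel_measurable borel" and f0: "\<And>t. 0 \<le> f t" and Cf: "C = {t. c'
    \<le> f t}" and PC: "measure P C = 1 - \<alpha>"
    and "\<exists>N\<in>sets borel. emeasure lborel N = 0 \<and> (\<forall>A\<in>sets borel. emeasure P (A - N) = (\<integral>\<^sup>+t\<in>A. ennreal (f t)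
      \<partial>lborel))"
    using C by (auto simp: hpd_region_def ac_density_def)
  then obtain N where N[measurable]: "N \<in> sets borel" and N0: "emeasure lborel N = 0"
    and Nf: "\<And>A. A \<in> sets borel \<Longrightarrow> emeasure P (A - N) = (\<integral>\<^sup>+t\<in>A. ennreal (f t) \<partial>lborel)" by blast
  show Cm[measurable]: "C \<in> sets borel" unfolding Cf by measurable
  have Em[measurable]: "?E \<in> sets borel" by measurable
  have QN: "?Q (A - N) = ?Q A" if [measurable]: "A \<in> sets borel" for A
  proof -
    have "N \<in> null_sets lborel" using N0 N by (auto simp: null_sets_def)
    then have "AE x in lborel. x \<notin> N" by (rule AE_not_in)
    then have "AE x in mvn V. x \<notin> N" unfolding AE_mvn_iff[OF V] .
    then have "AE x in mvn V. x \<in> A - N \<longleftrightarrow> x \<in> A" by eventually_elim auto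
    then show ?thesis by (intro Q.finite_measure_eq_AE) auto
  qed
  have Qem: "emeasure (mvn V) A = (\<integral>\<^sup>+t\<in>A. ennreal (?\<phi> t) \<partial>lborel)" if "A \<in> sets borel" for A
    unfolding mvn_def using that by (intro emeasure_density) auto
  have lower: "k * ?Q A \<le> ?Q A + \<eta>" if [measurable]: "A \<in> sets borel" and k: "0 \<le> k" "\<And>x. x \<in> A \<Longrightarrow> k * ?\<phi> x
    \<le> f x" for A k
  proof -
    have "ennreal (k * ?Q A) = ennreal k * emeasure (mvn V) A"
      using k by (simp add: Q.emeasure_eq_measure ennreal_mult)
    also have "\<dots> = (\<integral>\<^sup>+t\<in>A. ennreal k * ennreal (?\<phi> t) \<partial>lborel)"
      unfolding Qem[OF that(1)] by (subst nn_integral_cmult[symmetric]) (auto simp: mult.assoc)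
    also have "\<dots> \<le> (\<integral>\<^sup>+t\<in>A. ennreal (f t) \<partial>lborel)"
      using k by (intro nn_integral_mono) (auto simp: indicator_def ennreal_mult'[symmetric] ennreal_leI)
    also have "\<dots> = ennreal (measure P (A - N))" using Nf[OF that(1)] P.emeasure_eq_measure by simp
    finally have "k * ?Q A \<le> measure P (A - N)" by simp
    also have "\<dots> \<le> ?Q (A - N) + \<eta>" using close[of "A - N"] by (simp add: abs_le_iff)
    finally show ?thesis using QN by simp
  qed
  have upper: "?Q A - \<eta> \<le> k * ?Q A" if [measurable]: "A \<in> sets borel" and k: "0 \<le> k" "\<And>x. x \<in> A \<Longrightarrow> f x \<le> k
    * ?\<phi> x" for A k
  proof -
    have "ennreal (measure P (A - N)) = (\<integral>\<^sup>+t\<in>A. ennreal (f t) \<partial>lborel)"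
      using Nf[OF that(1)] P.emeasure_eq_measure by simp
    also have "\<dots> \<le> (\<integral>\<^sup>+t\<in>A. ennreal k * ennreal (?\<phi> t) \<partial>lborel)"
      using k by (intro nn_integral_mono) (auto simp: indicator_def ennreal_mult'[symmetric] ennreal_leI)
    also have "\<dots> = ennreal k * emeasure (mvn V) A"
      unfolding Qem[OF that(1)] by (subst nn_integral_cmult[symmetric]) (auto simp: mult.assoc)
    also have "\<dots> = ennreal (k * ?Q A)"
      using k by (simp add: Q.emeasure_eq_measure ennreal_mult)
    finally have "measure P (A - N) \<le> k * ?Q A" using k(1) by simp
    moreover have "?Q (A - N) - \<eta> \<le> measure P (A - N)" using close[of "A - N"] by (simp add: abs_le_iff)
    ultimately show ?thesis using QN by simp
  qed
  have QC: "\<bar>?Q C - ?Q ?E\<bar> \<le> \<eta>" using close[OF Cm] PC E by (simp add: abs_minus_commute)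
  have diff: "?Q (C - ?E) - ?Q (?E - C) = ?Q C - ?Q ?E"
    using Q.finite_measure_Diff'[of C ?E] Q.finite_measure_Diff'[of ?E C] Cm Em by (simp add: Int_commute)
  have \<eta>cr: "2 * \<eta> * c / r \<le> \<delta> / 8"
  proof -
    have "2 * \<eta> * c / r \<le> 2 * (\<delta> * r / (16 * c)) * c / r"
      using \<eta>(3) c r(1) by (intro divide_right_mono mult_right_mono mult_left_mono) auto
    also have "\<dots> = \<delta> / 8" using c r(1) by simp
    finally show ?thesis .
  qed
  let ?S = "{x. c - r \<le> ?\<phi> x \<and> ?\<phi> x \<le> c + r}"
  have Sm[measurable]: "?S \<in> sets borel" by measurable
  have one_sided: "?Q (C - ?E) \<le> \<delta> / 4 \<or> ?Q (?E - C) \<le> \<delta> / 4"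
  proof (cases "c \<le> c'")
    case True
    (* here f is at least c / (c - r) times the normal density, although their integrals differ by at most \<eta> *)
    let ?A = "{x. c' \<le> f x \<and> ?\<phi> x < c - r}"
    have Am[measurable]: "?A \<in> sets borel" by measurable
    have "(c / (c - r)) * ?Q ?A \<le> ?Q ?A + \<eta>"
    proof (rule lower[OF Am])
      fix x assume x: "x \<in> ?A"
      then have "c / (c - r) * ?\<phi> x \<le> c / (c - r) * (c - r)" using c r by (intro mult_left_mono) auto
      then show "c / (c - r) * ?\<phi> x \<le> f x" using True x r by simp
    qed (use c r in simp)
    moreover have "(c / (c - r)) * ?Q ?A - ?Q ?A = r / (c - r) * ?Q ?A" using r by (simp add: field_simps)
    ultimately have "r / (c - r) * ?Q ?A \<le> \<eta>" by simp
    then have "?Q ?A \<le> \<eta> * (c - r) / r" using r by (simp add: field_simps)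
    also have "\<dots> \<le> 2 * \<eta> * c / r" using r \<eta>(1) c by (intro divide_right_mono) (auto simp: algebra_simps)
    finally have "?Q ?A \<le> \<delta> / 8" using \<eta>cr by simp
    moreover have "?Q (C - ?E) \<le> ?Q (?A \<union> ?S)" using r by (intro Q.finite_measure_mono) (auto simp: Cf)
    moreover have "?Q (?A \<union> ?S) \<le> ?Q ?A + ?Q ?S" by (rule measure_Un_le) auto
    ultimately show ?thesis using shell by simp
  next
    case False
    let ?A = "{x. f x < c' \<and> c + r < ?\<phi> x}"
    have Am[measurable]: "?A \<in> sets borel" by measurable
    have "?Q ?A - \<eta> \<le> (c / (c + r)) * ?Q ?A"
    proof (rule upper[OF Am])
      fix x assume x: "x \<in> ?A"
      then have "c / (c + r) * (c + r) \<le> c / (c + r) * ?\<phi> x" using c r by (intro mult_left_mono) auto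
      then show "f x \<le> c / (c + r) * ?\<phi> x" using False x r c by simp
    qed (use c r in simp)
    moreover have "?Q ?A - (c / (c + r)) * ?Q ?A = r / (c + r) * ?Q ?A" using r c by (simp add: field_simps)
    ultimately have "r / (c + r) * ?Q ?A \<le> \<eta>" by simp
    then have "?Q ?A \<le> \<eta> * (c + r) / r" using r c by (simp add: field_simps)
    also have "\<dots> \<le> 2 * \<eta> * c / r" using r \<eta>(1) c by (intro divide_right_mono) (auto simp: algebra_simps)
    finally have "?Q ?A \<le> \<delta> / 8" using \<eta>cr by simp
    moreover have "?Q (?E - C) \<le> ?Q (?A \<union> ?S)" using r by (intro Q.finite_measure_mono) (auto simp: Cf)
    moreover have "?Q (?A \<union> ?S) \<le> ?Q ?A + ?Q ?S" by (rule measure_Un_le) auto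
    ultimately show ?thesis using shell by simp
  qed
  have "?Q ((C - ?E) \<union> (?E - C)) \<le> ?Q (C - ?E) + ?Q (?E - C)" by (rule measure_Un_le) auto
  then show "?Q ((C - ?E) \<union> (?E - C)) \<le> \<delta>" using one_sided diff QC \<eta>(2) \<eta>(1) by linarith
qed

text \<open>
  Density and threshold are both multiplied by the Jacobian of the affine map, so the region is merely
  transported.
\<close>

lemma hpd_region_rescaled:
  fixes P :: "('b::finite) rvec measure"
  assumes n: "n > 0" and P: "sets P = sets borel" and C: "hpd_region \<alpha> P C"
  shows "hpd_region \<alpha> (rescaled n P t\<^sub>0) {z. t\<^sub>0 + (1 / sqrt (real n)) *\<^sub>R z \<in> C}"
proof -
  define k where "k = 1 / sqrt (real n)"
  have k: "k > 0" using n by (simp add: k_def)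
  define g where "g t = (1 / k) *\<^sub>R (t - t\<^sub>0)" for t :: "'b rvec"
  have resc: "rescaled n P t\<^sub>0 = distr P borel g" by (simp add: rescaled_def g_def[abs_def] k_def)
  have inv: "g (t\<^sub>0 + k *\<^sub>R z) = z" for z using k by (simp add: g_def)
  have inv': "t\<^sub>0 + k *\<^sub>R g t = t" for t using k by (simp add: g_def)
  have gm[measurable]: "g \<in> borel_measurable borel" by (simp add: g_def[abs_def])
  have gP: "g \<in> measurable P borel" using gm P by (simp add: measurable_def sets_eq_imp_space_eq[OF P])
  have sP: "space P = UNIV" using sets_eq_imp_space_eq[OF P] by simp
  obtain f c' where f[measurable]: "f \<in> borel_measurable borel" and f0: "\<And>t. 0 \<le> f t" and Cf: "C = {t. c'
    \<le> f t}" and PC: "measure P C = 1 - \<alpha>"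
    and "\<exists>N\<in>sets borel. emeasure lborel N = 0 \<and> (\<forall>A\<in>sets borel. emeasure P (A - N) = (\<integral>\<^sup>+t\<in>A. ennreal (f t)
      \<partial>lborel))"
    using C by (auto simp: hpd_region_def ac_density_def)
  then obtain N where N[measurable]: "N \<in> sets borel" and N0: "emeasure lborel N = 0"
    and Nf: "\<And>A. A \<in> sets borel \<Longrightarrow> emeasure P (A - N) = (\<integral>\<^sup>+t\<in>A. ennreal (f t) \<partial>lborel)" by blast
  define K where "K = \<bar>k\<bar> ^ DIM('b rvec)"
  have K: "K > 0" using k by (simp add: K_def)
  have change: "(\<integral>\<^sup>+t. h t \<partial>lborel) = ennreal K * (\<integral>\<^sup>+z. h (t\<^sub>0 + k *\<^sub>R z) \<partial>lborel)"
    if [measurable]: "h \<in> borel_measurable borel" for h :: "'b rvec \<Rightarrow> ennreal"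
  proof -
    have "(\<integral>\<^sup>+t. h t \<partial>lborel) = (\<integral>\<^sup>+t. h t \<partial>density (distr lborel borel (\<lambda>x. t\<^sub>0 + k *\<^sub>R x)) (\<lambda>_. ennreal K))"
      using lborel_affine[of k t\<^sub>0] k unfolding K_def by simp
    also have "\<dots> = ennreal K * (\<integral>\<^sup>+z. h (t\<^sub>0 + k *\<^sub>R z) \<partial>lborel)"
      by (simp add: nn_integral_density nn_integral_distr nn_integral_cmult)
    finally show ?thesis .
  qed
  define f' where "f' z = K * f (t\<^sub>0 + k *\<^sub>R z)" for z
  define N' where "N' = {z. t\<^sub>0 + k *\<^sub>R z \<in> N}"
  have N'm[measurable]: "N' \<in> sets borel" unfolding N'_def by measurable
  have f'm[measurable]: "f' \<in> borel_measurable borel" unfolding f'_def[abs_def] by measurable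
  have "emeasure lborel N' = 0"
  proof -
    have "ennreal K * emeasure lborel N' = ennreal K * (\<integral>\<^sup>+z. indicator N (t\<^sub>0 + k *\<^sub>R z) \<partial>lborel)"
      by (simp add: nn_integral_indicator[symmetric] N'_def indicator_def del: nn_integral_indicator)
    also have "\<dots> = emeasure lborel N" by (subst change[symmetric]) auto
    finally show ?thesis using N0 K by simp
  qed
  moreover have "emeasure (rescaled n P t\<^sub>0) (A - N') = (\<integral>\<^sup>+z\<in>A. ennreal (f' z) \<partial>lborel)" if [measurable]: "A
    \<in> sets borel" for A
  proof -
    have gA[measurable]: "g -` A \<in> sets borel" using measurable_sets_borel[OF gm] by simp
    have "emeasure (rescaled n P t\<^sub>0) (A - N') = emeasure P (g -` (A - N') \<inter> space P)"
      unfolding resc by (rule emeasure_distr[OF gP]) measurable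
    also have "g -` (A - N') \<inter> space P = g -` A - N"
      using inv' sP by (auto simp: N'_def)
    also have "emeasure P (g -` A - N) = (\<integral>\<^sup>+t\<in>g -` A. ennreal (f t) \<partial>lborel)" by (rule Nf) measurable
    also have "\<dots> = ennreal K * (\<integral>\<^sup>+z. ennreal (f (t\<^sub>0 + k *\<^sub>R z)) * indicator (g -` A) (t\<^sub>0 + k *\<^sub>R z) \<partial>lborel)"
      by (rule change) measurable
    also have "\<dots> = (\<integral>\<^sup>+z. ennreal K * (ennreal (f (t\<^sub>0 + k *\<^sub>R z)) * indicator A z) \<partial>lborel)"
      by (subst nn_integral_cmult[symmetric]) (auto simp: indicator_def inv)
    also have "\<dots> = (\<integral>\<^sup>+z\<in>A. ennreal (f' z) \<partial>lborel)"
      using K f0 by (simp add: f'_def ennreal_mult mult.assoc)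
    finally show ?thesis .
  qed
  ultimately have "ac_density (rescaled n P t\<^sub>0) f'"
    unfolding ac_density_def using K f0 N'm f'm by (auto simp: f'_def)
  moreover have "{z. t\<^sub>0 + (1 / sqrt (real n)) *\<^sub>R z \<in> C} = {z. K * c' \<le> f' z}"
    using K by (simp add: Cf f'_def k_def[symmetric])
  moreover have "measure (rescaled n P t\<^sub>0) {z. t\<^sub>0 + (1 / sqrt (real n)) *\<^sub>R z \<in> C} = 1 - \<alpha>"
  proof -
    have Cm: "{z. t\<^sub>0 + k *\<^sub>R z \<in> C} \<in> sets borel" unfolding Cf by measurable
    have "measure (rescaled n P t\<^sub>0) {z. t\<^sub>0 + k *\<^sub>R z \<in> C} = measure P (g -` {z. t\<^sub>0 + k *\<^sub>R z \<in> C} \<inter> space P)"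
      unfolding resc by (rule measure_distr[OF gP Cm])
    also have "g -` {z. t\<^sub>0 + k *\<^sub>R z \<in> C} \<inter> space P = C" using sP by (auto simp: inv')
    finally show ?thesis using PC by (simp add: k_def)
  qed
  ultimately show ?thesis unfolding hpd_region_def by blast
qed

section \<open>Measurability of the posteriors in the data\<close>

lemma borel_measurable_vec_lambda:
  fixes f :: "'i::finite \<Rightarrow> 'x \<Rightarrow> real"
  assumes "\<And>i. f i \<in> borel_measurable M"
  shows "(\<lambda>x. \<chi> i. f i x) \<in> borel_measurable M"
  unfolding borel_measurable_euclidean_space[of "\<lambda>x. \<chi> i. f i x"]
  using assms by (auto simp: Basis_vec_def inner_axis)

lemma borel_measurable_vec_nth[measurable]:
  "f \<in> borel_measurable M \<Longrightarrow> (\<lambda>x. f x $ (i :: 'i::finite) :: real) \<in> borel_measurable M"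
  by (rule borel_measurable_continuous_on[where f="\<lambda>v. v $ i"]) (auto intro!: continuous_intros)

lemma borel_measurable_linear:
  fixes L :: "'a::euclidean_space \<Rightarrow> 'b::euclidean_space"
  assumes "linear L" "f \<in> borel_measurable M"
  shows "(\<lambda>x. L (f x)) \<in> borel_measurable M"
  using assms by (intro borel_measurable_continuous_on[where f=L] linear_continuous_on) (auto
    simp: linear_conv_bounded_linear)

lemma linear_band_part: "linear (band_part e)"
  unfolding band_part_eq[abs_def] by (rule matrix_vector_mul_linear)

lemma theta1_Sig: "theta1 e (Sig \<theta>) = band_part e \<theta>"
  by (simp add: theta1_def theta_Sig)

lemma sets_sampling[simp, measurable_cong]:
  "sets (sampling (\<Sigma> :: ('p::finite) sqmat) n) = sets (\<Pi>\<^sub>M i\<in>{..<n}. (borel :: 'p rvec measure))"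
  unfolding sampling_def by (rule sets_PiM_cong) auto

lemma space_sampling: "space (sampling (\<Sigma> :: ('p::finite) sqmat) n) = space (\<Pi>\<^sub>M i\<in>{..<n}. (borel :: 'p rvec
  measure))"
  by (rule sets_eq_imp_space_eq) (rule sets_sampling)

lemma prob_space_sampling: "posdef \<Sigma> \<Longrightarrow> prob_space (sampling \<Sigma> n)"
  unfolding sampling_def by (intro prob_space_PiM prob_space_mvn)

lemma borel_posdef_Sig[measurable]: "Measurable.pred borel (\<lambda>\<theta> :: ('p::{finite,linorder}) param. posdef (Sig
  \<theta>))"
  unfolding pred_def using borel_open[OF open_posdef_Sig] by simp

lemma borel_measurable_det_Sig[measurable]:
  "(\<lambda>\<theta> :: ('p::{finite,linorder}) param. det (Sig \<theta>)) \<in> borel_measurable borel"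
  by (intro borel_measurable_continuous_onI continuous_on_compose2[OF continuous_on_det] linear_continuous_on
      bounded_linear_Sig) auto

text \<open>
  Entries of the inverse, cut off outside the open set of positive definite matrices, on which they
  are continuous.
\<close>

definition inv_entry :: "'p \<Rightarrow> 'p \<Rightarrow> ('p::{finite,linorder}) param \<Rightarrow> real" where
  "inv_entry i j \<theta> = (if \<theta> \<in> {\<theta>. posdef (Sig \<theta>)} then matrix_inv (Sig \<theta>) $ i $ j else 0)"

lemma borel_measurable_inv_entry[measurable]: "inv_entry i j \<in> borel_measurable borel"
  unfolding inv_entry_def[abs_def]
proof (rule borel_measurable_continuous_on_if)
  show "{\<theta> :: 'a param. posdef (Sig \<theta>)} \<in> sets borel" by (rule borel_open[OF open_posdef_Sig])
  have "continuous_on {\<theta> :: 'a param. posdef (Sig \<theta>)} (\<lambda>\<theta>. matrix_inv (Sig \<theta>))"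
    by (rule continuous_on_compose2[OF continuous_on_matrix_inv linear_continuous_on[OF bounded_linear_Sig]])
      (auto intro: posdef_invertible)
  then show "continuous_on {\<theta> :: 'a param. posdef (Sig \<theta>)} (\<lambda>\<theta>. matrix_inv (Sig \<theta>) $ i $ j)"
    by (intro continuous_intros)
qed (rule continuous_on_const)

definition iw_density :: "('p::{finite,linorder}) sqmat \<Rightarrow> real \<Rightarrow> 'p param \<Rightarrow> real" where
  "iw_density B \<nu> \<theta> = (if posdef (Sig \<theta>)
     then det (Sig \<theta>) powr (- \<nu> / 2) * exp (- trace (matrix_inv (Sig \<theta>) ** B) / 2) else 0)"

lemma initial_posterior_eq:
  "initial_posterior B \<nu> n x = normalized (iw_density (B + real n *\<^sub>R sample_cov n x) (\<nu> + real n))"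
  unfolding initial_posterior_def inverse_wishart_def iw_density_def[abs_def] ..

lemma borel_measurable_sample_cov:
  "(\<lambda>x. sample_cov n x $ i $ j) \<in> borel_measurable (\<Pi>\<^sub>M i\<in>{..<n}. (borel :: ('p::finite) rvec measure))"
proof -
  have [measurable]: "(\<lambda>x. x l) \<in> measurable (\<Pi>\<^sub>M i\<in>{..<n}. (borel :: 'p rvec measure)) borel" if "l \<in> {..<n}"
    for l
    using that by (rule measurable_component_singleton)
  have "(\<lambda>x. 1 / real n * (\<Sum>l<n. x l $ i * x l $ j)) \<in> borel_measurable (\<Pi>\<^sub>M i\<in>{..<n}. (borel :: 'p rvec
    measure))"
    by measurable
  then show ?thesis by (simp add: sample_cov_def)
qed

lemma borel_measurable_iw_density:
  "(\<lambda>(x, \<theta>). iw_density (B + real n *\<^sub>R sample_cov n x) \<nu> \<theta>)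
     \<in> borel_measurable ((\<Pi>\<^sub>M i\<in>{..<n}. (borel :: ('p::{finite,linorder}) rvec measure)) \<Otimes>\<^sub>M borel)"
proof -
  note [measurable] = borel_measurable_sample_cov
  have "iw_density (B + real n *\<^sub>R sample_cov n x) \<nu> \<theta> = (if posdef (Sig \<theta>) then det (Sig \<theta>) powr (- \<nu> / 2)
      * exp (- (\<Sum>i\<in>UNIV. \<Sum>j\<in>UNIV. inv_entry i j \<theta> * (B $ j $ i + real n * sample_cov n x $ j $ i)) / 2) else 0)"
    for x \<theta>
    by (simp add: iw_density_def inv_entry_def trace_def matrix_matrix_mult_def)
  then show ?thesis by (simp only:) measurable
qed

definition conv_density :: "('b::finite \<Rightarrow> ('p::{finite,linorder}) upper) \<Rightarrow> ('b rvec \<Rightarrow> real) \<Rightarrow>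
    nat \<Rightarrow> (nat \<Rightarrow> 'p rvec) \<Rightarrow> 'b rvec \<Rightarrow> real" where
  "conv_density e \<pi>c n x t = \<pi>c t * lik n x (Sig (zero_ext e t))"

lemma conventional_posterior_eq: "conventional_posterior e \<pi>c n x = normalized (conv_density e \<pi>c n x)"
  unfolding conventional_posterior_def conv_density_def[abs_def] ..

lemma borel_measurable_conv_density:
  fixes e :: "'b::finite \<Rightarrow> ('p::{finite,linorder}) upper"
  assumes prior: "banded_prior e \<pi>c"
  shows "(\<lambda>(x, t). conv_density e \<pi>c n x t)
     \<in> borel_measurable ((\<Pi>\<^sub>M i\<in>{..<n}. (borel :: 'p rvec measure)) \<Otimes>\<^sub>M borel)"
proof -
  have [measurable]: "\<pi>c \<in> borel_measurable borel" using prior by (simp add: banded_prior_def)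
  have z[measurable]: "zero_ext e \<in> borel_measurable borel"
    using borel_measurable_linear[OF linear_zero_ext, of "\<lambda>x. x" borel e] by simp
  have [measurable]: "(\<lambda>x. x l) \<in> measurable (\<Pi>\<^sub>M i\<in>{..<n}. (borel :: 'p rvec measure)) borel" if "l \<in> {..<n}"
    for l
    using that by (rule measurable_component_singleton)
  have "conv_density e \<pi>c n x t = \<pi>c t * (\<Prod>l<n. exp (- (\<Sum>i\<in>UNIV. \<Sum>j\<in>UNIV. x l $ i * (inv_entry i j (zero_ext e
    t) * x l $ j)) / 2)
      / sqrt ((2 * pi) ^ CARD('p) * det (Sig (zero_ext e t))))" for x t
  proof (cases "posdef (Sig (zero_ext e t))")
    case True
    then show ?thesis
      by (simp add: conv_density_def lik_def mvn_density_def inv_entry_def inner_vec_def matrix_vector_mult_def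
        sum_distrib_left)
  next
    case False
    then have "\<pi>c t = 0" using prior by (simp add: banded_prior_def)
    then show ?thesis by (simp add: conv_density_def)
  qed
  then show ?thesis by (simp only:) measurable
qed

lemma subprob_space_conventional_posterior:
  fixes e :: "'b::finite \<Rightarrow> ('p::{finite,linorder}) upper"
  assumes "banded_prior e \<pi>c" "x \<in> space (\<Pi>\<^sub>M i\<in>{..<n}. (borel :: 'p rvec measure))"
  shows "subprob_space (conventional_posterior e \<pi>c n x)"
  unfolding conventional_posterior_eq
  using measurable_Pair2[OF borel_measurable_conv_density[OF assms(1)] assms(2)]
  by (intro subprob_space_normalized) simp

lemma subprob_space_initial_posterior:
  assumes "x \<in> space (\<Pi>\<^sub>M i\<in>{..<n}. (borel :: ('p::{finite,linorder}) rvec measure))"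
  shows "subprob_space (initial_posterior B \<nu> n x)"
  unfolding initial_posterior_eq
  using measurable_Pair2[OF borel_measurable_iw_density assms]
  by (intro subprob_space_normalized) simp

lemma sets_initial_posterior[simp, measurable_cong]: "sets (initial_posterior B \<nu> n x) = sets borel"
  and space_initial_posterior[simp]: "space (initial_posterior B \<nu> n x) = UNIV"
  by (simp_all add: initial_posterior_eq)

lemma sets_conventional_posterior[simp]: "sets (conventional_posterior e \<pi>c n x) = sets borel"
  by (simp add: conventional_posterior_eq)

lemma sets_ppp[simp]: "sets (ppp0_posterior e B \<nu> n x) = sets borel" "sets (ppp_posterior e k \<epsilon> B \<nu> n x)
  = sets borel"
  by (simp_all add: ppp0_posterior_def ppp_posterior_def)

lemma rescale_measurable[measurable]: "(\<lambda>t :: ('b::finite) rvec. sqrt (real n) *\<^sub>R (t - c))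
  \<in> borel_measurable borel"
  by measurable

lemma measure_rescaled:
  assumes P: "sets P = sets borel" and A: "A \<in> sets borel"
  shows "measure (rescaled n P c) A = measure P {t. sqrt (real n) *\<^sub>R (t - c) \<in> A}"
proof -
  have "(\<lambda>t. sqrt (real n) *\<^sub>R (t - c)) \<in> measurable P borel"
    using rescale_measurable measurable_cong_sets[OF P refl] by blast
  then show ?thesis
    unfolding rescaled_def using A sets_eq_imp_space_eq[OF P] by (simp add: measure_distr vimage_def)
qed

lemma sets_rescaled[simp]: "sets (rescaled n P c) = sets borel"
  by (simp add: rescaled_def)

lemma subprob_space_rescaled:
  assumes "subprob_space P" "sets P = sets borel"
  shows "subprob_space (rescaled n P c)"
  unfolding rescaled_def
proof (rule subprob_space_distr_borel[OF assms(1)])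
  show "(\<lambda>t. sqrt (real n) *\<^sub>R (t - c)) \<in> measurable P borel"
    using rescale_measurable measurable_cong_sets[OF assms(2) refl] by blast
qed simp

lemma band_part_measurable[measurable]: "band_part e \<in> borel_measurable borel"
  using borel_measurable_linear[OF linear_band_part, of "\<lambda>x. x" borel e] by simp

lemma subprob_space_ppp0:
  fixes e :: "'b::finite \<Rightarrow> ('p::{finite,linorder}) upper"
  assumes "x \<in> space (\<Pi>\<^sub>M i\<in>{..<n}. (borel :: 'p rvec measure))"
  shows "subprob_space (ppp0_posterior e B \<nu> n x)"
  unfolding ppp0_posterior_def theta1_Sig
  by (rule subprob_space_distr_borel[OF subprob_space_initial_posterior[OF assms]]) auto

lemma borel_measurable_tv_ppp0:
  fixes e :: "'b::finite \<Rightarrow> ('p::{finite,linorder}) upper"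
  assumes Q: "subprob_space Q" "sets Q = sets borel"
    and T: "T \<in> borel_measurable (\<Pi>\<^sub>M i\<in>{..<n}. (borel :: 'p rvec measure))"
  shows "(\<lambda>x. tv_dist (rescaled n (ppp0_posterior e B \<nu> n x) (band_part e (T x))) Q)
    \<in> borel_measurable (\<Pi>\<^sub>M i\<in>{..<n}. (borel :: 'p rvec measure))"
proof (rule borel_measurable_tv_dist[OF _ _ Q])
  note [measurable] = T
  fix A :: "'b rvec set" assume A: "A \<in> sets borel"
  have eq: "rescaled n (ppp0_posterior e B \<nu> n x) (band_part e (T x))
      = distr (normalized (iw_density (B + real n *\<^sub>R sample_cov n x) (\<nu> + real n))) borel
          (\<lambda>\<theta>. sqrt (real n) *\<^sub>R (band_part e \<theta> - band_part e (T x)))" for x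
    unfolding rescaled_def ppp0_posterior_def theta1_Sig initial_posterior_eq
    by (subst distr_distr) (auto simp: comp_def)
  have "(\<lambda>(x, \<theta>). sqrt (real n) *\<^sub>R (band_part e \<theta> - band_part e (T x)))
      \<in> borel_measurable ((\<Pi>\<^sub>M i\<in>{..<n}. (borel :: 'p rvec measure)) \<Otimes>\<^sub>M borel)"
    by measurable
  from borel_measurable_measure_distr_normalized[OF borel_measurable_iw_density this A]
  show "(\<lambda>x. measure (rescaled n (ppp0_posterior e B \<nu> n x) (band_part e (T x))) A)
    \<in> borel_measurable (\<Pi>\<^sub>M i\<in>{..<n}. (borel :: 'p rvec measure))"
    unfolding eq .
qed (auto intro!: subprob_space_rescaled subprob_space_ppp0)

lemma borel_measurable_tv_conventional:
  fixes e :: "'b::finite \<Rightarrow> ('p::{finite,linorder}) upper"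
  assumes prior: "banded_prior e \<pi>c" and Q: "subprob_space Q" "sets Q = sets borel"
    and T: "T \<in> borel_measurable (\<Pi>\<^sub>M i\<in>{..<n}. (borel :: 'p rvec measure))"
  shows "(\<lambda>x. tv_dist (rescaled n (conventional_posterior e \<pi>c n x) (T x)) Q)
    \<in> borel_measurable (\<Pi>\<^sub>M i\<in>{..<n}. (borel :: 'p rvec measure))"
proof (rule borel_measurable_tv_dist[OF _ _ Q])
  note [measurable] = T
  fix A :: "'b rvec set" assume A: "A \<in> sets borel"
  have "(\<lambda>(x, t). sqrt (real n) *\<^sub>R (t - T x))
      \<in> borel_measurable ((\<Pi>\<^sub>M i\<in>{..<n}. (borel :: 'p rvec measure)) \<Otimes>\<^sub>M borel)"
    by measurable
  from borel_measurable_measure_distr_normalized[OF borel_measurable_conv_density[OF prior] this A]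
  show "(\<lambda>x. measure (rescaled n (conventional_posterior e \<pi>c n x) (T x)) A)
    \<in> borel_measurable (\<Pi>\<^sub>M i\<in>{..<n}. (borel :: 'p rvec measure))"
    unfolding rescaled_def conventional_posterior_eq .
qed (use prior in \<open>auto intro!: subprob_space_rescaled subprob_space_conventional_posterior\<close>)

section \<open>The positive definiteness adjustment is asymptotically inactive\<close>

lemma in_band_commute: "in_band k i j \<longleftrightarrow> in_band k j i"
  by (auto simp: in_band_def abs_minus_commute)

lemma banding_Sig:
  fixes e :: "'b::finite \<Rightarrow> ('p::{finite,linorder}) upper"
  assumes e: "bij_betw e UNIV (band k)"
  shows "banding k (Sig \<theta>) = Sig (zero_ext e (band_part e \<theta>))"
proof -
  have inj: "inj e" and range: "range e = band k" using e by (auto simp: bij_betw_def)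
  have "Abs_upper (min i j, max i j) \<in> range e \<longleftrightarrow> in_band k i j" for i j :: 'p
    unfolding range band_def using in_band_commute[of k i j] by (auto simp: Abs_upper_Rep min_def max_def)
  moreover have "u \<in> range e \<Longrightarrow> e (inv e u) = u" for u by (rule f_inv_into_f)
  ultimately show ?thesis
    by (simp add: vec_eq_iff banding_def Sig_nth zero_ext_def band_part_def)
qed

lemma theta1_banding:
  fixes e :: "'b::finite \<Rightarrow> ('p::{finite,linorder}) upper"
  assumes e: "bij_betw e UNIV (band k)"
  shows "theta1 e (banding k (Sig \<theta>)) = band_part e \<theta>"
proof -
  have inj: "inj e" using e by (auto simp: bij_betw_def)
  show ?thesis
    unfolding banding_Sig[OF e] theta1_Sig by (simp add: vec_eq_iff band_part_def zero_ext_def inv_f_f[OF inj])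
qed

lemma Sig_true_parameter:
  fixes e :: "'b::finite \<Rightarrow> ('p::{finite,linorder}) upper"
  assumes e: "bij_betw e UNIV (band k)" and \<Sigma>: "transpose \<Sigma> = \<Sigma>" "k_banded k \<Sigma>"
  shows "Sig (zero_ext e (theta1 e \<Sigma>)) = \<Sigma>"
proof -
  have "banding k \<Sigma> = \<Sigma>" using \<Sigma>(2) by (auto simp: banding_def k_banded_def vec_eq_iff)
  then show ?thesis using banding_Sig[OF e, of "theta \<Sigma>"] by (simp add: Sig_theta[OF \<Sigma>(1)] theta1_def)
qed

lemma borel_measurable_lambda_min_banding[measurable]:
  fixes e :: "'b::finite \<Rightarrow> ('p::{finite,linorder}) upper"
  assumes e: "bij_betw e UNIV (band k)"
  shows "(\<lambda>\<theta> :: 'p param. lambda_min (banding k (Sig \<theta>))) \<in> borel_measurable borel"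
  unfolding borel_measurable_iff_ge
proof
  fix c
  define L where "L = (\<lambda>\<theta> :: 'p param. Sig (zero_ext e (band_part e \<theta>)))"
  have "linear L"
    unfolding L_def using linear_compose[OF linear_compose[OF linear_band_part linear_zero_ext] linear_Sig]
    by (simp add: comp_def)
  then have cont: "continuous_on UNIV L" by (simp add: linear_continuous_on linear_conv_bounded_linear)
  have "continuous_on UNIV (\<lambda>\<theta>. L \<theta> *v v)" for v
  proof -
    have "continuous_on UNIV (\<lambda>\<theta>. \<chi> i. \<Sum>j\<in>UNIV. L \<theta> $ i $ j * v $ j)"
      by (intro continuous_on_vec_lambda continuous_on_sum continuous_on_mult continuous_on_component
        continuous_on_const cont)
    then show ?thesis by (simp add: matrix_vector_mult_def)
  qed
  then have "closed {\<theta>. \<forall>v. c * (v \<bullet> v) \<le> v \<bullet> (L \<theta> *v v)}"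
    by (intro closed_Collect_all closed_Collect_le continuous_on_inner continuous_on_const)
  then have cl: "{\<theta>. \<forall>v. c * (v \<bullet> v) \<le> v \<bullet> (L \<theta> *v v)} \<in> sets borel" by (rule borel_closed)
  have eq: "{\<theta>. \<forall>v. c * (v \<bullet> v) \<le> v \<bullet> (L \<theta> *v v)} = {\<theta> \<in> space borel. c \<le> lambda_min (banding k (Sig \<theta>))}"
    unfolding banding_Sig[OF e] L_def lambda_min_symmetric[OF transpose_Sig] by simp
  show "{\<theta> \<in> space (borel :: 'p param measure). c \<le> lambda_min (banding k (Sig \<theta>))} \<in> sets borel"
    using cl unfolding eq .
qed

lemma borel_measurable_theta1_adj_banding:
  fixes e :: "'b::finite \<Rightarrow> ('p::{finite,linorder}) upper"
  assumes e: "bij_betw e UNIV (band k)"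
  shows "(\<lambda>\<theta>. theta1 e (adj_banding \<epsilon> k (Sig \<theta>))) \<in> borel_measurable borel"
proof -
  note [measurable] = borel_measurable_lambda_min_banding[OF e]
  let ?l = "\<lambda>\<theta>. lambda_min (banding k (Sig \<theta>))"
  have [measurable]: "(\<lambda>\<theta> :: 'p param. Sig (zero_ext e (band_part e \<theta>)) $ i $ j) \<in> borel_measurable borel"
    for i j
  proof -
    have "zero_ext e \<in> borel_measurable borel"
      using borel_measurable_linear[OF linear_zero_ext, of "\<lambda>x. x" borel e] by simp
    then show ?thesis unfolding Sig_nth by measurable
  qed
  have "theta1 e (adj_banding \<epsilon> k (Sig \<theta>)) = (\<chi> a. if ?l \<theta> < \<epsilon>
      then Sig (zero_ext e (band_part e \<theta>)) $ fst (Rep_upper (e a)) $ snd (Rep_upper (e a))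
        + (\<epsilon> - ?l \<theta>) * (mat 1 :: 'p sqmat) $ fst (Rep_upper (e a)) $ snd (Rep_upper (e a))
      else Sig (zero_ext e (band_part e \<theta>)) $ fst (Rep_upper (e a)) $ snd (Rep_upper (e a)))" for \<theta>
    by (simp add: theta1_def theta_def band_part_def[of e "vec_lambda _"] adj_banding_def banding_Sig[OF e,
      symmetric] vec_eq_iff)
  then show ?thesis by (simp only:) (intro borel_measurable_vec_lambda, measurable)
qed

text \<open>
  A coercivity constant of the true matrix survives small perturbations.
\<close>

lemma lambda_min_near:
  fixes e :: "'b::finite \<Rightarrow> ('p::{finite,linorder}) upper"
  assumes "posdef (Sig (zero_ext e t\<^sub>0))"
  obtains l \<rho> where "l > 0" "\<rho> > 0" "\<And>t. dist t t\<^sub>0 \<le> \<rho> \<Longrightarrow> l \<le> lambda_min (Sig (zero_ext e t))"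
proof -
  let ?L = "\<lambda>t. Sig (zero_ext e t)"
  have lin: "linear ?L" using linear_compose[OF linear_zero_ext linear_Sig] by (simp add: comp_def)
  obtain B where B: "B > 0" "\<And>t. norm (?L t) \<le> norm t * B"
    using bounded_linear.pos_bounded[of ?L] lin by (auto simp: linear_conv_bounded_linear)
  obtain c where c: "c > 0" "\<And>v. c * (v \<bullet> v) \<le> v \<bullet> (?L t\<^sub>0 *v v)" by (rule posdef_coercive[OF assms]) (rule
    that)
  have "c / 2 \<le> lambda_min (?L t)" if t: "dist t t\<^sub>0 \<le> c / (2 * B)" for t
    unfolding lambda_min_symmetric[OF transpose_Sig]
  proof
    fix v :: "'p rvec"
    have "norm (t - t\<^sub>0) * B \<le> c / 2" using t B(1) by (simp add: dist_norm field_simps)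
    then have "norm (?L t - ?L t\<^sub>0) \<le> c / 2" using B(2)[of "t - t\<^sub>0"] by (simp add: linear_diff[OF lin])
    then have "c / 2 * (v \<bullet> v) \<le> (c - norm (?L t - ?L t\<^sub>0)) * (v \<bullet> v)" by (intro mult_right_mono) auto
    also have "\<dots> \<le> v \<bullet> (?L t *v v)" by (rule posdef_stable[OF c(2)])
    finally show "c / 2 * (v \<bullet> v) \<le> v \<bullet> (?L t *v v)" .
  qed
  then show ?thesis using that[of "c / 2" "c / (2 * B)"] c(1) B(1) by simp
qed

lemma ppp_close_to_ppp0:
  fixes e :: "'b::finite \<Rightarrow> ('p::{finite,linorder}) upper"
  assumes e: "bij_betw e UNIV (band k)" and x: "x \<in> space (\<Pi>\<^sub>M i\<in>{..<n}. (borel :: 'p rvec measure))"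
    and near: "\<And>t. dist t t\<^sub>0 \<le> \<rho> \<Longrightarrow> \<epsilon> n \<le> lambda_min (Sig (zero_ext e t))" and A: "A \<in> sets borel"
  shows "\<bar>measure (ppp_posterior e k \<epsilon> B \<nu> n x) A - measure (ppp0_posterior e B \<nu> n x) A\<bar>
    \<le> measure (ppp0_posterior e B \<nu> n x) {t. \<rho> < dist t t\<^sub>0}"
proof -
  let ?\<pi> = "initial_posterior B \<nu> n x"
  let ?T = "\<lambda>\<theta>. theta1 e (adj_banding (\<epsilon> n) k (Sig \<theta>))" and ?Tz = "\<lambda>\<theta>. theta1 e (Sig \<theta>)"
  interpret subprob_space ?\<pi> by (rule subprob_space_initial_posterior[OF x])
  have Tm: "?T \<in> measurable ?\<pi> borel"
    unfolding measurable_cong_sets[OF sets_initial_posterior refl]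
      by (rule borel_measurable_theta1_adj_banding[OF e])
  have T0m: "?Tz \<in> measurable ?\<pi> borel"
    unfolding theta1_Sig by measurable
  have Dm: "{t. \<rho> < dist t t\<^sub>0} \<in> sets (borel :: 'b rvec measure)"
    by (intro borel_open open_Collect_less continuous_intros)
  have m: "measure (ppp_posterior e k \<epsilon> B \<nu> n x) A = measure ?\<pi> (?T -` A)"
    "measure (ppp0_posterior e B \<nu> n x) A = measure ?\<pi> (?Tz -` A)"
    "measure (ppp0_posterior e B \<nu> n x) {t. \<rho> < dist t t\<^sub>0} = measure ?\<pi> (?Tz -` {t. \<rho> < dist t t\<^sub>0})"
    unfolding ppp_posterior_def ppp0_posterior_def
    using measure_distr[OF Tm A] measure_distr[OF T0m A] measure_distr[OF T0m Dm] by simp_all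
  have s: "?T -` A \<in> sets ?\<pi>" "?Tz -` A \<in> sets ?\<pi>" "?Tz -` {t. \<rho> < dist t t\<^sub>0} \<in> sets ?\<pi>"
    using measurable_sets[OF Tm A] measurable_sets[OF T0m A] measurable_sets[OF T0m Dm] by simp_all
  have eq: "?T \<theta> = ?Tz \<theta>" if "\<not> \<rho> < dist (?Tz \<theta>) t\<^sub>0" for \<theta>
  proof -
    have "\<epsilon> n \<le> lambda_min (banding k (Sig \<theta>))"
      using near[of "?Tz \<theta>"] that by (simp add: banding_Sig[OF e] theta1_Sig)
    then have "adj_banding (\<epsilon> n) k (Sig \<theta>) = banding k (Sig \<theta>)" by (simp add: adj_banding_def)
    then show ?thesis by (simp add: theta1_banding[OF e] theta1_Sig)
  qed
  have "measure ?\<pi> (?T -` A) \<le> measure ?\<pi> (?Tz -` A \<union> ?Tz -` {t. \<rho> < dist t t\<^sub>0})"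
    using s by (intro finite_measure_mono) (use eq in auto)
  also have "\<dots> \<le> measure ?\<pi> (?Tz -` A) + measure ?\<pi> (?Tz -` {t. \<rho> < dist t t\<^sub>0})" by (rule measure_Un_le) (use s
    in auto)
  finally have 1: "measure ?\<pi> (?T -` A) \<le> measure ?\<pi> (?Tz -` A) + measure ?\<pi> (?Tz -` {t. \<rho> < dist t t\<^sub>0})" .
  have "measure ?\<pi> (?Tz -` A) \<le> measure ?\<pi> (?T -` A \<union> ?Tz -` {t. \<rho> < dist t t\<^sub>0})"
    using s by (intro finite_measure_mono) (use eq in auto)
  also have "\<dots> \<le> measure ?\<pi> (?T -` A) + measure ?\<pi> (?Tz -` {t. \<rho> < dist t t\<^sub>0})" by (rule measure_Un_le) (use s
    in auto)
  finally show ?thesis using 1 unfolding m by linarith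
qed

lemma subprob_space_ppp:
  fixes e :: "'b::finite \<Rightarrow> ('p::{finite,linorder}) upper"
  assumes e: "bij_betw e UNIV (band k)" and x: "x \<in> space (\<Pi>\<^sub>M i\<in>{..<n}. (borel :: 'p rvec measure))"
  shows "subprob_space (ppp_posterior e k \<epsilon> B \<nu> n x)"
  unfolding ppp_posterior_def
proof (rule subprob_space_distr_borel[OF subprob_space_initial_posterior[OF x]])
  show "(\<lambda>\<theta>. theta1 e (adj_banding (\<epsilon> n) k (Sig \<theta>))) \<in> measurable (initial_posterior B \<nu> n x) borel"
    unfolding measurable_cong_sets[OF sets_initial_posterior refl]
      by (rule borel_measurable_theta1_adj_banding[OF e])
qed simp

text \<open>
  When \<open>\<theta>\<^sub>1\<close> concentrates near the true value, the smallest eigenvalue of the banded matrix stays away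
  from \<open>0\<close>, so the adjustment changes nothing outside an event of small posterior probability.
\<close>

lemma ppp_close_to_normal:
  fixes e :: "'b::finite \<Rightarrow> ('p::{finite,linorder}) upper"
  assumes e: "bij_betw e UNIV (band k)" and x: "x \<in> space (\<Pi>\<^sub>M i\<in>{..<n}. (borel :: 'p rvec measure))"
    and near: "\<And>t. dist t t\<^sub>0 \<le> \<rho> \<Longrightarrow> \<epsilon> n \<le> lambda_min (Sig (zero_ext e t))"
    and V: "posdef V" and n: "n > 0" and tv: "tv_dist (rescaled n (ppp0_posterior e B \<nu> n x) c) (mvn V) \<le> \<eta> / 3"
    and c: "dist c t\<^sub>0 \<le> \<rho> / 2" and R: "measure (mvn V) {z. R < norm z} < \<eta> / 3" "R \<le> sqrt (real n) * (\<rho> / 2)"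
    and A: "A \<in> sets borel"
  shows "\<bar>measure (rescaled n (ppp_posterior e k \<epsilon> B \<nu> n x) c) A - measure (mvn V) A\<bar> \<le> \<eta>"
proof -
  let ?Pz = "ppp0_posterior e B \<nu> n x" and ?P = "ppp_posterior e k \<epsilon> B \<nu> n x"
  interpret Q: prob_space "mvn V" by (rule prob_space_mvn[OF V])
  have sQ: "subprob_space (mvn V)" by (rule prob_space_imp_subprob_space) unfold_locales
  interpret P0: subprob_space ?Pz by (rule subprob_space_ppp0[OF x])
  interpret R0: subprob_space "rescaled n ?Pz c" by (rule subprob_space_rescaled[OF subprob_space_ppp0[OF x]
    sets_ppp(1)])
  have le: "\<bar>measure (rescaled n ?Pz c) S - measure (mvn V) S\<bar> \<le> \<eta> / 3" if "S \<in> sets borel" for S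
    using abs_diff_le_tv_dist[OF R0.subprob_space_axioms sQ, of S] tv that by simp
  have Rm: "{z :: 'b rvec. R < norm z} \<in> sets borel" by measurable
  have "measure ?Pz {t. \<rho> < dist t t\<^sub>0} \<le> measure ?Pz {t. sqrt (real n) *\<^sub>R (t - c) \<in> {z. R < norm z}}"
  proof (rule P0.finite_measure_mono)
    show "{t. \<rho> < dist t t\<^sub>0} \<subseteq> {t. sqrt (real n) *\<^sub>R (t - c) \<in> {z. R < norm z}}"
    proof safe
      fix t assume t: "\<rho> < dist t t\<^sub>0"
      then have "\<rho> / 2 < norm (t - c)" using c dist_triangle[of t t\<^sub>0 c] by (simp add: dist_norm)
      then have "sqrt (real n) * (\<rho> / 2) < sqrt (real n) * norm (t - c)" using n by simp
      then show "R < norm (sqrt (real n) *\<^sub>R (t - c))" using R(2) by simp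
    qed
    show "{t. sqrt (real n) *\<^sub>R (t - c) \<in> {z. R < norm z}} \<in> sets ?Pz"
      using measurable_sets_borel[OF rescale_measurable Rm] by (simp add: vimage_def)
  qed
  also have "\<dots> = measure (rescaled n ?Pz c) {z. R < norm z}" by (rule measure_rescaled[symmetric]) (use Rm in
    auto)
  also have "\<dots> \<le> \<eta> / 3 + \<eta> / 3" using le[OF Rm] R(1) by linarith
  finally have far: "measure ?Pz {t. \<rho> < dist t t\<^sub>0} \<le> \<eta> / 3 + \<eta> / 3" .
  let ?A = "{t. sqrt (real n) *\<^sub>R (t - c) \<in> A}"
  have Am: "?A \<in> sets borel" using measurable_sets_borel[OF rescale_measurable A] by (simp add: vimage_def)
  have "\<bar>measure ?P ?A - measure ?Pz ?A\<bar> \<le> measure ?Pz {t. \<rho> < dist t t\<^sub>0}"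
    by (rule ppp_close_to_ppp0[where \<epsilon>=\<epsilon> and n=n and \<rho>=\<rho> and t\<^sub>0=t\<^sub>0, OF e x near Am])
  then show ?thesis
    using le[OF A] far unfolding measure_rescaled[OF sets_ppp(1) A] measure_rescaled[OF sets_ppp(2) A]
      by linarith
qed

section \<open>Conventional posterior probability of a highest density region\<close>

text \<open>
  Passing from a highest density region of \<open>P\<close> to the superlevel set of the normal law costs a set of
  small \<open>N(0, V\<^sub>1)\<close> probability. By contiguity, this set is also small under \<open>N(0, V\<^sub>2)\<close> centred at
  any point within \<open>B\<close>, which is where \<open>Pc\<close> is concentrated.
\<close>

lemma credible_region_transfer:
  fixes V\<^sub>1 V\<^sub>2 :: "('b::finite) sqmat"
  assumes V1: "posdef V\<^sub>1" and V2: "posdef V\<^sub>2" and c: "c > 0" and E: "measure (mvn V\<^sub>1) {x. c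
    \<le> mvn_density V\<^sub>1 x} = 1 - \<alpha>"
    and shell: "\<And>\<delta>. \<delta> > 0 \<Longrightarrow> \<exists>r>0. r < c \<and> measure (mvn V\<^sub>1) {x. c - r \<le> mvn_density V\<^sub>1 x \<and> mvn_density V\<^sub>1 x
      \<le> c + r} \<le> \<delta>"
    and \<delta>: "\<delta> > 0"
  obtains \<eta> where "\<eta> > 0"
    "\<And>n P Pc t\<^sub>0 m C. \<lbrakk>n > 0; subprob_space P; sets P = sets borel; sets Pc = sets borel;
      \<And>A. A \<in> sets borel \<Longrightarrow> \<bar>measure (rescaled n P t\<^sub>0) A - measure (mvn V\<^sub>1) A\<bar> \<le> \<eta>;
      \<And>A. A \<in> sets borel \<Longrightarrow> \<bar>measure (rescaled n Pc m) A - measure (mvn V\<^sub>2) A\<bar> \<le> \<eta>;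
      norm (sqrt (real n) *\<^sub>R (m - t\<^sub>0)) \<le> B; hpd_region \<alpha> P C\<rbrakk>
     \<Longrightarrow> \<bar>measure Pc C - measure (mvn V\<^sub>2) {z. z + sqrt (real n) *\<^sub>R (m - t\<^sub>0) \<in> {x. c \<le> mvn_density V\<^sub>1 x}}\<bar> \<le> \<delta>"
proof -
  have "\<delta> / 2 > 0" using \<delta> by simp
  then obtain \<delta>\<^sub>1 where d1: "\<delta>\<^sub>1 > 0" "\<And>(A :: 'b rvec set) t. \<lbrakk>A \<in> sets borel; norm t \<le> B; measure (mvn V\<^sub>1) A
    \<le> \<delta>\<^sub>1\<rbrakk>
      \<Longrightarrow> measure (mvn V\<^sub>2) {z. z + t \<in> A} \<le> \<delta> / 2"
    by (rule mvn_shift_contiguous[OF V1 V2]) (rule that)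
  obtain r where r: "r > 0" "r < c"
      "measure (mvn V\<^sub>1) {x. c - r \<le> mvn_density V\<^sub>1 x \<and> mvn_density V\<^sub>1 x \<le> c + r} \<le> \<delta>\<^sub>1 / 8"
    using shell[of "\<delta>\<^sub>1 / 8"] d1(1) by auto
  define \<eta> where "\<eta> = min (\<delta> / 2) (min (\<delta>\<^sub>1 / 4) (\<delta>\<^sub>1 * r / (16 * c)))"
  have \<eta>: "\<eta> > 0" "\<eta> \<le> \<delta> / 2" "\<eta> \<le> \<delta>\<^sub>1 / 4" "\<eta> \<le> \<delta>\<^sub>1 * r / (16 * c)"
    using \<delta> d1(1) r c by (auto simp: \<eta>_def)
  show ?thesis
  proof (rule that[OF \<eta>(1)])
    fix n :: nat and P Pc :: "'b rvec measure" and t\<^sub>0 m :: "'b rvec" and C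
    assume n: "n > 0" and P: "subprob_space P" "sets P = sets borel" and Pc: "sets Pc = sets borel"
      and cl1: "\<And>A. A \<in> sets borel \<Longrightarrow> \<bar>measure (rescaled n P t\<^sub>0) A - measure (mvn V\<^sub>1) A\<bar> \<le> \<eta>"
      and cl2: "\<And>A. A \<in> sets borel \<Longrightarrow> \<bar>measure (rescaled n Pc m) A - measure (mvn V\<^sub>2) A\<bar> \<le> \<eta>"
      and T: "norm (sqrt (real n) *\<^sub>R (m - t\<^sub>0)) \<le> B" and C: "hpd_region \<alpha> P C"
    interpret Q2: prob_space "mvn V\<^sub>2" by (rule prob_space_mvn[OF V2])
    define k where "k = 1 / sqrt (real n)"
    have k: "k > 0" "sqrt (real n) * k = 1" "k * sqrt (real n) = 1" using n by (auto simp: k_def)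
    define t where "t = sqrt (real n) *\<^sub>R (m - t\<^sub>0)"
    let ?E = "{x. c \<le> mvn_density V\<^sub>1 x}"
    define D where "D = {z. t\<^sub>0 + k *\<^sub>R z \<in> C}"
    have hpd: "hpd_region \<alpha> (rescaled n P t\<^sub>0) D"
      using hpd_region_rescaled[OF n P(2) C, of t\<^sub>0] by (simp add: D_def k_def)
    note close = hpd_region_close[OF V1 c E r \<eta>(1,3,4) subprob_space_rescaled[OF P] sets_rescaled cl1 hpd]
    have Dm: "D \<in> sets borel" by (rule close(1))
    have Em: "?E \<in> sets borel" by measurable
    have Sm: "(D - ?E) \<union> (?E - D) \<in> sets borel" using Dm Em by auto
    have shift: "{z. z + t \<in> S} \<in> sets borel" if "S \<in> sets borel" for S :: "'b rvec set"
    proof -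
      have "(\<lambda>z :: 'b rvec. z + t) \<in> borel_measurable borel" by measurable
      from measurable_sets_borel[OF this that] show ?thesis by (simp add: vimage_def)
    qed
    have sd: "measure (mvn V\<^sub>2) {z. z + t \<in> (D - ?E) \<union> (?E - D)} \<le> \<delta> / 2"
      by (rule d1(2)[OF Sm _ close(2)]) (use T in \<open>simp add: t_def\<close>)
    have "measure (mvn V\<^sub>2) {z. z + t \<in> D} \<le> measure (mvn V\<^sub>2) ({z. z + t \<in> ?E} \<union> {z. z + t \<in> (D - ?E) \<union> (?E
      - D)})"
      by (rule Q2.finite_measure_mono) (use shift[OF Em] shift[OF Sm] in auto)
    also have "\<dots> \<le> measure (mvn V\<^sub>2) {z. z + t \<in> ?E} + measure (mvn V\<^sub>2) {z. z + t \<in> (D - ?E) \<union> (?E - D)}"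
      by (rule measure_Un_le) (use shift[OF Em] shift[OF Sm] in auto)
    finally have 1: "measure (mvn V\<^sub>2) {z. z + t \<in> D} \<le> measure (mvn V\<^sub>2) {z. z + t \<in> ?E} + \<delta> / 2" using sd
      by linarith
    have "measure (mvn V\<^sub>2) {z. z + t \<in> ?E} \<le> measure (mvn V\<^sub>2) ({z. z + t \<in> D} \<union> {z. z + t \<in> (D - ?E) \<union> (?E
      - D)})"
      by (rule Q2.finite_measure_mono) (use shift[OF Dm] shift[OF Sm] in auto)
    also have "\<dots> \<le> measure (mvn V\<^sub>2) {z. z + t \<in> D} + measure (mvn V\<^sub>2) {z. z + t \<in> (D - ?E) \<union> (?E - D)}"
      by (rule measure_Un_le) (use shift[OF Dm] shift[OF Sm] in auto)
    finally have 2: "measure (mvn V\<^sub>2) {z. z + t \<in> ?E} \<le> measure (mvn V\<^sub>2) {z. z + t \<in> D} + \<delta> / 2" using sd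
      by linarith
    have "{s. sqrt (real n) *\<^sub>R (s - m) \<in> {z. z + t \<in> D}} = C"
    proof -
      have "sqrt (real n) *\<^sub>R (s - m) + t = sqrt (real n) *\<^sub>R (s - t\<^sub>0)" for s
        by (simp add: t_def scaleR_right_diff_distrib)
      then have "sqrt (real n) *\<^sub>R (s - m) + t \<in> D \<longleftrightarrow> s \<in> C" for s by (simp add: D_def k)
      then show ?thesis by simp
    qed
    then have "measure Pc C = measure (rescaled n Pc m) {z. z + t \<in> D}"
      using measure_rescaled[OF Pc shift[OF Dm], of n m] by simp
    then have "\<bar>measure Pc C - measure (mvn V\<^sub>2) {z. z + t \<in> D}\<bar> \<le> \<delta> / 2"
      using cl2[OF shift[OF Dm]] \<eta>(2) by simp
    then show "\<bar>measure Pc C - measure (mvn V\<^sub>2) {z. z + sqrt (real n) *\<^sub>R (m - t\<^sub>0) \<in> ?E}\<bar> \<le> \<delta>"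
      using 1 2 unfolding t_def[symmetric] by linarith
  qed
qed

section \<open>Asymptotic law of the gap and the coverage theorem\<close>

lemma tendsto_matrix_mult:
  fixes f :: "'x \<Rightarrow> real^'n^'m" and g :: "'x \<Rightarrow> real^'k^'n"
  assumes "(f \<longlongrightarrow> A) F" "(g \<longlongrightarrow> B) F"
  shows "((\<lambda>x. f x ** g x) \<longlongrightarrow> A ** B) F"
  unfolding matrix_matrix_mult_def
  by (intro tendsto_vec_lambda tendsto_sum tendsto_mult tendsto_vec_nth assms)

definition gap_matrix :: "('b \<Rightarrow> 'd) \<Rightarrow> ('d::finite) sqmat \<Rightarrow> real^'d^('b::finite)" where
  "gap_matrix e H = matrix_inv (block e H) ** select e ** H - select e"

lemma mle_gap_matrix: "mle_gap e H y = gap_matrix e H *v y"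
  by (simp add: mle_gap_def gap_matrix_def matrix_vector_mult_diff_rdistrib matrix_vector_mul_assoc
    matrix_mul_assoc)

lemma gap_matrix_continuous:
  fixes e :: "'b::finite \<Rightarrow> ('p::{finite,linorder}) upper"
  assumes inj: "inj e" and pd: "posdef (Sig (zero_ext e t\<^sub>0))"
  shows "isCont (\<lambda>t. gap_matrix e (info (matrix_inv (Sig (zero_ext e t))))) t\<^sub>0"
proof -
  let ?H = "\<lambda>t. info (matrix_inv (Sig (zero_ext e t)))"
  have lin: "linear (\<lambda>t. Sig (zero_ext e t))"
    using linear_compose[OF linear_zero_ext linear_Sig] by (simp add: comp_def)
  have "isCont (\<lambda>t. Sig (zero_ext e t)) t\<^sub>0"
    using lin by (simp add: linear_continuous_at linear_conv_bounded_linear)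
  then have "((\<lambda>t. matrix_inv (Sig (zero_ext e t))) \<longlongrightarrow> matrix_inv (Sig (zero_ext e t\<^sub>0))) (at t\<^sub>0)"
    unfolding isCont_def by (rule isCont_tendsto_compose[OF isCont_matrix_inv[OF posdef_invertible[OF pd]]])
  then have H: "(?H \<longlongrightarrow> ?H t\<^sub>0) (at t\<^sub>0)" by (rule isCont_tendsto_compose[OF isCont_info])
  then have "((\<lambda>t. block e (?H t)) \<longlongrightarrow> block e (?H t\<^sub>0)) (at t\<^sub>0)"
    unfolding block_def by (intro tendsto_matrix_mult tendsto_const)
  then have "((\<lambda>t. matrix_inv (block e (?H t))) \<longlongrightarrow> matrix_inv (block e (?H t\<^sub>0))) (at t\<^sub>0)"
    by (rule isCont_tendsto_compose[OF isCont_matrix_inv[OF posdef_invertible[OF posdef_block[OF posdef_info[OF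
      pd] inj]]]])
  then show ?thesis
    unfolding isCont_def gap_matrix_def by (intro tendsto_diff tendsto_matrix_mult tendsto_const H)
qed

lemma score_eq:
  fixes \<theta> :: "('p::{finite,linorder}) param"
  assumes n: "n > 0" and pd: "posdef (Sig \<theta>)"
  defines "H \<equiv> info (matrix_inv (Sig \<theta>))"
  shows "matrix_inv H *v ((1 / sqrt (real n)) *\<^sub>R grad (loglik n x) \<theta>) = sqrt (real n) *\<^sub>R (theta (sample_cov n
    x) - \<theta>)"
proof -
  have "(1 / sqrt (real n)) *\<^sub>R grad (loglik n x) \<theta> = sqrt (real n) *\<^sub>R (H *v (theta (sample_cov n x) - \<theta>))"
    unfolding grad_loglik[OF n pd] H_def by (simp add: real_div_sqrt)
  moreover have "invertible H" unfolding H_def by (rule posdef_invertible[OF posdef_info[OF pd]])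
  ultimately show ?thesis by (simp only: matrix_vector_mult_scaleR matrix_vector_inv)
qed

lemma borel_measurable_score:
  fixes \<theta> :: "('p::{finite,linorder}) param"
  assumes pd: "posdef (Sig \<theta>)"
  shows "(\<lambda>x. (1 / sqrt (real n)) *\<^sub>R grad (loglik n x) \<theta>) \<in> borel_measurable (\<Pi>\<^sub>M i\<in>{..<n}. (borel :: 'p rvec
    measure))"
proof (cases "n > 0")
  case True
  have [measurable]: "(\<lambda>x. theta (sample_cov n x)) \<in> borel_measurable (\<Pi>\<^sub>M i\<in>{..<n}. (borel :: 'p rvec
    measure))"
    unfolding theta_def by (intro borel_measurable_vec_lambda borel_measurable_sample_cov)
  show ?thesis unfolding grad_loglik[OF True pd] by measurable
qed simp

text \<open>
  The two estimators differ by a continuous function of the restricted estimator, applied to the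
  score; by Slutsky's argument the former may be replaced by its limit.
\<close>

lemma mle_difference_asymptotic:
  fixes e :: "'b::finite \<Rightarrow> ('p::{finite,linorder}) upper" and g :: "'b rvec \<Rightarrow> real"
  assumes inj: "inj e" and pd: "posdef (Sig (zero_ext e t\<^sub>0))" and g: "continuous_on UNIV g" and R:
    "R > 0" and \<delta>: "\<delta> > 0"
  defines "H \<equiv> info (matrix_inv (Sig (zero_ext e t\<^sub>0)))"
  obtains B r where "r > 0"
    "\<And>n x mf mb. \<lbrakk>n > 0; is_arg_max (loglik n x) (\<lambda>\<theta>. posdef (Sig \<theta>)) mf;
       is_arg_max (\<lambda>t. loglik n x (zero_ext e t)) (\<lambda>t. posdef (Sig (zero_ext e t))) mb;
       dist mb t\<^sub>0 \<le> r; norm ((1 / sqrt (real n)) *\<^sub>R grad (loglik n x) (zero_ext e t\<^sub>0)) \<le> R\<rbrakk>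
     \<Longrightarrow> norm (sqrt (real n) *\<^sub>R (mb - band_part e mf)) \<le> B \<and>
       \<bar>g (sqrt (real n) *\<^sub>R (mb - band_part e mf))
         - g (mle_gap e H (matrix_inv H *v ((1 / sqrt (real n)) *\<^sub>R grad (loglik n x) (zero_ext e t\<^sub>0))))\<bar> \<le> \<delta>"
proof -
  let ?M = "\<lambda>t. gap_matrix e (info (matrix_inv (Sig (zero_ext e t))))"
  define Y where "Y = norm (matrix_inv H) * R"
  have Y: "Y \<ge> 0" using R by (simp add: Y_def)
  define B where "B = (norm (?M t\<^sub>0) + 1) * Y"
  have "uniformly_continuous_on (cball 0 B) g"
    by (rule compact_uniformly_continuous[OF continuous_on_subset[OF g]]) auto
  then obtain d where d: "d > 0" "\<And>a b. \<lbrakk>norm a \<le> B; norm b \<le> B; dist b a < d\<rbrakk> \<Longrightarrow> dist (g b) (g a) < \<delta>"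
    unfolding uniformly_continuous_on_def using \<delta> by (metis mem_cball_0)
  (* q <= 1 keeps the gaps inside the ball of radius B, and q Y < d makes them d-close *)
  define q where "q = min 1 (d / (2 * (Y + 1)))"
  have q: "q > 0" "q \<le> 1" "q * Y < d"
  proof -
    show "q > 0" "q \<le> 1" using d(1) Y by (auto simp: q_def)
    have "q * Y \<le> d / (2 * (Y + 1)) * Y" using Y by (intro mult_right_mono) (auto simp: q_def)
    also have "\<dots> < d" using d(1) Y by (simp add: field_simps) (smt (verit) mult_nonneg_nonneg)
    finally show "q * Y < d" .
  qed
  obtain r where r: "r > 0" "\<And>t. dist t t\<^sub>0 < r \<Longrightarrow> dist (?M t) (?M t\<^sub>0) < q"
    using gap_matrix_continuous[OF inj pd] q(1) unfolding continuous_at_eps_delta by blast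
  show ?thesis
  proof (rule that[of "r / 2" B])
    show "r / 2 > 0" using r by simp
    fix n :: nat and x mf mb
    assume n: "n > 0" and mf: "is_arg_max (loglik n x) (\<lambda>\<theta>. posdef (Sig \<theta>)) mf"
      and mb: "is_arg_max (\<lambda>t. loglik n x (zero_ext e t)) (\<lambda>t. posdef (Sig (zero_ext e t))) mb"
      and mbr: "dist mb t\<^sub>0 \<le> r / 2" and s: "norm ((1 / sqrt (real n)) *\<^sub>R grad (loglik n x) (zero_ext e t\<^sub>0))
        \<le> R"
    define y where "y = matrix_inv H *v ((1 / sqrt (real n)) *\<^sub>R grad (loglik n x) (zero_ext e t\<^sub>0))"
    have y: "norm y \<le> Y"
      unfolding y_def Y_def using s by (intro order_trans[OF norm_matrix_vector_mult_le] mult_left_mono) auto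
    have yS: "y = sqrt (real n) *\<^sub>R (theta (sample_cov n x) - zero_ext e t\<^sub>0)"
      unfolding y_def H_def by (rule score_eq[OF n pd])
    have "mb - band_part e mf = ?M mb *v (theta (sample_cov n x) - zero_ext e t\<^sub>0)"
      using mle_gap_eq[OF inj n mb, of t\<^sub>0] mle_full_eq[OF n mf] by (simp add: mle_gap_matrix)
    then have T: "sqrt (real n) *\<^sub>R (mb - band_part e mf) = ?M mb *v y"
      unfolding yS by (simp only: matrix_vector_mult_scaleR)
    have Mq: "norm (?M mb - ?M t\<^sub>0) < q" using r(2)[of mb] mbr r(1) by (simp add: dist_norm)
    have "norm (?M mb) \<le> norm (?M t\<^sub>0) + 1" using Mq q(2) norm_triangle_sub[of "?M mb" "?M t\<^sub>0"] by linarith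
    then have b1: "norm (?M mb *v y) \<le> B"
      unfolding B_def using y by (intro order_trans[OF norm_matrix_vector_mult_le] mult_mono) auto
    have b2: "norm (?M t\<^sub>0 *v y) \<le> B"
      unfolding B_def using y by (intro order_trans[OF norm_matrix_vector_mult_le] mult_mono) auto
    have "dist (?M mb *v y) (?M t\<^sub>0 *v y) = norm ((?M mb - ?M t\<^sub>0) *v y)"
      by (simp add: dist_norm matrix_vector_mult_diff_rdistrib)
    also have "\<dots> \<le> norm (?M mb - ?M t\<^sub>0) * norm y" by (rule norm_matrix_vector_mult_le)
    also have "\<dots> \<le> q * Y" using Mq y Y q(1) by (intro mult_mono) auto
    also have "\<dots> < d" by (rule q(3))
    finally have "dist (g (?M mb *v y)) (g (?M t\<^sub>0 *v y)) < \<delta>" by (rule d(2)[OF b2 b1])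
    then show "norm (sqrt (real n) *\<^sub>R (mb - band_part e mf)) \<le> B \<and>
       \<bar>g (sqrt (real n) *\<^sub>R (mb - band_part e mf))
         - g (mle_gap e H (matrix_inv H *v ((1 / sqrt (real n)) *\<^sub>R grad (loglik n x) (zero_ext e t\<^sub>0))))\<bar> \<le> \<delta>"
      unfolding T y_def[symmetric] mle_gap_matrix H_def[symmetric] using b1 by (simp add: dist_real_def H_def)
  qed
qed

theorem theorem3p3:
  fixes k :: nat
    and \<alpha> :: real
    and \<Sigma>\<^sub>0 B\<^sub>0 :: "('p::{finite,linorder}) sqmat"
    and e :: "'b::finite \<Rightarrow> 'p upper"
    and \<nu>\<^sub>0 :: real
    and \<epsilon> :: "nat \<Rightarrow> real"
    and \<pi>c :: "'b rvec \<Rightarrow> real"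
    and mle_full :: "nat \<Rightarrow> (nat \<Rightarrow> 'p rvec) \<Rightarrow> 'p param"
    and mle_band :: "nat \<Rightarrow> (nat \<Rightarrow> 'p rvec) \<Rightarrow> 'b rvec"
    and C :: "nat \<Rightarrow> (nat \<Rightarrow> 'p rvec) \<Rightarrow> 'b rvec set"
  defines "\<theta>\<^sub>0 \<equiv> zero_ext e (theta1 e \<Sigma>\<^sub>0)"
  assumes k: "0 < k" "k \<le> CARD('p)"
    and \<alpha>: "0 < \<alpha>" "\<alpha> < 1"
    and \<Sigma>\<^sub>0: "posdef \<Sigma>\<^sub>0" "k_banded k \<Sigma>\<^sub>0"
    and e: "bij_betw e UNIV (band k)"
    and initial_prior: "\<nu>\<^sub>0 > 2 * real CARD('p)" "posdef B\<^sub>0"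
    and conventional_prior: "banded_prior e \<pi>c"
    and \<epsilon>: "\<And>n. \<epsilon> n > 0" "decseq \<epsilon>" "\<epsilon> \<longlonglongrightarrow> 0"
    and mle_full_measurable: "\<And>n. mle_full n \<in> borel_measurable (\<Pi>\<^sub>M i\<in>{..<n}. borel)"
    and mle_full: "with_high_prob (sampling \<Sigma>\<^sub>0)
      (\<lambda>n x. is_arg_max (loglik n x) (\<lambda>\<theta>. posdef (Sig \<theta>)) (mle_full n x))"
    and mle_band_measurable: "\<And>n. mle_band n \<in> borel_measurable (\<Pi>\<^sub>M i\<in>{..<n}. borel)"
    and mle_band: "with_high_prob (sampling \<Sigma>\<^sub>0)
      (\<lambda>n x. is_arg_max (\<lambda>\<theta>\<^sub>1. loglik n x (zero_ext e \<theta>\<^sub>1)) (\<lambda>\<theta>\<^sub>1. posdef (Sig (zero_ext e \<theta>\<^sub>1)))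
               (mle_band n x))"
    and A1_ppp0: "(\<lambda>n. \<integral>x. tv_dist
        (rescaled n (ppp0_posterior e B\<^sub>0 \<nu>\<^sub>0 n x) (band_part e (mle_full n x)))
        (mvn (matrix_inv (fisher11_2 e \<theta>\<^sub>0))) \<partial>sampling \<Sigma>\<^sub>0 n) \<longlonglongrightarrow> 0"
    and A1_conventional: "(\<lambda>n. \<integral>x. tv_dist
        (rescaled n (conventional_posterior e \<pi>c n x) (mle_band n x))
        (mvn (matrix_inv (fisher11 e \<theta>\<^sub>0))) \<partial>sampling \<Sigma>\<^sub>0 n) \<longlonglongrightarrow> 0"
    and A2_score: "conv_in_distr (sampling \<Sigma>\<^sub>0)
        (\<lambda>n x. (1 / sqrt (real n)) *\<^sub>R grad (loglik n x) \<theta>\<^sub>0) (mvn (fisher \<theta>\<^sub>0))"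
    and A2_mle_full: "conv_in_prob (sampling \<Sigma>\<^sub>0) mle_full \<theta>\<^sub>0"
    and A2_mle_band: "conv_in_prob (sampling \<Sigma>\<^sub>0) mle_band (theta1 e \<Sigma>\<^sub>0)"
    and A2_hessian: "\<And>n. AE x in sampling \<Sigma>\<^sub>0 n. isCont (hessian (loglik n x)) \<theta>\<^sub>0"
    and C_measurable: "\<And>n. {(x, t). x \<in> space (\<Pi>\<^sub>M i\<in>{..<n}. (borel :: 'p rvec measure)) \<and> t \<in> C n x}
        \<in> sets ((\<Pi>\<^sub>M i\<in>{..<n}. borel) \<Otimes>\<^sub>M borel)"
    and C: "with_high_prob (sampling \<Sigma>\<^sub>0)
        (\<lambda>n x. hpd_region \<alpha> (ppp_posterior e k \<epsilon> B\<^sub>0 \<nu>\<^sub>0 n x) (C n x))"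
  shows "(\<lambda>n. \<integral>x. measure (conventional_posterior e \<pi>c n x) (C n x) \<partial>sampling \<Sigma>\<^sub>0 n)
           \<longlonglongrightarrow> 1 - \<alpha>"
proof -
  let ?P = "sampling \<Sigma>\<^sub>0" and ?N = "\<lambda>n. \<Pi>\<^sub>M i\<in>{..<n}. (borel :: 'p rvec measure)"
  define t\<^sub>0 where "t\<^sub>0 = theta1 e \<Sigma>\<^sub>0"
  have inj: "inj e" using e by (simp add: bij_betw_def)
  have \<theta>0: "\<theta>\<^sub>0 = zero_ext e t\<^sub>0" by (simp add: \<theta>\<^sub>0_def t\<^sub>0_def)
  have Sig0: "Sig (zero_ext e t\<^sub>0) = \<Sigma>\<^sub>0"
    unfolding t\<^sub>0_def by (rule Sig_true_parameter[OF e posdefD(1)[OF \<Sigma>\<^sub>0(1)] \<Sigma>\<^sub>0(2)])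
  then have pd0: "posdef (Sig (zero_ext e t\<^sub>0))" using \<Sigma>\<^sub>0(1) by simp
  have prob: "prob_space (?P n)" for n by (rule prob_space_sampling[OF \<Sigma>\<^sub>0(1)])
  define H where "H = info (matrix_inv (Sig (zero_ext e t\<^sub>0)))"
  have fisher: "fisher \<theta>\<^sub>0 = H" unfolding \<theta>0 H_def by (rule fisher_eq_info[OF pd0])
  have H: "posdef H" unfolding H_def by (rule posdef_info[OF pd0])
  define V\<^sub>1 where "V\<^sub>1 = block e (matrix_inv H)"
  define V\<^sub>2 where "V\<^sub>2 = matrix_inv (block e H)"
  have V1: "posdef V\<^sub>1" unfolding V\<^sub>1_def by (rule posdef_block[OF posdef_matrix_inv[OF H] inj])
  have V2: "posdef V\<^sub>2" unfolding V\<^sub>2_def by (rule posdef_matrix_inv[OF posdef_block[OF H inj]])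
  have V1_eq: "matrix_inv (fisher11_2 e \<theta>\<^sub>0) = V\<^sub>1"
    unfolding V\<^sub>1_def using matrix_inv_fisher11_2[OF _ inj, of \<theta>\<^sub>0] H by (simp add: fisher)
  have V2_eq: "matrix_inv (fisher11 e \<theta>\<^sub>0) = V\<^sub>2" unfolding V\<^sub>2_def fisher11_eq fisher ..
  define K where "K = V\<^sub>2 ** select e - select e ** matrix_inv H"
  have V1_V2: "V\<^sub>1 = V\<^sub>2 + K ** H ** transpose K"
    unfolding V\<^sub>1_def V\<^sub>2_def K_def by (rule mle_gap_variance[OF H inj])
  have gapK: "mle_gap e H (matrix_inv H *v s) = K *v s" for s
    unfolding mle_gap_of_score K_def V\<^sub>2_def by (simp add: posdef_inv[OF H])
  obtain c where c: "c > 0" "measure (mvn V\<^sub>1) {x. c \<le> mvn_density V\<^sub>1 x} = 1 - \<alpha>"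
    "\<And>\<delta>. \<delta> > 0 \<Longrightarrow> \<exists>r>0. r < c \<and> measure (mvn V\<^sub>1) {x. c - r \<le> mvn_density V\<^sub>1 x \<and> mvn_density V\<^sub>1 x \<le> c + r} \<le> \<delta>"
    by (rule mvn_hpd_threshold[OF V1 \<alpha>]) (rule that)
  define E where "E = {x. c \<le> mvn_density V\<^sub>1 x}"
  have Em: "E \<in> sets borel" unfolding E_def by measurable
  define g where "g t = measure (mvn V\<^sub>2) {z. z + t \<in> E}" for t
  have gcont: "continuous_on UNIV g"
    unfolding g_def[abs_def] E_def by (rule mvn_shifted_probability_continuous[OF V1 V2])
  have g01: "0 \<le> g t" "g t \<le> 1" for t
    unfolding g_def using prob_space.prob_le_1[OF prob_space_mvn[OF V2]] by auto
  have gm[measurable]: "g \<in> borel_measurable borel" by (rule borel_measurable_continuous_onI[OF gcont])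
  define s where "s n x = (1 / sqrt (real n)) *\<^sub>R grad (loglik n x) \<theta>\<^sub>0" for n x
  have sm: "s n \<in> borel_measurable (?N n)" for n
    unfolding s_def[abs_def] \<theta>0 by (rule borel_measurable_score[OF pd0])
  have score: "conv_in_distr ?P s (mvn H)" using A2_score unfolding fisher s_def[abs_def] .
  define X where "X n x = measure (conventional_posterior e \<pi>c n x) (C n x)" for n x
  define Y where "Y n x = g (K *v s n x)" for n x

  \<comment> \<open>the limit experiment: averaging the shifted normal probabilities gives the exact level\<close>
  have limit: "(\<integral>y. g (K *v y) \<partial>mvn H) = 1 - \<alpha>"
  proof -
    have gK: "(\<lambda>y. g (K *v y)) \<in> borel_measurable (mvn H)" by measurable
    interpret Q2: prob_space "mvn V\<^sub>2" by (rule prob_space_mvn[OF V2])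
    interpret Q1: prob_space "mvn V\<^sub>1" by (rule prob_space_mvn[OF V1])
    have "ennreal (\<integral>y. g (K *v y) \<partial>mvn H) = (\<integral>\<^sup>+y. ennreal (g (K *v y)) \<partial>mvn H)"
    proof (rule nn_integral_eq_integral[symmetric])
      interpret QH: prob_space "mvn H" by (rule prob_space_mvn[OF H])
      show "integrable (mvn H) (\<lambda>y. g (K *v y))"
        by (rule QH.integrable_const_bound[where B=1]) (use g01 gK in \<open>auto intro!: AE_I2\<close>)
    qed (simp add: g01)
    also have "\<dots> = (\<integral>\<^sup>+y. emeasure (mvn V\<^sub>2) {z. z + K *v y \<in> E} \<partial>mvn H)"
      unfolding g_def Q2.emeasure_eq_measure ..
    also have "\<dots> = emeasure (mvn V\<^sub>1) E" by (rule mvn_convolution[OF V2 H V1 V1_V2 Em])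
    also have "\<dots> = ennreal (1 - \<alpha>)" using c(2) by (simp add: Q1.emeasure_eq_measure E_def)
    finally show ?thesis using \<alpha> g01 by (simp add: integral_nonneg)
  qed
  have "(\<lambda>n. \<integral>x. Y n x \<partial>?P n) \<longlonglongrightarrow> 1 - \<alpha>"
  proof -
    have "continuous_on UNIV (\<lambda>y. g (K *v y))"
      by (rule continuous_on_compose2[OF gcont]) (auto intro!: continuous_intros)
    moreover have "bounded (range (\<lambda>y. g (K *v y)))"
      by (intro boundedI[where B=1]) (use g01 in auto)
    ultimately show ?thesis
      using score unfolding conv_in_distr_def Y_def limit[symmetric] by blast
  qed
  moreover have "(\<lambda>n. (\<integral>x. X n x \<partial>?P n) - (\<integral>x. Y n x \<partial>?P n)) \<longlonglongrightarrow> 0"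
  proof (rule integral_diff_tendsto_0[OF prob])
    show "X n \<in> borel_measurable (?P n)" for n
    proof -
      have "(\<lambda>x. measure (normalized (conv_density e \<pi>c n x)) {t. (x, t) \<in> {(x, t). x \<in> space (?N n) \<and> t
        \<in> C n x}}) \<in> borel_measurable (?N n)"
        by (rule borel_measurable_normalized_section[OF borel_measurable_conv_density[OF conventional_prior]
          C_measurable])
      then have "X n \<in> borel_measurable (?N n)"
        unfolding X_def[abs_def] conventional_posterior_eq by (rule measurable_cong[THEN iffD1, rotated]) simp
      then show ?thesis unfolding measurable_cong_sets[OF sets_sampling refl] .
    qed
    show "Y n \<in> borel_measurable (?P n)" for n
    proof -
      note [measurable] = sm[of n]
      have "Y n \<in> borel_measurable (?N n)" unfolding Y_def[abs_def] by measurable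
      then show ?thesis unfolding measurable_cong_sets[OF sets_sampling refl] .
    qed
    show "0 \<le> X n x \<and> X n x \<le> 1" if "x \<in> space (?P n)" for n x
      using subprob_space.subprob_measure_le_1[OF subprob_space_conventional_posterior[OF conventional_prior]]
        that
      by (simp add: X_def space_sampling)
    show "0 \<le> Y n x \<and> Y n x \<le> 1" for n x by (simp add: Y_def g01)
    fix \<delta> \<eta> :: real assume \<delta>: "\<delta> > 0" and \<eta>: "\<eta> > 0"
    have d2: "\<delta> / 2 > 0" and e8: "\<eta> / 8 > 0" using \<delta> \<eta> by auto
    obtain R where R: "R > 0" "likely (\<eta> / 8) ?P (\<lambda>n x. norm (s n x) \<le> R)"
    proof (rule likely_bounded_of_conv_in_distr[OF prob _ prob_space_mvn[OF H] sets_mvn score e8])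
      show "s n \<in> borel_measurable (?P n)" for n
        using sm unfolding measurable_cong_sets[OF sets_sampling refl] .
    qed (rule that)
    obtain B r where r: "r > 0"
      "\<And>n x mf mb. \<lbrakk>n > 0; is_arg_max (loglik n x) (\<lambda>\<theta>. posdef (Sig \<theta>)) mf;
         is_arg_max (\<lambda>t. loglik n x (zero_ext e t)) (\<lambda>t. posdef (Sig (zero_ext e t))) mb;
         dist mb t\<^sub>0 \<le> r; norm (s n x) \<le> R\<rbrakk>
       \<Longrightarrow> norm (sqrt (real n) *\<^sub>R (mb - band_part e mf)) \<le> B \<and>
         \<bar>g (sqrt (real n) *\<^sub>R (mb - band_part e mf)) - g (K *v s n x)\<bar> \<le> \<delta> / 2"
      by (rule mle_difference_asymptotic[OF inj pd0 gcont R(1) d2, folded H_def \<theta>0, folded s_def, unfolded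
        gapK])
        (rule that)
    obtain \<eta>' where \<eta>': "\<eta>' > 0"
      "\<And>n P Pc t\<^sub>1 m D. \<lbrakk>n > 0; subprob_space P; sets P = sets borel; sets Pc = sets borel;
        \<And>A. A \<in> sets borel \<Longrightarrow> \<bar>measure (rescaled n P t\<^sub>1) A - measure (mvn V\<^sub>1) A\<bar> \<le> \<eta>';
        \<And>A. A \<in> sets borel \<Longrightarrow> \<bar>measure (rescaled n Pc m) A - measure (mvn V\<^sub>2) A\<bar> \<le> \<eta>';
        norm (sqrt (real n) *\<^sub>R (m - t\<^sub>1)) \<le> B; hpd_region \<alpha> P D\<rbrakk>
       \<Longrightarrow> \<bar>measure Pc D - g (sqrt (real n) *\<^sub>R (m - t\<^sub>1))\<bar> \<le> \<delta> / 2"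
      apply (rule credible_region_transfer[OF V1 V2 c d2, where B=B, folded E_def, folded g_def])
       apply assumption
      subgoal premises p
        by (rule p(1)[OF p(2)], rule p(3))
      done
    obtain l \<rho> where l: "l > 0" "\<rho> > 0" "\<And>t. dist t t\<^sub>0 \<le> \<rho> \<Longrightarrow> l \<le> lambda_min (Sig (zero_ext e t))"
      by (rule lambda_min_near[OF pd0]) (rule that)
    have e3: "\<eta>' / 3 > 0" using \<eta>'(1) by simp
    obtain R' where R': "R' > 0" "measure (mvn V\<^sub>1) {z. R' < norm z} < \<eta>' / 3"
      by (rule mvn_tail[OF V1 e3]) (rule that)
    have "eventually (\<lambda>n. \<epsilon> n < l \<and> R' \<le> sqrt (real n) * (\<rho> / 2) \<and> n > 0) sequentially"
    proof (intro eventually_conj)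
      show "eventually (\<lambda>n. \<epsilon> n < l) sequentially" using \<epsilon>(3) l(1) by (rule order_tendstoD)
      show "eventually (\<lambda>n. R' \<le> sqrt (real n) * (\<rho> / 2)) sequentially"
      proof -
        have "filterlim (\<lambda>n. sqrt (real n) * (\<rho> / 2)) at_top sequentially"
          using l(2) by (intro filterlim_at_top_mult_tendsto_pos[OF tendsto_const _ filterlim_compose[OF
            sqrt_at_top filterlim_real_sequentially]]) auto
        then show ?thesis by (simp add: filterlim_at_top)
      qed
    qed (rule eventually_gt_at_top)
    then obtain n\<^sub>0 where n0: "\<And>n. n \<ge> n\<^sub>0 \<Longrightarrow> \<epsilon> n < l \<and> R' \<le> sqrt (real n) * (\<rho> / 2) \<and> n > 0"
      by (auto simp: eventually_sequentially)
    let ?tv0 = "\<lambda>n x. tv_dist (rescaled n (ppp0_posterior e B\<^sub>0 \<nu>\<^sub>0 n x) (band_part e (mle_full n x))) (mvn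
      V\<^sub>1)"
    let ?tvc = "\<lambda>n x. tv_dist (rescaled n (conventional_posterior e \<pi>c n x) (mle_band n x)) (mvn V\<^sub>2)"
    have sQ1: "subprob_space (mvn V\<^sub>1)" and sQ2: "subprob_space (mvn V\<^sub>2)"
      using prob_space_mvn[OF V1] prob_space_mvn[OF V2] by (auto intro: prob_space_imp_subprob_space)
    have l1: "likely (\<eta> / 8) ?P (\<lambda>n x. ?tv0 n x \<le> \<eta>' / 3)"
    proof (rule likely_of_integral_tendsto_0[OF prob _ _ A1_ppp0[unfolded V1_eq] e3 e8])
      show "?tv0 n \<in> borel_measurable (?P n)" for n
        unfolding measurable_cong_sets[OF sets_sampling refl]
        by (rule borel_measurable_tv_ppp0[OF sQ1 sets_mvn mle_full_measurable])
      show "0 \<le> ?tv0 n x \<and> ?tv0 n x \<le> 1" if "x \<in> space (?P n)" for n x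
        using that by (auto intro!: tv_dist_nonneg tv_dist_le_1 subprob_space_rescaled subprob_space_ppp0 sQ1
          simp: space_sampling)
    qed
    have l2: "likely (\<eta> / 8) ?P (\<lambda>n x. ?tvc n x \<le> \<eta>')"
    proof (rule likely_of_integral_tendsto_0[OF prob _ _ A1_conventional[unfolded V2_eq] \<eta>'(1) e8])
      show "?tvc n \<in> borel_measurable (?P n)" for n
        unfolding measurable_cong_sets[OF sets_sampling refl]
        by (rule borel_measurable_tv_conventional[OF conventional_prior sQ2 sets_mvn mle_band_measurable])
      show "0 \<le> ?tvc n x \<and> ?tvc n x \<le> 1" if "x \<in> space (?P n)" for n x
        using that conventional_prior
        by (auto intro!: tv_dist_nonneg tv_dist_le_1 subprob_space_rescaled subprob_space_conventional_posterior
          sQ2 simp: space_sampling)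
    qed
    (* the selection matrix has operator norm below norm (select e) + 1, so this bounds the error of the band
      by \<rho> / 2 *)
    have l3: "likely (\<eta> / 8) ?P (\<lambda>n x. dist (mle_full n x) \<theta>\<^sub>0 \<le> \<rho> / (2 * (norm (select e) + 1)))"
    proof (rule likely_of_conv_in_prob[OF prob _ A2_mle_full _ e8])
      show "mle_full n \<in> borel_measurable (?P n)" for n
        unfolding measurable_cong_sets[OF sets_sampling refl] by (rule mle_full_measurable)
      show "0 < \<rho> / (2 * (norm (select e) + 1))" using l(2) by (simp add: add_nonneg_pos)
    qed
    have l4: "likely (\<eta> / 8) ?P (\<lambda>n x. dist (mle_band n x) t\<^sub>0 \<le> r)"
    proof (rule likely_of_conv_in_prob[OF prob _ A2_mle_band[folded t\<^sub>0_def] r(1) e8])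
      show "mle_band n \<in> borel_measurable (?P n)" for n
        unfolding measurable_cong_sets[OF sets_sampling refl] by (rule mle_band_measurable)
    qed
    note l5 = with_high_prob_likely[OF mle_full e8]
    note l6 = with_high_prob_likely[OF mle_band e8]
    note l7 = with_high_prob_likely[OF C e8]
    note all = likely_conj[OF prob l1 likely_conj[OF prob l2 likely_conj[OF prob l3 likely_conj[OF prob l4
      likely_conj[OF prob l5 likely_conj[OF prob l6 likely_conj[OF prob l7 R(2)]]]]]]]
    have "likely (\<eta> / 8 + (\<eta> / 8 + (\<eta> / 8 + (\<eta> / 8 + (\<eta> / 8 + (\<eta> / 8 + (\<eta> / 8 + \<eta> / 8))))))) ?P (\<lambda>n x. \<bar>X n x
      - Y n x\<bar> \<le> \<delta>)"
    proof (rule likely_mono[OF all])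
      fix n x
      assume n: "n \<ge> n\<^sub>0" and "x \<in> space (?P n)"
        and G: "?tv0 n x \<le> \<eta>' / 3 \<and> ?tvc n x \<le> \<eta>' \<and> dist (mle_full n x) \<theta>\<^sub>0 \<le> \<rho> / (2 * (norm (select e) + 1)) \<and>
          dist (mle_band n x) t\<^sub>0 \<le> r \<and>
          is_arg_max (loglik n x) (\<lambda>\<theta>. posdef (Sig \<theta>)) (mle_full n x) \<and>
          is_arg_max (\<lambda>\<theta>\<^sub>1. loglik n x (zero_ext e \<theta>\<^sub>1)) (\<lambda>\<theta>\<^sub>1. posdef (Sig (zero_ext e \<theta>\<^sub>1))) (mle_band n x) \<and>
          hpd_region \<alpha> (ppp_posterior e k \<epsilon> B\<^sub>0 \<nu>\<^sub>0 n x) (C n x) \<and> norm (s n x) \<le> R"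
      then have x: "x \<in> space (?N n)" by (simp add: space_sampling)
      have npos: "n > 0" and \<epsilon>l: "\<epsilon> n < l" and R'n: "R' \<le> sqrt (real n) * (\<rho> / 2)" using n0[OF n] by auto
      let ?m = "mle_band n x" and ?c = "band_part e (mle_full n x)"
      have gap: "norm (sqrt (real n) *\<^sub>R (?m - ?c)) \<le> B"
        "\<bar>g (sqrt (real n) *\<^sub>R (?m - ?c)) - g (K *v s n x)\<bar> \<le> \<delta> / 2"
        using r(2)[of n x "mle_full n x" ?m] npos G by auto
      have "?c - t\<^sub>0 = select e *v (mle_full n x - \<theta>\<^sub>0)"
      proof -
        have "band_part e \<theta>\<^sub>0 = t\<^sub>0" by (simp add: \<theta>0 band_part_def zero_ext_def vec_eq_iff inv_f_f[OF inj])
        then show ?thesis by (simp add: matrix_vector_mult_diff_distrib band_part_eq)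
      qed
      then have "dist ?c t\<^sub>0 \<le> norm (select e :: real^'p upper^'b) * dist (mle_full n x) \<theta>\<^sub>0"
        using norm_matrix_vector_mult_le[of "select e :: real^'p upper^'b" "mle_full n x - \<theta>\<^sub>0"]
          by (simp add: dist_norm)
      also have "\<dots> \<le> (norm (select e :: real^'p upper^'b) + 1) * (\<rho> / (2 * (norm (select e :: real^'p upper^'b)
        + 1)))"
        using G l(2) by (intro mult_mono) auto
      also have "\<dots> = \<rho> / 2"
      proof -
        have "norm (select e :: real^'p upper^'b) + 1 \<noteq> 0" using norm_ge_zero[of "select e :: real^'p upper^'b"]
          by linarith
        then show ?thesis by (simp add: field_simps)
      qed
      finally have cdist: "dist ?c t\<^sub>0 \<le> \<rho> / 2" .
      have near: "\<epsilon> n \<le> lambda_min (Sig (zero_ext e t))" if "dist t t\<^sub>0 \<le> \<rho>" for t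
        using l(3)[OF that] \<epsilon>l by simp
      have "\<bar>X n x - g (sqrt (real n) *\<^sub>R (?m - ?c))\<bar> \<le> \<delta> / 2"
        unfolding X_def
      proof (rule \<eta>'(2)[OF npos subprob_space_ppp[OF e x] sets_ppp(2) sets_conventional_posterior _ _ gap(1)])
        show "\<bar>measure (rescaled n (ppp_posterior e k \<epsilon> B\<^sub>0 \<nu>\<^sub>0 n x) ?c) A - measure (mvn V\<^sub>1) A\<bar> \<le> \<eta>'" if "A
          \<in> sets borel" for A
          by (rule ppp_close_to_normal[where \<epsilon>=\<epsilon> and n=n and \<rho>=\<rho> and t\<^sub>0=t\<^sub>0, OF e x near V1 npos _ cdist R'(2)
            R'n that])
            (use G in auto)
        show "\<bar>measure (rescaled n (conventional_posterior e \<pi>c n x) ?m) A - measure (mvn V\<^sub>2) A\<bar> \<le> \<eta>'" if A: "A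
          \<in> sets borel" for A
        proof -
          have "\<bar>measure (rescaled n (conventional_posterior e \<pi>c n x) ?m) A - measure (mvn V\<^sub>2) A\<bar> \<le> ?tvc n x"
            by (rule abs_diff_le_tv_dist[OF subprob_space_rescaled[OF subprob_space_conventional_posterior[OF
              conventional_prior x]
                  sets_conventional_posterior] sQ2]) (use A in simp)
          then show ?thesis using G by linarith
        qed
        show "hpd_region \<alpha> (ppp_posterior e k \<epsilon> B\<^sub>0 \<nu>\<^sub>0 n x) (C n x)" using G by blast
      qed
      then show "\<bar>X n x - Y n x\<bar> \<le> \<delta>" using gap(2) unfolding Y_def by linarith
    qed
    then show "likely \<eta> ?P (\<lambda>n x. \<bar>X n x - Y n x\<bar> \<le> \<delta>)" by simp
  qed
  ultimately have "(\<lambda>n. ((\<integral>x. X n x \<partial>?P n) - (\<integral>x. Y n x \<partial>?P n)) + (\<integral>x. Y n x \<partial>?P n)) \<longlonglongrightarrow> 0 + (1 - \<alpha>)"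
    by (intro tendsto_add)
  then show ?thesis by (simp add: X_def)
qed

end
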